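(* $\mathsf{D}_0(C_2^5)=11$ and $k_{\mathsf{D}}(C_2^5)=10$. Additionally, $\mathsf{D}_{1}(C_2^5)=6$, $\mathsf{D}_{2}(C_2^5)=10$, $\mathsf{D}_{3}(C_2^5)=13$, $\mathsf{D}_{4}(C_2^5)=16$, $\mathsf{D}_{5}(C_2^5)=19$, $\mathsf{D}_{6}(C_2^5)=21$, $\mathsf{D}_{7}(C_2^5)=23$, $\mathsf{D}_{8}(C_2^5)=26$, and $\mathsf{D}_{9}(C_2^5)=28$.
   Context: $C_2^5$ is the elementary abelian $2$-group of rank $5$. A sequence over a finite abelian group $G$ is a finite unordered list of elements with repetitions; zero-sum means its terms sum to $0$. $\mathsf{D}_k(G)$ ($k\in\mathbb{N}$) is the smallest $\ell$ such that every sequence over $G$ of length at least $\ell$ has $k$ disjoint non-empty zero-sum subsequences. It is known that there exists $\mathsf{D}_0(G)\in\mathbb{N}_0$ with $\mathsf{D}_k(G)=\mathsf{D}_0(G)+k\exp(G)$ for all sufficiently large $k$; $k_{\mathsf{D}}(G)$ is the minimal $k_0\in\mathbb{N}$ with $\mathsf{D}_k(G)=\mathsf{D}_0(G)+k\exp(G)$ for all $k\ge k_0$. *)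

theory Defs
  imports "HOL-Analysis.Finite_Cartesian_Product" "HOL-Library.Multiset" "HOL-Library.Z2"
begin

instance bit :: finite
proof
  have "(UNIV :: bit set) = {0, 1}" by (auto intro: bit.exhaust)
  then show "finite (UNIV :: bit set)" by (metis finite.emptyI finite.insertI)
qed

text \<open>Sequences over an abelian group G are finite multisets over G.
  A sequence S has k disjoint non-empty zero-sum subsequences.\<close>
definition has_k_disjoint_zs :: "nat \<Rightarrow> ('a::ab_group_add) multiset \<Rightarrow> bool" where
  "has_k_disjoint_zs k S \<longleftrightarrow>
     (\<exists>T :: nat \<Rightarrow> 'a multiset.
        (\<forall>i<k. T i \<noteq> {#} \<and> sum_mset (T i) = 0) \<and> (\<Sum>i<k. T i) \<subseteq># S)"

definition Dk :: "'a::{ab_group_add,finite} itself \<Rightarrow> nat \<Rightarrow> nat" where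
  "Dk G k = (LEAST l. \<forall>S :: 'a multiset. l \<le> size S \<longrightarrow> has_k_disjoint_zs k S)"

definition grp_exp :: "'a::{ab_group_add,finite} itself \<Rightarrow> nat" where
  "grp_exp G = (LEAST n. n > 0 \<and> (\<forall>g::'a. (\<Sum>_<n. g) = 0))"

definition D0 :: "'a::{ab_group_add,finite} itself \<Rightarrow> nat" where
  "D0 G = (THE d. \<exists>K. \<forall>k\<ge>K. Dk G k = d + k * grp_exp G)"

definition kD :: "'a::{ab_group_add,finite} itself \<Rightarrow> nat" where
  "kD G = (LEAST k0. 1 \<le> k0 \<and> (\<forall>k\<ge>k0. Dk G k = D0 G + k * grp_exp G))"

abbreviation C2_5 :: "(bit ^ 5) itself" where "C2_5 \<equiv> TYPE(bit ^ 5)"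

end

theory Submission
  imports Defs
begin

text \<open>Zeros and pairs of equal terms can be split off a sequence as zero-sum blocks, so everything
  depends on how many disjoint zero-sum subsets a set \<open>A\<close> of \<open>n \<le> 31\<close> nonzero elements must have: one
  more for each of \<open>n = 6, 10, 13, 16, 19, 21, 23, 26, 28, 31\<close>. A set of more than 16 elements
  contains a line \<open>{x, y, x + y}\<close>, which can be removed; pigeonhole arguments settle
  \<open>n = 6, 10, 13, 16\<close>. For \<open>n = 21, 23, 28, 31\<close> the complement has at most ten points, and all sets of
  at most ten points are enumerated up to linear equivalence.

  For the lower bounds, points are weighted so that every zero-sum block is heavy; a packing of the
  forbidden size would leave over at most one term, but the sum of the whole set is neither 0 nor
  one of its elements.\<close>

section \<open>Packings of zero-sum subsets\<close>

text \<open>A block avoiding 0 has at least three elements, so a line is the cheapest one. Removing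
  it gains a block whenever the threshold has grown by three: 19 from 16, 26 from 23, and also 13
  and 16 for sets that contain a line. Below 17 elements the obstacle is sum-freeness, where
  translation-invariant subsets supply quadruples instead. The thresholds 21, 23 and 28 exceed their
  predecessors by only two, which does not pay for a line; this is why enumeration takes over there,
  and passing to complements keeps it to sets of 10, 8 and 3 points.

  The constants 11 and 10 both come from sets of 30 nonzero elements, which need not have more than
  nine blocks. Adding \<open>k - 10\<close> pairs gives a sequence of \<open>2 * k + 10\<close>
  terms without \<open>k\<close> blocks, and this construction makes sense only from
  \<open>k = 10\<close> on; at \<open>k = 9\<close> the true value is 28, one below the linear
  formula.\<close>

lemma has_k_disjoint_zs_0: "has_k_disjoint_zs 0 S"
  by (simp add: has_k_disjoint_zs_def)

lemma has_k_disjoint_zs_mono: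
  "has_k_disjoint_zs k S \<Longrightarrow> S \<subseteq># S' \<Longrightarrow> has_k_disjoint_zs k S'"
  unfolding has_k_disjoint_zs_def by (meson subset_mset.order_trans)

lemma has_k_disjoint_zs_Suc:
  assumes "X \<noteq> {#}" "sum_mset X = 0" "has_k_disjoint_zs k S"
  shows "has_k_disjoint_zs (Suc k) (X + S)"
proof -
  from assms(3) obtain T where T: "\<forall>i<k. T i \<noteq> {#} \<and> sum_mset (T i) = 0" "(\<Sum>i<k. T i) \<subseteq># S"
    unfolding has_k_disjoint_zs_def by blast
  have "(\<Sum>i<Suc k. (T(k := X)) i) = X + (\<Sum>i<k. T i)"
    by (simp add: add.commute)
  then show ?thesis
    unfolding has_k_disjoint_zs_def using T assms(1,2)
    by (intro exI[of _ "T(k := X)"]) (auto simp: less_Suc_eq)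
qed

lemma has_k_disjoint_zs_le:
  assumes "has_k_disjoint_zs k S" "j \<le> k"
  shows "has_k_disjoint_zs j S"
proof -
  from assms(1) obtain T where T: "\<forall>i<k. T i \<noteq> {#} \<and> sum_mset (T i) = 0" "(\<Sum>i<k. T i) \<subseteq># S"
    unfolding has_k_disjoint_zs_def by blast
  have "(\<Sum>i<k. T i) = (\<Sum>i<j. T i) + (\<Sum>i=j..<k. T i)"
    using assms(2) by (metis atLeast0LessThan le0 sum.atLeastLessThan_concat)
  then have "(\<Sum>i<j. T i) \<subseteq># S"
    using T(2) by (metis mset_subset_eq_add_left subset_mset.order_trans)
  then show ?thesis
    unfolding has_k_disjoint_zs_def using T(1) assms(2) by (meson order_less_le_trans)
qed

abbreviation packs :: "nat \<Rightarrow> 'a::{ab_group_add,finite} set \<Rightarrow> bool" where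
  "packs k A \<equiv> has_k_disjoint_zs k (mset_set A)"

lemma packs_mono: "packs k A \<Longrightarrow> A \<subseteq> B \<Longrightarrow> packs k B"
  by (rule has_k_disjoint_zs_mono) (auto intro: subset_imp_msubset_mset_set)

lemma packs_Suc:
  fixes A :: "'a::{ab_group_add,finite} set"
  assumes "X \<subseteq> A" "X \<noteq> {}" "\<Sum>X = 0" "packs k (A - X)"
  shows "packs (Suc k) A"
proof -
  have "mset_set A = mset_set X + mset_set (A - X)"
    using assms(1) by (metis Diff_disjoint Diff_partition finite mset_set_Union)
  moreover have "sum_mset (mset_set X) = 0"
    using assms(3) sum_unfold_sum_mset[of "\<lambda>x. x" X] by simp
  ultimately show ?thesis
    using has_k_disjoint_zs_Suc[OF _ _ assms(4), of "mset_set X"] assms(2)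
    by (simp add: mset_set_empty_iff)
qed

text \<open>In an elementary 2-group the case \<open>x = y\<close> says that 0 is not in
  \<open>A\<close>. These are thus the sets of nonzero elements that contain no projective line
  \<open>{x, y, x + y}\<close>.\<close>

definition sum_free :: "'a::ab_group_add set \<Rightarrow> bool" where
  "sum_free A \<longleftrightarrow> (\<forall>x\<in>A. \<forall>y\<in>A. x + y \<notin> A)"

section \<open>Blocks in elementary abelian 2-groups\<close>

locale elementary_two_group =
  fixes G :: "'a::{ab_group_add,finite} itself"
  assumes double_zero: "(x::'a) + x = 0"
begin

lemma add_cancel2 [simp]: "(x::'a) + (x + y) = y" "x + y + y = x"
  by (metis add.assoc add_0 double_zero, metis add.assoc add_0_right double_zero)

lemma add_eq_0: "(x::'a) + y = 0 \<longleftrightarrow> x = y"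
  by (metis add.right_cancel double_zero)

text \<open>The common elements contribute the same to both sums and cancel; the two remainders have
  equal sums, which add up to 0. This turns a collision of subset sums into a block.\<close>

lemma sum_sym_diff:
  assumes "\<Sum>Y = (\<Sum>Z :: 'a)"
  shows "\<Sum>((Y - Z) \<union> (Z - Y)) = 0"
proof -
  have "\<Sum>Y = \<Sum>(Y - Z) + \<Sum>(Y \<inter> Z)" "\<Sum>Z = \<Sum>(Z - Y) + \<Sum>(Y \<inter> Z)"
    by (metis finite sum.Int_Diff add.commute, metis Int_commute finite sum.Int_Diff add.commute)
  with assms have "\<Sum>(Y - Z) = \<Sum>(Z - Y)" by simp
  moreover have "\<Sum>((Y - Z) \<union> (Z - Y)) = \<Sum>(Y - Z) + \<Sum>(Z - Y)"
    by (rule sum.union_disjoint) auto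
  ultimately show ?thesis by (simp add: double_zero)
qed

lemma zero_sum_card_ge_3:
  fixes X :: "'a set"
  assumes "\<Sum>X = 0" "X \<noteq> {}" "0 \<notin> X"
  shows "card X \<ge> 3"
proof (rule ccontr)
  assume "\<not> card X \<ge> 3"
  moreover have "card X \<noteq> 0" using assms by simp
  ultimately consider "card X = 1" | "card X = 2" by linarith
  then show False
  proof cases
    case 1
    then show ?thesis using assms by (auto simp: card_1_singleton_iff)
  next
    case 2
    then obtain x y where "X = {x, y}" "x \<noteq> y" by (auto simp: card_2_iff)
    then show ?thesis using assms(1) add_eq_0 by simp
  qed
qed

text \<open>\<open>P\<close> is a union of pairs \<open>{a, a + t}\<close>, each with sum
  \<open>t\<close>, so any two of these pairs form a zero-sum quadruple.\<close>

lemma packs_translation_invariant: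
  fixes P :: "'a set"
  assumes "t \<noteq> 0" "\<forall>a\<in>P. a + t \<in> P" "4 * k \<le> card P"
  shows "packs k P"
  using assms(2,3)
proof (induction k arbitrary: P)
  case 0
  then show ?case by (simp add: has_k_disjoint_zs_0)
next
  case (Suc k)
  then obtain a where a: "a \<in> P" by fastforce
  have "\<not> P \<subseteq> {a, a + t}"
    using Suc.prems(2) card_mono[of "{a, a + t}" P] card_insert_le_m1[of 2 "{a + t}" a] by auto
  then obtain b where b: "b \<in> P" "b \<noteq> a" "b \<noteq> a + t" by auto
  let ?X = "{a, a + t, b, b + t}"
  have ne: "a + t \<noteq> a" "b + t \<noteq> b" "a + t \<noteq> b + t" "a \<noteq> b + t"
    using assms(1) b by (auto simp: add_cancel2)
  then have "\<Sum>?X = a + (a + t + (b + (b + t)))" "card ?X = 4"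
    using b by auto
  moreover from this(1) have "\<Sum>?X = 0" by (simp add: add.assoc double_zero)
  moreover have sub: "?X \<subseteq> P" using a b Suc.prems(1) by auto
  moreover have "packs k (P - ?X)"
  proof (rule Suc.IH)
    show "\<forall>c\<in>P - ?X. c + t \<in> P - ?X"
      using Suc.prems(1) by (auto simp: add_cancel2)
    have "card (P - ?X) = card P - 4"
      using sub \<open>card ?X = 4\<close> by (metis card_Diff_subset finite)
    then show "4 * k \<le> card (P - ?X)" using Suc.prems(2) by simp
  qed
  ultimately show ?case using packs_Suc[of ?X P k] by blast
qed

text \<open>Translation by \<open>t\<close> is an involution of \<open>P\<close> without fixed
  points.\<close>

lemma even_card_translation_invariant:
  fixes P :: "'a set"
  assumes "t \<noteq> 0" "\<forall>a\<in>P. a + t \<in> P"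
  shows "even (card P)"
  using finite[of P] assms(2)
proof (induction P rule: finite_psubset_induct)
  case (psubset P)
  show ?case
  proof (cases "P = {}")
    case False
    then obtain a where a: "a \<in> P" by auto
    have ne: "a + t \<noteq> a" using assms(1) by simp
    have "even (card (P - {a, a + t}))"
    proof (rule psubset.IH)
      show "\<forall>c\<in>P - {a, a + t}. c + t \<in> P - {a, a + t}"
        using psubset.prems by auto
    qed (use a in auto)
    moreover have "card (P - {a, a + t}) = card P - 2"
      using a ne psubset.prems by (subst card_Diff_subset) auto
    moreover have "card P \<ge> 2"
      using a ne psubset.prems card_mono[of P "{a, a + t}"] by simp
    ultimately show ?thesis by simp
  qed simp
qed

text \<open>A failure of sum-freeness exhibits a line, whose three elements are distinct because 0
  is not in \<open>A\<close>. The hypothesis \<open>smaller\<close> covers every subset missing at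
  most three elements, so a caller need not know which line was removed.\<close>

lemma packs_Suc_line:
  fixes A :: "'a set"
  assumes "0 \<notin> A" "\<not> sum_free A"
    and smaller: "\<And>A'. A' \<subseteq> A \<Longrightarrow> card A \<le> card A' + 3 \<Longrightarrow> packs k A'"
  shows "packs (Suc k) A"
proof -
  obtain x y where xy: "x \<in> A" "y \<in> A" "x + y \<in> A"
    using assms(2) by (auto simp: sum_free_def)
  have ne: "x \<noteq> y" "x \<noteq> 0" "y \<noteq> 0" using xy assms(1) double_zero by metis+
  have "\<Sum>{x, y, x + y} = 0"
    using ne by (simp add: double_zero add.assoc[symmetric, of x y])
  moreover have "packs k (A - {x, y, x + y})"
    using ne xy by (intro smaller) (auto simp: card_Diff_subset)
  ultimately show ?thesis using xy packs_Suc[of "{x, y, x + y}" A k] by auto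
qed

end

section \<open>Rank five: thresholds obtained by pigeonhole and by removing lines\<close>

locale elementary_two_group_32 = elementary_two_group G
  for G :: "'a::{ab_group_add,finite} itself" +
  assumes card_UNIV: "CARD('a) = 32"
begin

text \<open>Six elements have 64 subsets but there are only 32 possible sums; two subsets with the
  same sum give a block, their symmetric difference.\<close>

lemma packs_1:
  fixes A :: "'a set"
  assumes "card A \<ge> 6"
  shows "packs 1 A"
proof -
  have "(2::nat) ^ 6 \<le> 2 ^ card A" using assms by (intro power_increasing) auto
  then have "64 \<le> card (Pow A)" by (simp add: card_Pow)
  then have "\<not> inj_on (\<lambda>X. \<Sum>X) (Pow A)"
    using card_inj_on_le[of "\<lambda>X. \<Sum>X" "Pow A" UNIV] card_UNIV by auto
  then obtain Y Z where YZ: "Y \<subseteq> A" "Z \<subseteq> A" "\<Sum>Y = \<Sum>Z" "Y \<noteq> Z"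
    by (auto simp: inj_on_def)
  then have "packs (Suc 0) A"
    using sum_sym_diff[OF YZ(3)]
    by (intro packs_Suc[of "(Y - Z) \<union> (Z - Y)"]) (auto simp: has_k_disjoint_zs_0)
  then show ?thesis by simp
qed

text \<open>Two of the 55 pairs of elements of \<open>A \<union> {0}\<close> have equal sums, which yields a zero-sum set of at
  most four elements of \<open>A\<close>; six elements remain.\<close>

lemma packs_2:
  fixes A :: "'a set"
  assumes "card A \<ge> 10" "0 \<notin> A"
  shows "packs 2 A"
proof -
  let ?P = "{Y. Y \<subseteq> insert 0 A \<and> card Y = 2}"
  have "card ?P = card (insert 0 A) choose 2" by (rule n_subsets) simp
  also have "\<dots> \<ge> 11 choose 2" using assms by (intro binomial_right_mono) auto
  finally have "card ?P \<ge> 55" by (simp add: choose_two)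
  then have "\<not> inj_on (\<lambda>X. \<Sum>X) ?P"
    using card_inj_on_le[of "\<lambda>X. \<Sum>X" ?P UNIV] card_UNIV by auto
  then obtain Y Z where YZ: "Y \<in> ?P" "Z \<in> ?P" "\<Sum>Y = \<Sum>Z" "Y \<noteq> Z"
    unfolding inj_on_def by blast
  let ?D = "(Y - Z) \<union> (Z - Y)"
  let ?X = "?D - {0}"
  have "card (Y - Z) = card (Z - Y)"
    using YZ card_Diff_subset_Int[of Y Z] card_Diff_subset_Int[of Z Y] by (simp add: Int_commute)
  moreover have "Y - Z \<noteq> {}"
    using YZ card_subset_eq[of Z Y] by auto
  then have "card (Y - Z) \<noteq> 0" by simp
  moreover have "card (Y - Z) \<le> 2"
    using YZ(1) card_mono[of Y "Y - Z"] by auto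
  moreover have "card ?D = card (Y - Z) + card (Z - Y)"
    by (rule card_Un_disjoint) auto
  ultimately have D: "2 \<le> card ?D" "card ?D \<le> 4" by linarith+
  have "card ?X \<le> 4" using D(2) card_mono[of ?D ?X] by auto
  \<comment> \<open>Dropping 0 does not change the sum, and since \<open>?D\<close> has at least two
    elements something remains.\<close>
  have "?X \<noteq> {}" using D(1) card_mono[of "{0}" ?D] by auto
  moreover have "?X \<subseteq> A" using YZ by auto
  moreover have "\<Sum>?X = 0"
    using sum_sym_diff[OF YZ(3)] by (simp add: sum_diff1)
  moreover have "packs 1 (A - ?X)"
  proof (rule packs_1)
    have "card (A - ?X) = card A - card ?X" using \<open>?X \<subseteq> A\<close> by (intro card_Diff_subset) auto
    then show "6 \<le> card (A - ?X)" using assms(1) \<open>card ?X \<le> 4\<close> by linarith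
  qed
  ultimately have "packs (Suc 1) A" using packs_Suc[of ?X A 1] by blast
  then show ?thesis by (simp only: Suc_1)
qed

text \<open>For \<open>a\<close> in \<open>A\<close> the translate of \<open>A\<close> by
  \<open>a\<close> is disjoint from \<open>A\<close>, so two copies of \<open>A\<close> fit into 32
  elements.\<close>

lemma sum_free_card:
  fixes A :: "'a set"
  assumes "sum_free A"
  shows "card A \<le> 16"
proof (cases "A = {}")
  case False
  then obtain a where "a \<in> A" by auto
  then have "A \<inter> (+) a ` A = {}" using assms by (auto simp: sum_free_def)
  then have "card (A \<union> (+) a ` A) = card A + card A"
    by (subst card_Un_disjoint) (auto simp: card_image)
  then show ?thesis
    using card_mono[of UNIV "A \<union> (+) a ` A"] card_UNIV by simp
qed simp

text \<open>Every translate of \<open>A\<close> by an element of \<open>A\<close> is the complement of \<open>A\<close>.\<close>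

lemma sum_free_16_invariant:
  fixes A :: "'a set"
  assumes "sum_free A" "card A = 16" "u \<in> A" "v \<in> A" "x \<in> A"
  shows "x + (u + v) \<in> A"
proof (rule ccontr)
  assume "x + (u + v) \<notin> A"
  moreover have "(+) v ` A = - A"
  proof (rule card_subset_eq)
    show "(+) v ` A \<subseteq> - A" using assms by (auto simp: sum_free_def)
    show "card ((+) v ` A) = card (- A)"
      using assms(2) card_UNIV by (simp add: card_image Compl_eq_Diff_UNIV card_Diff_subset)
  qed simp
  ultimately obtain y where "y \<in> A" "x + (u + v) = v + y" by blast
  then have "y = x + u" by (metis add.assoc add.commute add.left_cancel)
  then show False using \<open>y \<in> A\<close> assms by (auto simp: sum_free_def)
qed

text \<open>In the sum-free case, some \<open>s\<close> is the sum of at least five pairs in \<open>B\<close>. Six pairs give three zero-sum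
  quadruples. With five pairs and three remaining elements \<open>u\<close>, \<open>v\<close>, \<open>w\<close>, either \<open>u + v + w = s\<close>, or
  \<open>B \<union> (s + B)\<close> is sum-free with 16 elements and \<open>u + v\<close> is the sum of six pairs.\<close>

lemma packs_3:
  fixes A :: "'a set"
  assumes "card A \<ge> 13" "0 \<notin> A"
  shows "packs 3 A"
proof (cases "sum_free A")
  case False
  have "packs (Suc 2) A"
  proof (rule packs_Suc_line[OF assms(2) False])
    fix A' :: "'a set" assume "A' \<subseteq> A" "card A \<le> card A' + 3"
    then show "packs 2 A'" using assms by (intro packs_2) auto
  qed
  then show ?thesis by simp
next
  case True
  obtain B where B: "B \<subseteq> A" "card B = 13"
    using assms(1) obtain_subset_with_card_n by metis
  have "packs 3 B"
  proof -
    have 0: "0 \<notin> B" and sf: "x \<in> B \<Longrightarrow> y \<in> B \<Longrightarrow> x + y \<notin> B" for x y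
      using True B assms by (auto simp: sum_free_def)
    \<comment> \<open>For \<open>s \<noteq> 0\<close>, \<open>N s\<close> is the union of the pairs
      in \<open>B\<close> with sum \<open>s\<close>, hence has twice as many elements as there are
      such pairs.\<close>
    define N where "N s = {a\<in>B. a + s \<in> B}" for s
    have N_inv: "\<forall>a\<in>N s. a + s \<in> N s" for s by (auto simp: N_def)
    have packs_N: "packs 3 B" if "s \<noteq> 0" "12 \<le> card (N s)" for s
      using packs_translation_invariant[of s "N s" 3] that N_inv
      by (intro packs_mono[of 3 "N s" B]) (auto simp: N_def)
    \<comment> \<open>Double counting of the 169 ordered pairs by their sum: \<open>s = 0\<close>
      accounts for 13, the elements of \<open>B\<close> for none by sum-freeness, and the other 18
      values would account for at most 8 each, which gives only 157.\<close>
    have "\<exists>s. s \<noteq> 0 \<and> 8 < card (N s)"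
    proof (rule ccontr)
      assume "\<not> ?thesis"
      then have le: "card (N s) \<le> 8" if "s \<noteq> 0" for s using that by (meson not_le)
      have "(\<Sum>s\<in>UNIV. card (N s)) = card (SIGMA s:UNIV. N s)" by simp
      also have "(SIGMA s:UNIV. N s) = (\<lambda>(a, b). (a + b, a)) ` (B \<times> B)"
      proof (intro equalityI subsetI)
        fix z assume "z \<in> (SIGMA s:UNIV. N s)"
        then obtain s a where "z = (s, a)" "a \<in> B" "a + s \<in> B" by (auto simp: N_def)
        then show "z \<in> (\<lambda>(a, b). (a + b, a)) ` (B \<times> B)"
          by (intro image_eqI[of _ _ "(a, a + s)"]) auto
      qed (auto simp: N_def)
      also have "card \<dots> = 169"
        by (subst card_image) (auto simp: inj_on_def B(2))
      finally have total: "(\<Sum>s\<in>UNIV. card (N s)) = 169" .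
      have NB: "N s = {}" if "s \<in> B" for s using that sf by (auto simp: N_def)
      have "N 0 = B" by (simp add: N_def)
      then have "card (N s) \<le> (if s = 0 then 13 else if s \<in> B then 0 else 8)" for s
        using le[of s] NB[of s] B(2) by simp
      then have "(\<Sum>s\<in>UNIV. card (N s)) \<le> (\<Sum>s\<in>UNIV. (if s = 0 then 13 else if s \<in> B then 0 else 8))"
        by (intro sum_mono)
      also have "\<dots> = 13 + (\<Sum>s\<in>UNIV - {0}. (if s \<in> B then 0 else 8))"
        by (subst sum.remove[of _ "0::'a"]) auto
      also have "(\<Sum>s\<in>UNIV - {0}. (if s \<in> B then 0 else 8)) = (\<Sum>s\<in>UNIV - insert 0 B. 8::nat)"
        by (rule sum.mono_neutral_cong_right) auto
      also have "\<dots> = 8 * 18"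
        using 0 B(2) card_UNIV by (simp add: card_Diff_subset)
      finally show False using total by simp
    qed
    then obtain s where s: "s \<noteq> 0" "8 < card (N s)" by blast
    show ?thesis
    proof (cases "12 \<le> card (N s)")
      case True
      then show ?thesis using packs_N s by blast
    next
      case False
      let ?U = "B - N s" and ?Q = "B \<union> (+) s ` B"
      \<comment> \<open>More than 8, less than 12 and even leaves only 10, that is, five
        pairs.\<close>
      have "even (card (N s))" using even_card_translation_invariant N_inv s by blast
      with s False have cN: "card (N s) = 10" by presburger
      have "N s \<subseteq> B" by (auto simp: N_def)
      then have "card ?U = 3" using cN B(2) by (simp add: card_Diff_subset)
      then obtain u v w where U: "?U = {u, v, w}" "u \<noteq> v" "u \<noteq> w" "v \<noteq> w"
        by (auto simp: card_3_iff)
      then have uvw: "u \<in> B" "v \<in> B" "w \<in> B" "u \<notin> N s" "v \<notin> N s" "w \<notin> N s" by blast+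
      obtain x where x: "x \<in> N s" using cN by fastforce
      then have sB: "s \<notin> B" using sf by (auto simp: N_def)
      show ?thesis
      proof (cases "u + v + w = s")
        case True
        \<comment> \<open>One pair \<open>x\<close>, \<open>x + s\<close> joins the three leftover
          elements to a block of five, since both parts have sum \<open>s\<close>; the other four
          pairs form two quadruples.\<close>
        let ?X = "{u, v, w, x, x + s}"
        have "x + s \<in> N s" using x N_inv by blast
        have dist: "u \<notin> {v, w, x, x + s}" "v \<notin> {w, x, x + s}" "w \<notin> {x, x + s}"
          using U(2-4) uvw(4-6) x \<open>x + s \<in> N s\<close> by auto
        have "x + s \<noteq> x" using s by simp
        then have "\<Sum>?X = u + (v + (w + (x + (x + s))))" using dist by simp
        also have "\<dots> = (u + v + w) + s" by (simp add: add.assoc)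
        finally have "\<Sum>?X = 0" using True by (simp add: double_zero)
        moreover have "packs 2 (B - ?X)"
        proof (rule packs_mono)
          have "card (N s - {x, x + s}) = 8"
            using x \<open>x + s \<in> N s\<close> \<open>x + s \<noteq> x\<close> cN by (subst card_Diff_subset) auto
          moreover have "\<forall>a\<in>N s - {x, x + s}. a + s \<in> N s - {x, x + s}"
            using N_inv by auto
          ultimately show "packs 2 (N s - {x, x + s})"
            using s(1) by (intro packs_translation_invariant[of s]) auto
          show "N s - {x, x + s} \<subseteq> B - ?X" using U(1) \<open>N s \<subseteq> B\<close> by auto
        qed
        moreover have "?X \<subseteq> B" using U(1) x \<open>x + s \<in> N s\<close> \<open>N s \<subseteq> B\<close> by auto
        ultimately have "packs (Suc 2) B" by (intro packs_Suc[of ?X]) auto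
        then show ?thesis by simp
      next
        case False
        \<comment> \<open>If one of the three summands were in \<open>N s\<close>, its translate by
          \<open>s\<close> would lie in \<open>B\<close> and equal the sum of the other two. So all
          three are among \<open>u\<close>, \<open>v\<close>, \<open>w\<close>; they are distinct,
          as two equal ones would cancel and put \<open>s\<close> into \<open>B\<close>. Their sum
          is then \<open>u + v + w\<close>, which is not \<open>s\<close> in this case.\<close>
        have no_s: "a + b + c \<noteq> s" if "a \<in> B" "b \<in> B" "c \<in> B" for a b c
        proof
          assume eq: "a + b + c = s"
          have nN: "x \<notin> N s" if "x + y + z = s" "x \<in> B" "y \<in> B" "z \<in> B" for x y z
          proof
            assume "x \<in> N s"
            then have "x + s \<in> B" by (auto simp: N_def)
            moreover have "x + s = y + z" using that(1) by (metis add.assoc add_cancel2(1))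
            ultimately show False using sf that by metis
          qed
          have "a \<in> {u, v, w}" "b \<in> {u, v, w}" "c \<in> {u, v, w}"
            using nN[of a b c] nN[of b a c] nN[of c a b] eq that U(1)
            by (auto simp: add_ac)
          moreover have "a \<noteq> b" "a \<noteq> c" "b \<noteq> c"
            using eq that sB by (auto simp: double_zero add_ac)
          ultimately have "a + b + c = u + v + w" by (auto simp: add_ac)
          then show False using eq False by simp
        qed
        \<comment> \<open>Modulo \<open>s\<close> every element of \<open>?Q\<close> comes from
          \<open>B\<close>, so a line in \<open>?Q\<close> would give three elements of
          \<open>B\<close> with sum 0 or \<open>s\<close>.\<close>
        have "sum_free ?Q" unfolding sum_free_def
        proof (intro ballI notI)
          fix x y assume xy: "x \<in> ?Q" "y \<in> ?Q" "x + y \<in> ?Q"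
          have *: "\<exists>a\<in>B. z = a \<or> z = s + a" if "z \<in> ?Q" for z using that by auto
          from xy * obtain a b c where abc: "a \<in> B" "b \<in> B" "c \<in> B"
            "x = a \<or> x = s + a" "y = b \<or> y = s + b" "x + y = c \<or> x + y = s + c"
            by metis
          then have "a + b + c = 0 \<or> a + b + c = s"
            by (smt (verit, ccfv_SIG) add.assoc add.commute add_cancel2 double_zero)
          then show False
            using no_s abc(1-3) sf add_eq_0 by metis
        qed
        moreover have "card ?Q = 16"
        proof -
          have "B \<inter> (+) s ` B = N s"
          proof (intro equalityI subsetI)
            fix z assume "z \<in> N s"
            then show "z \<in> B \<inter> (+) s ` B"
              by (auto simp: N_def intro!: image_eqI[of _ _ "z + s"] simp: add_ac)
          qed (auto simp: N_def add_ac double_zero)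
          moreover have "card ((+) s ` B) = 13" using B(2) by (simp add: card_image)
          ultimately show ?thesis
            using card_Un_Int[of B "(+) s ` B"] cN B(2) by simp
        qed
        ultimately have inv: "x + (u + v) \<in> ?Q" if "x \<in> B" for x
          using sum_free_16_invariant[of ?Q u v x] that uvw by blast
        \<comment> \<open>\<open>?Q\<close> is invariant under \<open>u + v\<close>, so an
          \<open>a\<close> whose translate leaves \<open>B\<close> satisfies
          \<open>a + (u + v) = s + b\<close> with \<open>b\<close> in \<open>B\<close> outside
          \<open>N s\<close>, that is, \<open>b\<close> is \<open>u\<close>, \<open>v\<close> or
          \<open>w\<close>. The choices \<open>u\<close> and \<open>v\<close> would make
          \<open>a\<close> equal to \<open>v + s\<close> or \<open>u + s\<close>, which are not in
          \<open>B\<close>. Hence at most one \<open>a\<close> is lost, and six pairs with sum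
          \<open>u + v\<close> remain.\<close>
        have "B - N (u + v) \<subseteq> {w + s + (u + v)}"
        proof
          fix a assume a: "a \<in> B - N (u + v)"
          then have "a + (u + v) \<in> (+) s ` B" using inv by (auto simp: N_def)
          then obtain b where b: "b \<in> B" "a + (u + v) = s + b" by blast
          have ab: "a = s + b + (u + v)" using b(2) by (metis add_cancel2(2))
          have "b \<notin> N s" using a b by (auto simp: N_def add_ac)
          then have "b = u \<or> b = v \<or> b = w" using b(1) U(1) by auto
          moreover have "b \<noteq> u"
          proof
            assume "b = u"
            then have "a = v + s" using ab by (metis add.assoc add.commute add_cancel2(1))
            then show False using a uvw by (auto simp: N_def)
          qed
          moreover have "b \<noteq> v"
          proof
            assume "b = v"
            then have "a = u + s" using ab by (metis add.assoc add.commute add_cancel2(1))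
            then show False using a uvw by (auto simp: N_def)
          qed
          ultimately show "a \<in> {w + s + (u + v)}" using ab by (simp add: add_ac)
        qed
        then have "card (B - N (u + v)) \<le> 1" using card_mono[of "{w + s + (u + v)}"] by fastforce
        moreover have "card (B - N (u + v)) = 13 - card (N (u + v))"
          using B(2) by (subst card_Diff_subset) (auto simp: N_def)
        ultimately have "12 \<le> card (N (u + v))" by linarith
        then show ?thesis using packs_N U(2) add_eq_0 by blast
      qed
    qed
  qed
  then show ?thesis using B packs_mono by blast
qed

text \<open>A sum-free \<open>A\<close> now has the extremal size 16 and is invariant under
  \<open>u + v\<close> for \<open>u\<close>, \<open>v\<close> in \<open>A\<close>; its eight pairs
  with that sum form four quadruples.\<close>

lemma packs_4:
  fixes A :: "'a set"
  assumes "card A \<ge> 16" "0 \<notin> A"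
  shows "packs 4 A"
proof (cases "sum_free A")
  case False
  have "packs (Suc 3) A"
  proof (rule packs_Suc_line[OF assms(2) False])
    fix A' :: "'a set" assume "A' \<subseteq> A" "card A \<le> card A' + 3"
    then show "packs 3 A'" using assms by (intro packs_3) auto
  qed
  then show ?thesis by simp
next
  case True
  then have c: "card A = 16" using sum_free_card assms by (simp add: le_antisym)
  then obtain u where "u \<in> A" by fastforce
  have "\<not> A \<subseteq> {u}" using c card_mono[of "{u}" A] by auto
  then obtain v where "v \<in> A" "v \<noteq> u" by blast
  with \<open>u \<in> A\<close> c True show ?thesis
    using sum_free_16_invariant[of A u v]
    by (intro packs_translation_invariant[of "u + v"]) (auto simp: add_eq_0)
qed

text \<open>The bound 14 makes \<open>n + 3\<close> exceed 16, the largest size of a sum-free set,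
  so a line is always available.\<close>

lemma packs_Suc_large:
  fixes A :: "'a set"
  assumes "\<And>A' :: 'a set. card A' \<ge> n \<Longrightarrow> 0 \<notin> A' \<Longrightarrow> packs k A'"
    and "card A \<ge> n + 3" "n \<ge> 14" "0 \<notin> A"
  shows "packs (Suc k) A"
proof (rule packs_Suc_line)
  show "\<not> sum_free A" using assms sum_free_card by fastforce
  fix A' assume "A' \<subseteq> A" "card A \<le> card A' + 3"
  then show "packs k A'" using assms by (intro assms(1)) auto
qed (use assms in auto)


end

section \<open>Coordinates and certificates\<close>

unbundle bit_operations_syntax

text \<open>Vectors are coded by the integers \<open>0, \<dots>, 31\<close>, addition being bitwise exclusive or; a frame is a
  choice of coordinates.\<close>

definition frame :: "(int \<Rightarrow> 'a::ab_group_add) \<Rightarrow> bool" where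
  "frame f \<longleftrightarrow> bij_betw f {0..<32} UNIV \<and>
     (\<forall>x\<in>{0..<32}. \<forall>y\<in>{0..<32}. f (x XOR y) = f x + f y)"

lemma xor_range: "x \<in> {0..<32} \<Longrightarrow> y \<in> {0..<32} \<Longrightarrow> x XOR y \<in> {0..<32::int}"
  using XOR_upper[of x 5 y] by simp

lemma frame_inj: "frame f \<Longrightarrow> inj_on f {0..<32}"
  by (simp add: frame_def bij_betw_def)

lemma frame_xor: "frame f \<Longrightarrow> x \<in> {0..<32} \<Longrightarrow> y \<in> {0..<32} \<Longrightarrow> f (x XOR y) = f x + f y"
  by (simp add: frame_def)

lemma frame_0: "frame f \<Longrightarrow> f 0 = 0"
  using frame_xor[of f 0 0] by simp

lemma frame_surj:
  assumes "frame f"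
  obtains x where "x \<in> {0..<32}" "y = f x"
  using assms unfolding frame_def bij_betw_def by (metis UNIV_I imageE)

lemma frame_double_zero:
  fixes f :: "int \<Rightarrow> 'a::ab_group_add"
  assumes "frame f"
  shows "y + y = (0::'a)"
proof -
  obtain x where x: "x \<in> {0..<32}" "y = f x" using frame_surj[OF assms] .
  then show ?thesis using frame_xor[OF assms x(1) x(1)] frame_0[OF assms] by simp
qed

lemma frame_card:
  fixes f :: "int \<Rightarrow> 'a::ab_group_add"
  shows "frame f \<Longrightarrow> CARD('a) = 32"
  using bij_betw_same_card[of f "{0..<32}" UNIV] by (simp add: frame_def)

text \<open>The new coordinates are \<open>f\<close> after the inverse of \<open>g\<close>; an
  injective map of the 32 codes into themselves is bijective. This is how an invertible matrix in a
  certificate acts on frames.\<close>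

lemma frame_transfer:
  assumes f: "frame f" and inj: "inj_on g {0..<32}" and ran: "g ` {0..<32} \<subseteq> {0..<32}"
    and xor: "\<And>x y. g (x XOR y) = g x XOR g y"
  obtains f' where "frame f'" "\<And>x. x \<in> {0..<32} \<Longrightarrow> f' (g x) = f x"
proof
  let ?h = "the_inv_into {0..<32} g"
  have bij: "bij_betw g {0..<32} {0..<32}"
    using inj ran endo_inj_surj[of "{0..<32}" g] by (auto simp: bij_betw_def)
  have h: "?h (g x) = x" if "x \<in> {0..<32}" for x
    using the_inv_into_f_f[OF inj that] .
  show "(f \<circ> ?h) (g x) = f x" if "x \<in> {0..<32}" for x
    using h[OF that] by simp
  show "frame (f \<circ> ?h)"
    unfolding frame_def
  proof (intro conjI ballI)
    show "bij_betw (f \<circ> ?h) {0..<32} UNIV"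
    proof (rule bij_betw_trans[OF bij_betw_the_inv_into[OF bij]])
      show "bij_betw f {0..<32} UNIV" using f by (simp add: frame_def)
    qed
    fix x y :: int assume "x \<in> {0..<32}" "y \<in> {0..<32}"
    then have "x \<in> g ` {0..<32}" "y \<in> g ` {0..<32}"
      using bij by (simp_all only: bij_betw_def)
    then obtain u v where uv: "u \<in> {0..<32}" "v \<in> {0..<32}" "x = g u" "y = g v" by blast
    have "?h (x XOR y) = u XOR v"
      using h[OF xor_range[OF uv(1,2)]] uv(3,4) by (simp only: xor)
    then show "(f \<circ> ?h) (x XOR y) = (f \<circ> ?h) x + (f \<circ> ?h) y"
      using h[OF uv(1)] h[OF uv(2)] frame_xor[OF f uv(1,2)] uv(3,4) by simp
  qed
qed

text \<open>\<open>lin [a\<^sub>0, \<dots>, a\<^sub>4]\<close> is the linear map with \<open>2 ^ i \<mapsto> a\<^sub>i\<close>.\<close>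

fun lin :: "int list \<Rightarrow> int \<Rightarrow> int" where
  "lin [] x = 0"
| "lin (a # as) x = (if odd x then a XOR lin as (x div 2) else lin as (x div 2))"

text \<open>The recursion follows the binary constructors of a numeral, so that the certificates are
  evaluated without parity tests or divisions; \<open>lin_code\<close> installs this as the
  executable form of \<open>lin\<close>.\<close>

fun lin_num :: "int list \<Rightarrow> num \<Rightarrow> int" where
  "lin_num [] n = 0"
| "lin_num (a # as) num.One = a"
| "lin_num (a # as) (num.Bit0 n) = lin_num as n"
| "lin_num (a # as) (num.Bit1 n) = a XOR lin_num as n"

lemma lin_0: "lin as 0 = 0"
  by (induction as) auto

lemma lin_numeral: "lin as (numeral n) = lin_num as n"
  by (induction as n rule: lin_num.induct) (auto simp: lin_0)

declare lin.simps [code del]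

lemma lin_code [code]: "lin as 0 = 0" "lin as (Int.Pos n) = lin_num as n"
  by (simp_all add: lin_0 lin_numeral)

lemma lin_xor: "lin as (x XOR y) = lin as x XOR lin as y"
proof (induction as arbitrary: x y)
  case (Cons a as)
  have "(x XOR y) div 2 = (x div 2) XOR (y div 2)"
    using drop_bit_xor[of 1 x y] by (simp add: drop_bit_eq_div)
  then show ?case
    by (simp add: Cons.IH even_xor_iff ac_simps)
qed simp

lemma lin_range: "set as \<subseteq> {0..<32} \<Longrightarrow> lin as x \<in> {0..<32}"
proof (induction as arbitrary: x)
  case (Cons a as)
  then show ?case using xor_range[of a "lin as (x div 2)"] by simp
qed simp

text \<open>The span of a list of vectors, or the empty list if the vectors are linearly dependent.\<close>

fun ispan :: "int list \<Rightarrow> int list" and ispan_ext :: "int \<Rightarrow> int list \<Rightarrow> int list" where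
  "ispan [] = [0]"
| "ispan (a # as) = ispan_ext a (ispan as)"
| "ispan_ext a s = (if s = [] \<or> a \<in> set s then [] else s @ map (\<lambda>x. a XOR x) s)"

lemma xor_eq_0_int: "x XOR y = 0 \<longleftrightarrow> x = (y::int)"
  by (metis xor.assoc xor.right_neutral xor_self_eq)

text \<open>The two claims need a joint induction: an odd \<open>x\<close> in the kernel would
  exhibit \<open>a\<close> as a value of \<open>lin as\<close>, hence as a member of the span that
  \<open>a\<close> is required to avoid.\<close>

lemma ispan_kernel:
  assumes "ispan as \<noteq> []"
  shows "lin as ` {0..<2 ^ length as} \<subseteq> set (ispan as) \<and>
    (\<forall>x\<in>{0..<2 ^ length as}. lin as x = 0 \<longrightarrow> x = 0)"
  using assms
proof (induction as)
  case (Cons a as)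
  have ne: "ispan as \<noteq> []" and a: "a \<notin> set (ispan as)"
    using Cons.prems by (auto split: if_splits)
  have half: "x div 2 \<in> {0..<2 ^ length as}" if "x \<in> {0..<2 ^ length (a # as)}" for x :: int
    using that by auto
  have IH: "lin as y \<in> set (ispan as)" "lin as y = 0 \<Longrightarrow> y = 0" if "y \<in> {0..<2 ^ length as}" for y
    using Cons.IH[OF ne] that by auto
  show ?case
  proof (intro conjI ballI impI subsetI)
    fix z assume "z \<in> lin (a # as) ` {0..<2 ^ length (a # as)}"
    then obtain x where x: "x \<in> {0..<2 ^ length (a # as)}" "z = lin (a # as) x" by blast
    then show "z \<in> set (ispan (a # as))"
      using IH(1)[OF half[OF x(1)]] ne a by auto
  next
    fix x assume x: "x \<in> {0..<2 ^ length (a # as)}" "lin (a # as) x = 0"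
    have "even x"
    proof (rule ccontr)
      assume "odd x"
      then have "a = lin as (x div 2)" using x(2) by (simp add: xor_eq_0_int)
      then show False using a IH(1)[OF half[OF x(1)]] by simp
    qed
    then show "x = 0" using x(2) IH(2)[OF half[OF x(1)]] by auto
  qed
qed auto

section \<open>Certificates for lists of representatives up to linear equivalence\<close>

definition invertible5 :: "int list \<Rightarrow> bool" where
  "invertible5 M \<longleftrightarrow> length M = 5 \<and> list_all (\<lambda>a. 0 \<le> a \<and> a < 32) M \<and> ispan M \<noteq> []"

lemma invertible5_inj:
  assumes "invertible5 M"
  shows "inj_on (lin M) {0..<32}"
proof (rule inj_onI)
  fix x y assume xy: "x \<in> {0..<32}" "y \<in> {0..<32}" "lin M x = lin M y"
  have "lin M (x XOR y) = 0" using xy(3) by (simp add: lin_xor)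
  then have "x XOR y = 0"
    using ispan_kernel[of M] assms xor_range[OF xy(1,2)] by (auto simp: invertible5_def)
  then show "x = y" by (simp add: xor_eq_0_int)
qed

text \<open>The frame may depend on \<open>B\<close>, which expresses equivalence under linear maps.
  Inclusion instead of equality permits representatives with more than \<open>n\<close> elements:
  packing the complement of a larger set is a stronger result.\<close>

definition covers :: "'a::ab_group_add itself \<Rightarrow> nat \<Rightarrow> int list list \<Rightarrow> bool" where
  "covers G n Rs \<longleftrightarrow> (\<forall>B::'a set. 0 \<notin> B \<longrightarrow> card B = n \<longrightarrow>
     (\<exists>f. frame f \<and> (\<exists>R\<in>set Rs. B \<subseteq> f ` (set R \<inter> {0..<32}))))"

text \<open>An index outside the list yields \<open>False\<close>, so a faulty certificate is
  rejected instead of referring to an unspecified entry.\<close>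

fun sat_at :: "('b \<Rightarrow> bool) \<Rightarrow> 'b list \<Rightarrow> int \<Rightarrow> bool" where
  "sat_at P [] j = False"
| "sat_at P (x # xs) j = (if j = 0 then P x else sat_at P xs (j - 1))"

lemma sat_atD: "sat_at P xs j \<Longrightarrow> \<exists>x\<in>set xs. P x"
  by (induction P xs j rule: sat_at.induct) (auto split: if_splits)

fun certifies :: "int list list \<Rightarrow> int list \<Rightarrow> int \<times> int list \<Rightarrow> bool" where
  "certifies Rs X (j, M) \<longleftrightarrow>
     sat_at (\<lambda>R. list_all (\<lambda>x. List.member R (lin M x)) X) Rs j \<and> invertible5 M"

definition points :: "int list" where
  "points = [1, 2, 3, 4, 5, 6, 7, 8, 9, 10, 11, 12, 13, 14, 15, 16, 17, 18, 19, 20, 21, 22, 23, 24,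
    25, 26, 27, 28, 29, 30, 31]"

text \<open>Here \<open>ps\<close> is the list of points outside \<open>R\<close>, and
  \<open>list_all2\<close> forces one certificate for each of them. Nonemptiness provides a
  certificate even when the point to be added already lies in \<open>R\<close>.\<close>

fun extends_all :: "int list list \<Rightarrow> int list \<Rightarrow> (int \<times> int list) list \<Rightarrow> int list \<Rightarrow> bool" where
  "extends_all Rs R cs ps \<longleftrightarrow> ps \<noteq> [] \<and> list_all2 (\<lambda>p. certifies Rs (p # R)) ps cs"

definition extension_step :: "int list list \<Rightarrow> int list list \<Rightarrow> (int \<times> int list) list list \<Rightarrow> bool" where
  "extension_step Rs Rs' Cs \<longleftrightarrow>
     list_all2 (\<lambda>R cs. extends_all Rs' R cs (filter (\<lambda>p. p \<notin> set R) points)) Rs Cs"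

lemma set_points: "set points = {1..<32}"
proof -
  have "{1..<32::int} = set [1..31]" by auto
  also have "[1..31] = points" unfolding points_def by (simp add: upto.simps)
  finally show ?thesis by simp
qed

lemma covers_0: "frame (f :: int \<Rightarrow> 'a::{ab_group_add,finite}) \<Longrightarrow> covers TYPE('a) 0 [[]]"
  by (auto simp: covers_def)

text \<open>Remove a point \<open>b\<close>, place the rest inside a representative
  \<open>R\<close>, and add the code of \<open>b\<close> to \<open>R\<close>. The certificate for
  this enlarged set moves it by an invertible matrix into a member of the next list, and the frame
  is adjusted by the inverse.\<close>

lemma covers_Suc:
  assumes cov: "covers TYPE('a::{ab_group_add,finite}) n Rs" and step: "extension_step Rs Rs' Cs"
  shows "covers TYPE('a) (Suc n) Rs'"
  unfolding covers_def
proof (intro allI impI)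
  fix B :: "'a set" assume B: "0 \<notin> B" "card B = Suc n"
  then obtain b where b: "b \<in> B" by fastforce
  then have "0 \<notin> B - {b}" "card (B - {b}) = n" using B by auto
  then obtain f R where f: "frame f" and R: "R \<in> set Rs" "B - {b} \<subseteq> f ` (set R \<inter> {0..<32})"
    using cov unfolding covers_def by blast
  obtain q where q: "q \<in> {0..<32}" "b = f q" using frame_surj[OF f] by blast
  have "q \<noteq> 0" using q b B(1) frame_0[OF f] by auto
  from R(1) step obtain cs where cs: "extends_all Rs' R cs (filter (\<lambda>p. p \<notin> set R) points)"
    unfolding extension_step_def list_all2_conv_all_nth by (metis in_set_conv_nth)
  \<comment> \<open>If the code of \<open>b\<close> is already in \<open>R\<close>, any point
    outside \<open>R\<close> may be added, as only an inclusion has to be preserved.\<close>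
  define p where "p = (if q \<in> set R then hd (filter (\<lambda>p. p \<notin> set R) points) else q)"
  have p: "p \<in> set (filter (\<lambda>p. p \<notin> set R) points)"
  proof (cases "q \<in> set R")
    case True
    then show ?thesis using cs unfolding p_def extends_all.simps by (metis hd_in_set)
  next
    case False
    then show ?thesis using q \<open>q \<noteq> 0\<close> by (simp add: p_def set_points)
  qed
  then have p_range: "p \<in> {0..<32}" by (simp add: set_points)
  have sub: "B \<subseteq> f ` (set (p # R) \<inter> {0..<32})"
    using R(2) q p_range by (auto simp: p_def)
  obtain c where "certifies Rs' (p # R) c"
    using cs p unfolding extends_all.simps list_all2_conv_all_nth by (metis in_set_conv_nth)
  then obtain M R' where M: "invertible5 M" and R': "R' \<in> set Rs'"
      "\<And>x. x \<in> set (p # R) \<Longrightarrow> lin M x \<in> set R'"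
    by (cases c) (auto dest!: sat_atD simp: list_all_iff List.member_iff)
  have ran: "lin M x \<in> {0..<32}" for x
    by (rule lin_range) (use M in \<open>auto simp: invertible5_def list_all_iff\<close>)
  obtain f' where f': "frame f'" "\<And>x. x \<in> {0..<32} \<Longrightarrow> f' (lin M x) = f x"
    using frame_transfer[OF f invertible5_inj[OF M]] ran lin_xor by blast
  have "B \<subseteq> f' ` (set R' \<inter> {0..<32})"
  proof
    fix y assume "y \<in> B"
    then obtain x where x: "x \<in> set (p # R)" "x \<in> {0..<32}" "y = f x" using sub by blast
    then show "y \<in> f' ` (set R' \<inter> {0..<32})"
      using f'(2)[OF x(2)] R'(2)[OF x(1)] ran[of x] by (metis IntI image_eqI)
  qed
  then show "\<exists>f. frame f \<and> (\<exists>R\<in>set Rs'. B \<subseteq> f ` (set R \<inter> {0..<32}))"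
    using f'(1) R'(1) by blast
qed

section \<open>Certificates for packings of complements\<close>

definition disjoint_blocks :: "int list \<Rightarrow> int list list \<Rightarrow> bool" where
  "disjoint_blocks R bs \<longleftrightarrow> distinct (concat bs) \<and>
     list_all (\<lambda>x. 0 < x \<and> x < 32 \<and> x \<notin> set R) (concat bs) \<and>
     list_all (\<lambda>b. b \<noteq> [] \<and> foldr (XOR) b 0 = 0) bs"

lemma frame_sum:
  assumes "frame f" "set xs \<subseteq> {0..<32}" "distinct xs"
  shows "foldr (XOR) xs 0 \<in> {0..<32} \<and> \<Sum>(f ` set xs) = f (foldr (XOR) xs 0)"
  using assms(2,3)
proof (induction xs)
  case Nil
  then show ?case using frame_0[OF assms(1)] by simp
next
  case (Cons x xs)
  have "f x \<notin> f ` set xs"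
    using Cons.prems inj_on_image_mem_iff[OF frame_inj[OF assms(1)], of x "set xs"] by auto
  then show ?case
    using Cons frame_xor[OF assms(1), of x "foldr (XOR) xs 0"] xor_range[of x "foldr (XOR) xs 0"]
    by simp
qed

lemma packs_blocks:
  fixes f :: "int \<Rightarrow> 'a::{ab_group_add,finite}"
  assumes f: "frame f" and "disjoint_blocks R bs" "f ` set (concat bs) \<subseteq> A"
  shows "packs (length bs) A"
  using assms(2,3)
proof (induction bs arbitrary: A)
  case Nil
  then show ?case by (simp add: has_k_disjoint_zs_0)
next
  case (Cons b bs)
  have "\<forall>x\<in>set (concat (b # bs)). 0 < x \<and> x < 32"
    using Cons.prems(1) unfolding disjoint_blocks_def list_all_iff by blast
  then have ran: "set (concat (b # bs)) \<subseteq> {0..<32}"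
    by (meson atLeastLessThan_iff less_imp_le subsetI)
  have "\<Sum>(f ` set b) = 0"
    using frame_sum[OF f, of b] frame_0[OF f] Cons.prems(1) ran
    by (auto simp: disjoint_blocks_def list_all_iff)
  moreover have "packs (length bs) (A - f ` set b)"
  proof (rule Cons.IH)
    have "f ` set (concat bs) \<inter> f ` set b = f ` (set (concat bs) \<inter> set b)"
      using inj_on_image_Int[OF frame_inj[OF f], of "set (concat bs)" "set b"] ran by auto
    also have "set (concat bs) \<inter> set b = {}"
      using Cons.prems(1) unfolding disjoint_blocks_def by auto
    finally have "f ` set (concat bs) \<inter> f ` set b = {}" by simp
    moreover have "f ` set (concat bs) \<subseteq> A" using Cons.prems(2) by (simp add: image_Un)
    ultimately show "f ` set (concat bs) \<subseteq> A - f ` set b" by blast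
  qed (use Cons.prems(1) in \<open>auto simp: disjoint_blocks_def list_all_iff\<close>)
  ultimately show ?case
    using Cons.prems by (auto simp: disjoint_blocks_def intro!: packs_Suc[of "f ` set b"])
qed

text \<open>Shrinking \<open>A\<close> to exactly \<open>31 - n\<close> elements leaves exactly
  \<open>n\<close> nonzero elements outside. These lie in the image of a representative
  \<open>R\<close>, so blocks of codes outside \<open>R\<close> have their images inside the
  shrunken set.\<close>

lemma covers_packs:
  fixes A :: "'a::{ab_group_add,finite} set"
  assumes cov: "covers TYPE('a) n Rs" and blocks: "list_all2 disjoint_blocks Rs bss"
    and len: "list_all (\<lambda>bs. length bs = k) bss"
    and A: "0 \<notin> A" "card A + n \<ge> 31" "n \<le> 31" and card: "CARD('a) = 32"
  shows "packs k A"
proof -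
  obtain A' where A': "A' \<subseteq> A" "card A' = 31 - n"
    using A(2) obtain_subset_with_card_n[of "31 - n" A] by force
  let ?B = "- insert 0 A'"
  have "0 \<notin> A'" using A A' by auto
  then have "card (insert 0 A') = 32 - n" using A'(2) A(3) by simp
  then have "card ?B = 32 - (32 - n)"
    unfolding Compl_eq_Diff_UNIV using card by (subst card_Diff_subset) auto
  then have "card ?B = n" using A(3) by simp
  moreover have "0 \<notin> ?B" by simp
  ultimately obtain f R where f: "frame f" and R: "R \<in> set Rs" "?B \<subseteq> f ` (set R \<inter> {0..<32})"
    using cov[unfolded covers_def, rule_format, of ?B] by blast
  obtain bs where bs: "disjoint_blocks R bs" "bs \<in> set bss"
    using R(1) blocks unfolding list_all2_conv_all_nth by (metis in_set_conv_nth)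
  have "f ` set (concat bs) \<subseteq> A'"
  proof
    fix y assume "y \<in> f ` set (concat bs)"
    then obtain x where x: "x \<in> set (concat bs)" "y = f x" by blast
    then have xr: "0 < x" "x < 32" "x \<notin> set R"
      using bs(1) by (auto simp: disjoint_blocks_def list_all_iff)
    have inj: "f x = f z \<Longrightarrow> z \<in> {0..<32} \<Longrightarrow> z = x" for z
      using inj_onD[OF frame_inj[OF f], of x z] xr by auto
    have "y \<noteq> 0" using inj[of 0] frame_0[OF f] xr x(2) by auto
    moreover have "y \<notin> ?B" using R(2) inj xr x(2) by auto
    ultimately show "y \<in> A'" by auto
  qed
  then have "packs (length bs) A'" using packs_blocks[OF f bs(1)] by blast
  moreover have "length bs = k" using bs(2) len by (simp add: list_all_iff)
  ultimately show ?thesis using A'(1) packs_mono by blast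
qed

section \<open>Enumeration of complements\<close>

text \<open>For \<open>n \<le> 9\<close> the list \<open>reps\<^sub>n\<close> represents the orbits of \<open>n\<close>-subsets of nonzero vectors under
  \<open>GL(5,2)\<close>; the seven sets of \<open>reps\<^sub>1\<^sub>0\<close> have 10 to 13 elements and complements with six disjoint
  zero-sum subsets.\<close>

definition reps\<^sub>0 :: "int list list" where
  "reps\<^sub>0 =
    [[]]"

definition reps\<^sub>1 :: "int list list" where
  "reps\<^sub>1 =
    [[1]]"

definition reps\<^sub>2 :: "int list list" where
  "reps\<^sub>2 =
    [[1, 2]]"

definition reps\<^sub>3 :: "int list list" where
  "reps\<^sub>3 =
    [[1, 2, 3], [1, 2, 4]]"

definition reps\<^sub>4 :: "int list list" where
  "reps\<^sub>4 =
    [[1, 2, 3, 4], [2, 3, 4, 5], [1, 2, 4, 8]]"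

definition reps\<^sub>5 :: "int list list" where
  "reps\<^sub>5 =
    [[1, 2, 3, 4, 5], [1, 2, 3, 4, 8], [2, 3, 4, 5, 8], [3, 4, 6, 8, 9], [1, 2, 4, 8, 16]]"

definition reps\<^sub>6 :: "int list list" where
  "reps\<^sub>6 =
    [[1, 2, 3, 4, 5, 6], [1, 2, 3, 4, 5, 8], [2, 3, 4, 5, 8, 9], [1, 2, 4, 6, 8, 9], [1, 3, 4, 6,
    8, 9], [1, 2, 3, 4, 8, 16], [2, 3, 4, 5, 8, 16], [3, 4, 6, 8, 9, 16], [5, 6, 8, 10, 16, 17]]"

definition reps\<^sub>7 :: "int list list" where
  "reps\<^sub>7 =
    [[1, 2, 3, 4, 5, 6, 7], [1, 2, 3, 4, 5, 6, 8], [1, 2, 3, 4, 5, 8, 9], [1, 2, 3, 4, 6, 8, 9],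
    [2, 3, 4, 5, 6, 8, 9], [4, 5, 6, 7, 8, 9, 10], [1, 2, 3, 4, 5, 8, 16], [2, 3, 4, 5, 8, 9, 16],
    [1, 2, 4, 6, 8, 9, 16], [1, 3, 4, 6, 8, 9, 16], [2, 4, 6, 8, 9, 16, 17], [3, 4, 6, 8, 9, 16,
    17], [1, 5, 6, 8, 10, 16, 17], [4, 5, 6, 8, 10, 16, 17]]"

definition reps\<^sub>8 :: "int list list" where
  "reps\<^sub>8 =
    [[1, 2, 3, 4, 5, 6, 7, 8], [1, 2, 3, 4, 5, 6, 8, 9], [2, 3, 4, 5, 6, 7, 8, 9], [1, 2, 4, 5, 6,
    8, 9, 10], [1, 4, 5, 6, 7, 8, 9, 10], [4, 5, 6, 7, 8, 9, 10, 11], [1, 2, 3, 4, 5, 6, 8, 16],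
    [1, 2, 3, 4, 5, 8, 9, 16], [1, 2, 3, 4, 6, 8, 9, 16], [2, 3, 4, 5, 6, 8, 9, 16], [4, 5, 6, 7,
    8, 9, 10, 16], [2, 3, 4, 5, 8, 9, 16, 17], [1, 2, 4, 6, 8, 9, 16, 17], [1, 3, 4, 6, 8, 9, 16,
    17], [2, 3, 4, 6, 8, 9, 16, 17], [1, 2, 5, 6, 8, 10, 16, 17], [1, 4, 5, 6, 8, 10, 16, 17], [3,
    4, 5, 6, 8, 10, 16, 17], [4, 5, 6, 7, 8, 10, 16, 17], [3, 4, 6, 8, 10, 12, 16, 17], [3, 5, 7,
    8, 10, 12, 16, 17]]"

definition reps\<^sub>9 :: "int list list" where
  "reps\<^sub>9 =
    [[1, 2, 3, 4, 5, 6, 7, 8, 9], [1, 2, 3, 4, 5, 6, 8, 9, 10], [1, 2, 4, 5, 6, 7, 8, 9, 10], [1,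
    4, 5, 6, 7, 8, 9, 10, 11], [2, 3, 4, 5, 7, 8, 9, 10, 12], [1, 2, 3, 4, 5, 6, 7, 8, 16], [1, 2,
    3, 4, 5, 6, 8, 9, 16], [2, 3, 4, 5, 6, 7, 8, 9, 16], [1, 2, 4, 5, 6, 8, 9, 10, 16], [1, 4, 5,
    6, 7, 8, 9, 10, 16], [4, 5, 6, 7, 8, 9, 10, 11, 16], [1, 2, 3, 4, 5, 8, 9, 16, 17], [1, 2, 3,
    4, 6, 8, 9, 16, 17], [2, 3, 4, 5, 6, 8, 9, 16, 17], [1, 2, 3, 5, 6, 8, 10, 16, 17], [1, 2, 4,
    5, 6, 8, 10, 16, 17], [1, 3, 4, 5, 6, 8, 10, 16, 17], [1, 4, 5, 6, 7, 8, 10, 16, 17], [3, 4,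
    5, 6, 7, 8, 10, 16, 17], [2, 4, 5, 6, 8, 9, 10, 16, 17], [4, 5, 6, 7, 8, 9, 10, 16, 17], [1,
    2, 4, 6, 8, 10, 12, 16, 17], [1, 3, 4, 6, 8, 10, 12, 16, 17], [2, 3, 4, 6, 8, 10, 12, 16, 17],
    [2, 3, 5, 6, 8, 10, 12, 16, 17], [1, 3, 5, 7, 8, 10, 12, 16, 17], [2, 3, 5, 7, 8, 10, 12, 16,
    17], [3, 4, 6, 8, 10, 12, 14, 16, 17], [3, 5, 6, 8, 10, 12, 14, 16, 17], [3, 5, 7, 8, 10, 12,
    14, 16, 17], [4, 5, 6, 8, 9, 10, 16, 17, 18], [3, 4, 6, 8, 9, 12, 16, 17, 18], [2, 6, 7, 8, 9,
    12, 16, 17, 18], [6, 7, 8, 9, 12, 13, 16, 17, 18]]"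

definition reps\<^sub>1\<^sub>0 :: "int list list" where
  "reps\<^sub>1\<^sub>0 =
    [[3, 5, 7, 14, 23, 25, 26, 27, 28, 29, 30, 31], [1, 2, 3, 12, 15, 21, 23, 26, 27, 28, 29, 30,
    31], [1, 2, 5, 7, 26, 27, 28, 29, 30, 31], [14, 15, 22, 23, 24, 25, 26, 27, 28, 29, 30, 31],
    [1, 6, 7, 24, 25, 26, 27, 28, 29, 30, 31], [1, 2, 15, 21, 22, 23, 25, 26, 27, 28, 29, 30, 31],
    [7, 19, 21, 22, 23, 24, 25, 26, 27, 28, 29, 30, 31]]"

text \<open>An entry \<open>(j, M)\<close> for \<open>R\<close> and \<open>p \<notin> R\<close> says that the linear map \<open>M\<close> sends \<open>R \<union> {p}\<close> into the
  \<open>j\<close>-th set of the next list; the points \<open>p\<close> are taken in increasing order.\<close>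

definition maps\<^sub>0 :: "(int \<times> int list) list list" where
  "maps\<^sub>0 =
    [[(0, [1, 2, 4, 8, 16]), (0, [2, 1, 4, 8, 16]), (0, [2, 3, 4, 8, 16]), (0, [2, 4, 1, 8, 16]),
    (0, [2, 4, 3, 8, 16]), (0, [2, 4, 5, 8, 16]), (0, [2, 4, 7, 8, 16]), (0, [2, 4, 8, 1, 16]),
    (0, [2, 4, 8, 3, 16]), (0, [2, 4, 8, 5, 16]), (0, [2, 4, 8, 7, 16]), (0, [2, 4, 8, 9, 16]),
    (0, [2, 4, 8, 11, 16]), (0, [2, 4, 8, 13, 16]), (0, [2, 4, 8, 15, 16]), (0, [2, 4, 8, 16, 1]),
    (0, [2, 4, 8, 16, 3]), (0, [2, 4, 8, 16, 5]), (0, [2, 4, 8, 16, 7]), (0, [2, 4, 8, 16, 9]),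
    (0, [2, 4, 8, 16, 11]), (0, [2, 4, 8, 16, 13]), (0, [2, 4, 8, 16, 15]), (0, [2, 4, 8, 16,
    17]), (0, [2, 4, 8, 16, 19]), (0, [2, 4, 8, 16, 21]), (0, [2, 4, 8, 16, 23]), (0, [2, 4, 8,
    16, 25]), (0, [2, 4, 8, 16, 27]), (0, [2, 4, 8, 16, 29]), (0, [2, 4, 8, 16, 31])]]"

definition maps\<^sub>1 :: "(int \<times> int list) list list" where
  "maps\<^sub>1 =
    [[(0, [1, 2, 4, 8, 16]), (0, [1, 3, 4, 8, 16]), (0, [1, 4, 2, 8, 16]), (0, [1, 4, 3, 8, 16]),
    (0, [1, 4, 6, 8, 16]), (0, [1, 4, 7, 8, 16]), (0, [1, 4, 8, 2, 16]), (0, [1, 4, 8, 3, 16]),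
    (0, [1, 4, 8, 6, 16]), (0, [1, 4, 8, 7, 16]), (0, [1, 4, 8, 10, 16]), (0, [1, 4, 8, 11, 16]),
    (0, [1, 4, 8, 14, 16]), (0, [1, 4, 8, 15, 16]), (0, [1, 4, 8, 16, 2]), (0, [1, 4, 8, 16, 3]),
    (0, [1, 4, 8, 16, 6]), (0, [1, 4, 8, 16, 7]), (0, [1, 4, 8, 16, 10]), (0, [1, 4, 8, 16, 11]),
    (0, [1, 4, 8, 16, 14]), (0, [1, 4, 8, 16, 15]), (0, [1, 4, 8, 16, 18]), (0, [1, 4, 8, 16,
    19]), (0, [1, 4, 8, 16, 22]), (0, [1, 4, 8, 16, 23]), (0, [1, 4, 8, 16, 26]), (0, [1, 4, 8,
    16, 27]), (0, [1, 4, 8, 16, 30]), (0, [1, 4, 8, 16, 31])]]"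

definition maps\<^sub>2 :: "(int \<times> int list) list list" where
  "maps\<^sub>2 =
    [[(0, [1, 2, 4, 8, 16]), (1, [1, 2, 4, 8, 16]), (1, [1, 2, 5, 8, 16]), (1, [1, 2, 6, 8, 16]),
    (1, [1, 2, 7, 8, 16]), (1, [1, 2, 8, 4, 16]), (1, [1, 2, 8, 5, 16]), (1, [1, 2, 8, 6, 16]),
    (1, [1, 2, 8, 7, 16]), (1, [1, 2, 8, 12, 16]), (1, [1, 2, 8, 13, 16]), (1, [1, 2, 8, 14, 16]),
    (1, [1, 2, 8, 15, 16]), (1, [1, 2, 8, 16, 4]), (1, [1, 2, 8, 16, 5]), (1, [1, 2, 8, 16, 6]),
    (1, [1, 2, 8, 16, 7]), (1, [1, 2, 8, 16, 12]), (1, [1, 2, 8, 16, 13]), (1, [1, 2, 8, 16, 14]),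
    (1, [1, 2, 8, 16, 15]), (1, [1, 2, 8, 16, 20]), (1, [1, 2, 8, 16, 21]), (1, [1, 2, 8, 16,
    22]), (1, [1, 2, 8, 16, 23]), (1, [1, 2, 8, 16, 28]), (1, [1, 2, 8, 16, 29]), (1, [1, 2, 8,
    16, 30]), (1, [1, 2, 8, 16, 31])]]"

definition maps\<^sub>3 :: "(int \<times> int list) list list" where
  "maps\<^sub>3 =
    [[(0, [1, 2, 4, 8, 16]), (0, [1, 2, 5, 8, 16]), (0, [1, 2, 6, 8, 16]), (0, [1, 2, 7, 8, 16]),
    (0, [1, 2, 8, 4, 16]), (0, [1, 2, 8, 5, 16]), (0, [1, 2, 8, 6, 16]), (0, [1, 2, 8, 7, 16]),
    (0, [1, 2, 8, 12, 16]), (0, [1, 2, 8, 13, 16]), (0, [1, 2, 8, 14, 16]), (0, [1, 2, 8, 15,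
    16]), (0, [1, 2, 8, 16, 4]), (0, [1, 2, 8, 16, 5]), (0, [1, 2, 8, 16, 6]), (0, [1, 2, 8, 16,
    7]), (0, [1, 2, 8, 16, 12]), (0, [1, 2, 8, 16, 13]), (0, [1, 2, 8, 16, 14]), (0, [1, 2, 8, 16,
    15]), (0, [1, 2, 8, 16, 20]), (0, [1, 2, 8, 16, 21]), (0, [1, 2, 8, 16, 22]), (0, [1, 2, 8,
    16, 23]), (0, [1, 2, 8, 16, 28]), (0, [1, 2, 8, 16, 29]), (0, [1, 2, 8, 16, 30]), (0, [1, 2,
    8, 16, 31])],
    [(0, [1, 2, 4, 8, 16]), (0, [1, 4, 2, 8, 16]), (0, [4, 1, 2, 8, 16]), (1, [2, 3, 4, 8, 16]),
    (2, [1, 2, 4, 8, 16]), (2, [1, 2, 4, 9, 16]), (2, [1, 2, 4, 10, 16]), (2, [1, 2, 4, 11, 16]),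
    (2, [1, 2, 4, 12, 16]), (2, [1, 2, 4, 13, 16]), (2, [1, 2, 4, 14, 16]), (2, [1, 2, 4, 15,
    16]), (2, [1, 2, 4, 16, 8]), (2, [1, 2, 4, 16, 9]), (2, [1, 2, 4, 16, 10]), (2, [1, 2, 4, 16,
    11]), (2, [1, 2, 4, 16, 12]), (2, [1, 2, 4, 16, 13]), (2, [1, 2, 4, 16, 14]), (2, [1, 2, 4,
    16, 15]), (2, [1, 2, 4, 16, 24]), (2, [1, 2, 4, 16, 25]), (2, [1, 2, 4, 16, 26]), (2, [1, 2,
    4, 16, 27]), (2, [1, 2, 4, 16, 28]), (2, [1, 2, 4, 16, 29]), (2, [1, 2, 4, 16, 30]), (2, [1,
    2, 4, 16, 31])]]"

definition maps\<^sub>4 :: "(int \<times> int list) list list" where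
  "maps\<^sub>4 =
    [[(0, [1, 2, 4, 8, 16]), (0, [2, 1, 4, 8, 16]), (0, [2, 3, 4, 8, 16]), (1, [1, 2, 4, 8, 16]),
    (1, [1, 2, 4, 9, 16]), (1, [1, 2, 4, 10, 16]), (1, [1, 2, 4, 11, 16]), (1, [1, 2, 4, 12, 16]),
    (1, [1, 2, 4, 13, 16]), (1, [1, 2, 4, 14, 16]), (1, [1, 2, 4, 15, 16]), (1, [1, 2, 4, 16, 8]),
    (1, [1, 2, 4, 16, 9]), (1, [1, 2, 4, 16, 10]), (1, [1, 2, 4, 16, 11]), (1, [1, 2, 4, 16, 12]),
    (1, [1, 2, 4, 16, 13]), (1, [1, 2, 4, 16, 14]), (1, [1, 2, 4, 16, 15]), (1, [1, 2, 4, 16,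
    24]), (1, [1, 2, 4, 16, 25]), (1, [1, 2, 4, 16, 26]), (1, [1, 2, 4, 16, 27]), (1, [1, 2, 4,
    16, 28]), (1, [1, 2, 4, 16, 29]), (1, [1, 2, 4, 16, 30]), (1, [1, 2, 4, 16, 31])],
    [(0, [1, 2, 4, 8, 16]), (0, [6, 2, 3, 8, 16]), (0, [6, 2, 5, 8, 16]), (2, [1, 2, 4, 8, 16]),
    (2, [1, 2, 4, 9, 16]), (2, [1, 2, 4, 10, 16]), (2, [1, 2, 4, 11, 16]), (2, [1, 2, 4, 12, 16]),
    (2, [1, 2, 4, 13, 16]), (2, [1, 2, 4, 14, 16]), (2, [1, 2, 4, 15, 16]), (2, [1, 2, 4, 16, 8]),
    (2, [1, 2, 4, 16, 9]), (2, [1, 2, 4, 16, 10]), (2, [1, 2, 4, 16, 11]), (2, [1, 2, 4, 16, 12]),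
    (2, [1, 2, 4, 16, 13]), (2, [1, 2, 4, 16, 14]), (2, [1, 2, 4, 16, 15]), (2, [1, 2, 4, 16,
    24]), (2, [1, 2, 4, 16, 25]), (2, [1, 2, 4, 16, 26]), (2, [1, 2, 4, 16, 27]), (2, [1, 2, 4,
    16, 28]), (2, [1, 2, 4, 16, 29]), (2, [1, 2, 4, 16, 30]), (2, [1, 2, 4, 16, 31])],
    [(1, [1, 2, 4, 8, 16]), (1, [1, 4, 2, 8, 16]), (1, [4, 1, 2, 8, 16]), (2, [2, 3, 4, 8, 16]),
    (1, [1, 4, 8, 2, 16]), (1, [4, 1, 8, 2, 16]), (2, [2, 3, 8, 4, 16]), (1, [4, 8, 1, 2, 16]),
    (2, [2, 8, 3, 4, 16]), (2, [8, 2, 3, 4, 16]), (3, [3, 4, 6, 8, 16]), (4, [1, 2, 4, 8, 16]),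
    (4, [1, 2, 4, 8, 17]), (4, [1, 2, 4, 8, 18]), (4, [1, 2, 4, 8, 19]), (4, [1, 2, 4, 8, 20]),
    (4, [1, 2, 4, 8, 21]), (4, [1, 2, 4, 8, 22]), (4, [1, 2, 4, 8, 23]), (4, [1, 2, 4, 8, 24]),
    (4, [1, 2, 4, 8, 25]), (4, [1, 2, 4, 8, 26]), (4, [1, 2, 4, 8, 27]), (4, [1, 2, 4, 8, 28]),
    (4, [1, 2, 4, 8, 29]), (4, [1, 2, 4, 8, 30]), (4, [1, 2, 4, 8, 31])]]"

definition maps\<^sub>5 :: "(int \<times> int list) list list" where
  "maps\<^sub>5 =
    [[(0, [1, 2, 4, 8, 16]), (0, [1, 2, 5, 8, 16]), (1, [1, 2, 4, 8, 16]), (1, [1, 2, 4, 9, 16]),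
    (1, [1, 2, 4, 10, 16]), (1, [1, 2, 4, 11, 16]), (1, [1, 2, 4, 12, 16]), (1, [1, 2, 4, 13,
    16]), (1, [1, 2, 4, 14, 16]), (1, [1, 2, 4, 15, 16]), (1, [1, 2, 4, 16, 8]), (1, [1, 2, 4, 16,
    9]), (1, [1, 2, 4, 16, 10]), (1, [1, 2, 4, 16, 11]), (1, [1, 2, 4, 16, 12]), (1, [1, 2, 4, 16,
    13]), (1, [1, 2, 4, 16, 14]), (1, [1, 2, 4, 16, 15]), (1, [1, 2, 4, 16, 24]), (1, [1, 2, 4,
    16, 25]), (1, [1, 2, 4, 16, 26]), (1, [1, 2, 4, 16, 27]), (1, [1, 2, 4, 16, 28]), (1, [1, 2,
    4, 16, 29]), (1, [1, 2, 4, 16, 30]), (1, [1, 2, 4, 16, 31])],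
    [(1, [1, 2, 4, 8, 16]), (1, [2, 1, 4, 8, 16]), (1, [2, 3, 4, 8, 16]), (1, [1, 2, 8, 4, 16]),
    (1, [2, 1, 8, 4, 16]), (1, [2, 3, 8, 4, 16]), (3, [1, 8, 2, 4, 16]), (4, [1, 8, 3, 4, 16]),
    (4, [8, 1, 3, 4, 16]), (4, [8, 9, 3, 4, 16]), (5, [1, 2, 4, 8, 16]), (5, [1, 2, 4, 8, 17]),
    (5, [1, 2, 4, 8, 18]), (5, [1, 2, 4, 8, 19]), (5, [1, 2, 4, 8, 20]), (5, [1, 2, 4, 8, 21]),
    (5, [1, 2, 4, 8, 22]), (5, [1, 2, 4, 8, 23]), (5, [1, 2, 4, 8, 24]), (5, [1, 2, 4, 8, 25]),
    (5, [1, 2, 4, 8, 26]), (5, [1, 2, 4, 8, 27]), (5, [1, 2, 4, 8, 28]), (5, [1, 2, 4, 8, 29]),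
    (5, [1, 2, 4, 8, 30]), (5, [1, 2, 4, 8, 31])],
    [(1, [1, 2, 4, 8, 16]), (1, [6, 2, 3, 8, 16]), (1, [6, 2, 5, 8, 16]), (2, [1, 2, 4, 8, 16]),
    (4, [2, 1, 4, 8, 16]), (4, [2, 3, 4, 8, 16]), (4, [7, 3, 1, 8, 16]), (4, [7, 3, 6, 8, 16]),
    (2, [6, 2, 3, 8, 16]), (2, [6, 2, 5, 8, 16]), (6, [1, 2, 4, 8, 16]), (6, [1, 2, 4, 8, 17]),
    (6, [1, 2, 4, 8, 18]), (6, [1, 2, 4, 8, 19]), (6, [1, 2, 4, 8, 20]), (6, [1, 2, 4, 8, 21]),
    (6, [1, 2, 4, 8, 22]), (6, [1, 2, 4, 8, 23]), (6, [1, 2, 4, 8, 24]), (6, [1, 2, 4, 8, 25]),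
    (6, [1, 2, 4, 8, 26]), (6, [1, 2, 4, 8, 27]), (6, [1, 2, 4, 8, 28]), (6, [1, 2, 4, 8, 29]),
    (6, [1, 2, 4, 8, 30]), (6, [1, 2, 4, 8, 31])],
    [(4, [1, 2, 4, 8, 16]), (4, [2, 1, 8, 4, 16]), (4, [2, 10, 3, 4, 16]), (4, [2, 10, 9, 4, 16]),
    (4, [15, 7, 3, 6, 16]), (4, [15, 7, 3, 9, 16]), (4, [15, 12, 8, 9, 16]), (4, [15, 12, 8, 6,
    16]), (4, [15, 12, 4, 9, 16]), (4, [15, 12, 4, 6, 16]), (7, [1, 2, 4, 8, 16]), (7, [1, 2, 4,
    8, 17]), (7, [1, 2, 4, 8, 18]), (7, [1, 2, 4, 8, 19]), (7, [1, 2, 4, 8, 20]), (7, [1, 2, 4, 8,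
    21]), (7, [1, 2, 4, 8, 22]), (7, [1, 2, 4, 8, 23]), (7, [1, 2, 4, 8, 24]), (7, [1, 2, 4, 8,
    25]), (7, [1, 2, 4, 8, 26]), (7, [1, 2, 4, 8, 27]), (7, [1, 2, 4, 8, 28]), (7, [1, 2, 4, 8,
    29]), (7, [1, 2, 4, 8, 30]), (7, [1, 2, 4, 8, 31])],
    [(5, [1, 2, 4, 8, 16]), (5, [1, 4, 2, 8, 16]), (5, [4, 1, 2, 8, 16]), (6, [2, 3, 4, 8, 16]),
    (5, [1, 4, 8, 2, 16]), (5, [4, 1, 8, 2, 16]), (6, [2, 3, 8, 4, 16]), (5, [4, 8, 1, 2, 16]),
    (6, [2, 8, 3, 4, 16]), (6, [8, 2, 3, 4, 16]), (7, [3, 4, 6, 8, 16]), (5, [1, 4, 8, 16, 2]),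
    (5, [4, 1, 8, 16, 2]), (6, [2, 3, 8, 16, 4]), (5, [4, 8, 1, 16, 2]), (6, [2, 8, 3, 16, 4]),
    (6, [8, 2, 3, 16, 4]), (7, [3, 4, 6, 16, 8]), (5, [4, 8, 16, 1, 2]), (6, [2, 8, 16, 3, 4]),
    (6, [8, 2, 16, 3, 4]), (7, [3, 4, 16, 6, 8]), (6, [8, 16, 2, 3, 4]), (7, [3, 16, 4, 6, 8]),
    (7, [16, 3, 4, 6, 8]), (8, [5, 6, 8, 10, 16])]]"

definition maps\<^sub>6 :: "(int \<times> int list) list list" where
  "maps\<^sub>6 =
    [[(0, [1, 2, 4, 8, 16]), (1, [1, 2, 4, 8, 16]), (1, [1, 2, 4, 9, 16]), (1, [1, 2, 4, 10, 16]),
    (1, [1, 2, 4, 11, 16]), (1, [1, 2, 4, 12, 16]), (1, [1, 2, 4, 13, 16]), (1, [1, 2, 4, 14,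
    16]), (1, [1, 2, 4, 15, 16]), (1, [1, 2, 4, 16, 8]), (1, [1, 2, 4, 16, 9]), (1, [1, 2, 4, 16,
    10]), (1, [1, 2, 4, 16, 11]), (1, [1, 2, 4, 16, 12]), (1, [1, 2, 4, 16, 13]), (1, [1, 2, 4,
    16, 14]), (1, [1, 2, 4, 16, 15]), (1, [1, 2, 4, 16, 24]), (1, [1, 2, 4, 16, 25]), (1, [1, 2,
    4, 16, 26]), (1, [1, 2, 4, 16, 27]), (1, [1, 2, 4, 16, 28]), (1, [1, 2, 4, 16, 29]), (1, [1,
    2, 4, 16, 30]), (1, [1, 2, 4, 16, 31])],
    [(1, [1, 2, 4, 8, 16]), (1, [1, 2, 5, 8, 16]), (2, [1, 2, 4, 8, 16]), (3, [1, 2, 8, 4, 16]),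
    (3, [1, 3, 8, 4, 16]), (3, [1, 8, 2, 4, 16]), (3, [1, 8, 3, 4, 16]), (4, [6, 2, 3, 8, 16]),
    (4, [6, 2, 5, 8, 16]), (6, [1, 2, 4, 8, 16]), (6, [1, 2, 4, 8, 17]), (6, [1, 2, 4, 8, 18]),
    (6, [1, 2, 4, 8, 19]), (6, [1, 2, 4, 8, 20]), (6, [1, 2, 4, 8, 21]), (6, [1, 2, 4, 8, 22]),
    (6, [1, 2, 4, 8, 23]), (6, [1, 2, 4, 8, 24]), (6, [1, 2, 4, 8, 25]), (6, [1, 2, 4, 8, 26]),
    (6, [1, 2, 4, 8, 27]), (6, [1, 2, 4, 8, 28]), (6, [1, 2, 4, 8, 29]), (6, [1, 2, 4, 8, 30]),
    (6, [1, 2, 4, 8, 31])],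
    [(2, [1, 2, 4, 8, 16]), (4, [1, 2, 4, 8, 16]), (4, [1, 2, 5, 8, 16]), (4, [1, 2, 8, 4, 16]),
    (4, [1, 2, 8, 5, 16]), (4, [1, 8, 2, 4, 16]), (4, [1, 8, 2, 5, 16]), (5, [1, 4, 6, 8, 16]),
    (5, [1, 4, 6, 9, 16]), (7, [1, 2, 4, 8, 16]), (7, [1, 2, 4, 8, 17]), (7, [1, 2, 4, 8, 18]),
    (7, [1, 2, 4, 8, 19]), (7, [1, 2, 4, 8, 20]), (7, [1, 2, 4, 8, 21]), (7, [1, 2, 4, 8, 22]),
    (7, [1, 2, 4, 8, 23]), (7, [1, 2, 4, 8, 24]), (7, [1, 2, 4, 8, 25]), (7, [1, 2, 4, 8, 26]),
    (7, [1, 2, 4, 8, 27]), (7, [1, 2, 4, 8, 28]), (7, [1, 2, 4, 8, 29]), (7, [1, 2, 4, 8, 30]),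
    (7, [1, 2, 4, 8, 31])],
    [(3, [1, 2, 4, 8, 16]), (3, [1, 4, 2, 8, 16]), (3, [1, 4, 6, 8, 16]), (3, [4, 1, 8, 2, 16]),
    (3, [4, 1, 8, 6, 16]), (3, [4, 8, 1, 2, 16]), (3, [4, 8, 1, 6, 16]), (3, [4, 8, 9, 2, 16]),
    (3, [4, 8, 9, 6, 16]), (8, [1, 2, 4, 8, 16]), (8, [1, 2, 4, 8, 17]), (8, [1, 2, 4, 8, 18]),
    (8, [1, 2, 4, 8, 19]), (8, [1, 2, 4, 8, 20]), (8, [1, 2, 4, 8, 21]), (8, [1, 2, 4, 8, 22]),
    (8, [1, 2, 4, 8, 23]), (8, [1, 2, 4, 8, 24]), (8, [1, 2, 4, 8, 25]), (8, [1, 2, 4, 8, 26]),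
    (8, [1, 2, 4, 8, 27]), (8, [1, 2, 4, 8, 28]), (8, [1, 2, 4, 8, 29]), (8, [1, 2, 4, 8, 30]),
    (8, [1, 2, 4, 8, 31])],
    [(3, [1, 2, 4, 8, 16]), (3, [1, 5, 3, 8, 16]), (3, [1, 5, 6, 8, 16]), (4, [2, 1, 8, 4, 16]),
    (4, [2, 1, 8, 6, 16]), (4, [2, 10, 3, 6, 16]), (4, [2, 10, 3, 4, 16]), (4, [2, 10, 9, 6, 16]),
    (4, [2, 10, 9, 4, 16]), (9, [1, 2, 4, 8, 16]), (9, [1, 2, 4, 8, 17]), (9, [1, 2, 4, 8, 18]),
    (9, [1, 2, 4, 8, 19]), (9, [1, 2, 4, 8, 20]), (9, [1, 2, 4, 8, 21]), (9, [1, 2, 4, 8, 22]),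
    (9, [1, 2, 4, 8, 23]), (9, [1, 2, 4, 8, 24]), (9, [1, 2, 4, 8, 25]), (9, [1, 2, 4, 8, 26]),
    (9, [1, 2, 4, 8, 27]), (9, [1, 2, 4, 8, 28]), (9, [1, 2, 4, 8, 29]), (9, [1, 2, 4, 8, 30]),
    (9, [1, 2, 4, 8, 31])],
    [(6, [1, 2, 4, 8, 16]), (6, [2, 1, 4, 8, 16]), (6, [2, 3, 4, 8, 16]), (6, [1, 2, 8, 4, 16]),
    (6, [2, 1, 8, 4, 16]), (6, [2, 3, 8, 4, 16]), (8, [1, 8, 2, 4, 16]), (9, [1, 8, 3, 4, 16]),
    (9, [8, 1, 3, 4, 16]), (9, [8, 9, 3, 4, 16]), (6, [1, 2, 8, 16, 4]), (6, [2, 1, 8, 16, 4]),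
    (6, [2, 3, 8, 16, 4]), (8, [1, 8, 2, 16, 4]), (9, [1, 8, 3, 16, 4]), (9, [8, 1, 3, 16, 4]),
    (9, [8, 9, 3, 16, 4]), (8, [1, 8, 16, 2, 4]), (9, [1, 8, 16, 3, 4]), (9, [8, 1, 16, 3, 4]),
    (9, [8, 9, 16, 3, 4]), (10, [2, 4, 8, 9, 16]), (12, [1, 16, 5, 6, 8]), (12, [16, 1, 5, 6, 8]),
    (12, [16, 17, 5, 6, 8])],
    [(6, [1, 2, 4, 8, 16]), (6, [6, 2, 3, 8, 16]), (6, [6, 2, 5, 8, 16]), (7, [1, 2, 4, 8, 16]),
    (9, [2, 1, 4, 8, 16]), (9, [2, 3, 4, 8, 16]), (9, [7, 3, 1, 8, 16]), (9, [7, 3, 6, 8, 16]),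
    (7, [6, 2, 3, 8, 16]), (7, [6, 2, 5, 8, 16]), (7, [1, 2, 4, 16, 8]), (9, [2, 1, 4, 16, 8]),
    (9, [2, 3, 4, 16, 8]), (9, [7, 3, 1, 16, 8]), (9, [7, 3, 6, 16, 8]), (7, [6, 2, 3, 16, 8]),
    (7, [6, 2, 5, 16, 8]), (10, [1, 8, 16, 2, 4]), (11, [1, 8, 16, 3, 4]), (13, [1, 4, 16, 6, 8]),
    (13, [1, 5, 16, 6, 8]), (13, [21, 5, 4, 6, 8]), (13, [21, 5, 17, 6, 8]), (11, [24, 8, 9, 3,
    4]), (11, [24, 8, 17, 3, 4])],
    [(9, [1, 2, 4, 8, 16]), (9, [2, 1, 8, 4, 16]), (9, [2, 10, 3, 4, 16]), (9, [2, 10, 9, 4, 16]),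
    (9, [15, 7, 3, 6, 16]), (9, [15, 7, 3, 9, 16]), (9, [15, 12, 8, 9, 16]), (9, [15, 12, 8, 6,
    16]), (9, [15, 12, 4, 9, 16]), (9, [15, 12, 4, 6, 16]), (11, [1, 2, 4, 8, 16]), (11, [2, 1, 8,
    4, 16]), (12, [2, 3, 5, 8, 16]), (12, [2, 7, 1, 8, 16]), (11, [2, 10, 3, 4, 16]), (12, [2, 7,
    6, 8, 16]), (11, [2, 10, 9, 4, 16]), (12, [11, 14, 6, 1, 16]), (12, [11, 14, 6, 10, 16]), (11,
    [15, 7, 3, 6, 16]), (11, [15, 7, 3, 9, 16]), (11, [15, 12, 8, 9, 16]), (11, [15, 12, 8, 6,
    16]), (11, [15, 12, 4, 9, 16]), (11, [15, 12, 4, 6, 16])],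
    [(12, [1, 2, 4, 8, 16]), (12, [2, 1, 7, 16, 8]), (12, [2, 3, 18, 5, 8]), (13, [1, 2, 4, 8,
    16]), (13, [2, 1, 7, 16, 8]), (13, [2, 23, 7, 6, 8]), (13, [2, 23, 7, 17, 8]), (12, [2, 23, 7,
    6, 8]), (12, [2, 23, 18, 17, 8]), (12, [2, 23, 7, 17, 8]), (12, [2, 23, 18, 6, 8]), (13, [27,
    14, 30, 6, 10]), (13, [27, 14, 30, 6, 17]), (12, [27, 14, 11, 6, 10]), (12, [27, 14, 11, 6,
    17]), (12, [27, 14, 30, 6, 17]), (12, [27, 14, 30, 6, 10]), (12, [27, 24, 30, 16, 17]), (12,
    [27, 24, 30, 16, 10]), (12, [27, 24, 30, 8, 17]), (12, [27, 24, 30, 8, 10]), (13, [27, 24, 30,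
    16, 10]), (13, [27, 24, 30, 16, 17]), (13, [27, 24, 30, 8, 10]), (13, [27, 24, 30, 8, 17])]]"

definition maps\<^sub>7 :: "(int \<times> int list) list list" where
  "maps\<^sub>7 =
    [[(0, [1, 2, 4, 8, 16]), (0, [1, 2, 4, 9, 16]), (0, [1, 2, 4, 10, 16]), (0, [1, 2, 4, 11, 16]),
    (0, [1, 2, 4, 12, 16]), (0, [1, 2, 4, 13, 16]), (0, [1, 2, 4, 14, 16]), (0, [1, 2, 4, 15,
    16]), (0, [1, 2, 4, 16, 8]), (0, [1, 2, 4, 16, 9]), (0, [1, 2, 4, 16, 10]), (0, [1, 2, 4, 16,
    11]), (0, [1, 2, 4, 16, 12]), (0, [1, 2, 4, 16, 13]), (0, [1, 2, 4, 16, 14]), (0, [1, 2, 4,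
    16, 15]), (0, [1, 2, 4, 16, 24]), (0, [1, 2, 4, 16, 25]), (0, [1, 2, 4, 16, 26]), (0, [1, 2,
    4, 16, 27]), (0, [1, 2, 4, 16, 28]), (0, [1, 2, 4, 16, 29]), (0, [1, 2, 4, 16, 30]), (0, [1,
    2, 4, 16, 31])],
    [(0, [1, 2, 4, 8, 16]), (1, [1, 2, 4, 8, 16]), (1, [2, 1, 4, 8, 16]), (1, [2, 3, 6, 8, 16]),
    (1, [2, 4, 1, 8, 16]), (1, [2, 6, 3, 8, 16]), (1, [6, 2, 3, 8, 16]), (2, [2, 4, 7, 8, 16]),
    (6, [1, 2, 4, 8, 16]), (6, [1, 2, 4, 8, 17]), (6, [1, 2, 4, 8, 18]), (6, [1, 2, 4, 8, 19]),
    (6, [1, 2, 4, 8, 20]), (6, [1, 2, 4, 8, 21]), (6, [1, 2, 4, 8, 22]), (6, [1, 2, 4, 8, 23]),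
    (6, [1, 2, 4, 8, 24]), (6, [1, 2, 4, 8, 25]), (6, [1, 2, 4, 8, 26]), (6, [1, 2, 4, 8, 27]),
    (6, [1, 2, 4, 8, 28]), (6, [1, 2, 4, 8, 29]), (6, [1, 2, 4, 8, 30]), (6, [1, 2, 4, 8, 31])],
    [(1, [1, 2, 4, 8, 16]), (1, [1, 2, 5, 8, 16]), (1, [1, 2, 8, 4, 16]), (1, [1, 2, 8, 5, 16]),
    (1, [1, 8, 2, 4, 16]), (1, [1, 8, 2, 5, 16]), (4, [1, 4, 6, 8, 16]), (4, [1, 4, 6, 9, 16]),
    (7, [1, 2, 4, 8, 16]), (7, [1, 2, 4, 8, 17]), (7, [1, 2, 4, 8, 18]), (7, [1, 2, 4, 8, 19]),
    (7, [1, 2, 4, 8, 20]), (7, [1, 2, 4, 8, 21]), (7, [1, 2, 4, 8, 22]), (7, [1, 2, 4, 8, 23]),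
    (7, [1, 2, 4, 8, 24]), (7, [1, 2, 4, 8, 25]), (7, [1, 2, 4, 8, 26]), (7, [1, 2, 4, 8, 27]),
    (7, [1, 2, 4, 8, 28]), (7, [1, 2, 4, 8, 29]), (7, [1, 2, 4, 8, 30]), (7, [1, 2, 4, 8, 31])],
    [(1, [1, 2, 4, 8, 16]), (1, [1, 2, 6, 8, 16]), (1, [2, 1, 8, 4, 16]), (1, [2, 1, 8, 6, 16]),
    (3, [1, 4, 2, 8, 16]), (3, [1, 4, 2, 9, 16]), (3, [1, 4, 6, 8, 16]), (3, [1, 4, 6, 9, 16]),
    (8, [1, 2, 4, 8, 16]), (8, [1, 2, 4, 8, 17]), (8, [1, 2, 4, 8, 18]), (8, [1, 2, 4, 8, 19]),
    (8, [1, 2, 4, 8, 20]), (8, [1, 2, 4, 8, 21]), (8, [1, 2, 4, 8, 22]), (8, [1, 2, 4, 8, 23]),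
    (8, [1, 2, 4, 8, 24]), (8, [1, 2, 4, 8, 25]), (8, [1, 2, 4, 8, 26]), (8, [1, 2, 4, 8, 27]),
    (8, [1, 2, 4, 8, 28]), (8, [1, 2, 4, 8, 29]), (8, [1, 2, 4, 8, 30]), (8, [1, 2, 4, 8, 31])],
    [(1, [1, 2, 4, 8, 16]), (2, [1, 2, 4, 8, 16]), (3, [3, 1, 5, 9, 16]), (3, [3, 1, 5, 10, 16]),
    (3, [3, 5, 1, 9, 16]), (3, [3, 5, 1, 10, 16]), (4, [2, 4, 5, 8, 16]), (4, [2, 4, 5, 10, 16]),
    (9, [1, 2, 4, 8, 16]), (9, [1, 2, 4, 8, 17]), (9, [1, 2, 4, 8, 18]), (9, [1, 2, 4, 8, 19]),
    (9, [1, 2, 4, 8, 20]), (9, [1, 2, 4, 8, 21]), (9, [1, 2, 4, 8, 22]), (9, [1, 2, 4, 8, 23]),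
    (9, [1, 2, 4, 8, 24]), (9, [1, 2, 4, 8, 25]), (9, [1, 2, 4, 8, 26]), (9, [1, 2, 4, 8, 27]),
    (9, [1, 2, 4, 8, 28]), (9, [1, 2, 4, 8, 29]), (9, [1, 2, 4, 8, 30]), (9, [1, 2, 4, 8, 31])],
    [(4, [1, 2, 4, 8, 16]), (4, [2, 1, 4, 8, 16]), (4, [2, 3, 4, 10, 16]), (5, [1, 2, 4, 8, 16]),
    (4, [2, 12, 4, 5, 16]), (4, [2, 14, 4, 7, 16]), (4, [14, 2, 4, 7, 16]), (4, [14, 12, 10, 9,
    16]), (10, [1, 2, 4, 8, 16]), (10, [1, 2, 4, 8, 17]), (10, [1, 2, 4, 8, 18]), (10, [1, 2, 4,
    8, 19]), (10, [1, 2, 4, 8, 20]), (10, [1, 2, 4, 8, 21]), (10, [1, 2, 4, 8, 22]), (10, [1, 2,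
    4, 8, 23]), (10, [1, 2, 4, 8, 24]), (10, [1, 2, 4, 8, 25]), (10, [1, 2, 4, 8, 26]), (10, [1,
    2, 4, 8, 27]), (10, [1, 2, 4, 8, 28]), (10, [1, 2, 4, 8, 29]), (10, [1, 2, 4, 8, 30]), (10,
    [1, 2, 4, 8, 31])],
    [(6, [1, 2, 4, 8, 16]), (6, [1, 2, 5, 8, 16]), (7, [1, 2, 4, 8, 16]), (8, [1, 2, 8, 4, 16]),
    (8, [1, 3, 8, 4, 16]), (8, [1, 8, 2, 4, 16]), (8, [1, 8, 3, 4, 16]), (9, [6, 2, 3, 8, 16]),
    (9, [6, 2, 5, 8, 16]), (7, [1, 2, 4, 16, 8]), (8, [1, 2, 8, 16, 4]), (8, [1, 3, 8, 16, 4]),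
    (8, [1, 8, 2, 16, 4]), (8, [1, 8, 3, 16, 4]), (9, [6, 2, 3, 16, 8]), (9, [6, 2, 5, 16, 8]),
    (12, [1, 8, 16, 2, 4]), (13, [1, 8, 16, 3, 4]), (16, [1, 4, 16, 6, 8]), (16, [1, 5, 16, 6,
    8]), (16, [1, 16, 4, 6, 8]), (16, [1, 16, 5, 6, 8]), (19, [12, 4, 6, 3, 16]), (19, [12, 4, 10,
    3, 16])],
    [(7, [1, 2, 4, 8, 16]), (9, [1, 2, 4, 8, 16]), (9, [1, 2, 5, 8, 16]), (9, [1, 2, 8, 4, 16]),
    (9, [1, 2, 8, 5, 16]), (9, [1, 8, 2, 4, 16]), (9, [1, 8, 2, 5, 16]), (10, [1, 4, 6, 8, 16]),
    (10, [1, 4, 6, 9, 16]), (11, [1, 2, 4, 8, 16]), (14, [1, 2, 8, 16, 4]), (14, [1, 3, 8, 16,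
    4]), (14, [1, 8, 2, 16, 4]), (14, [1, 8, 3, 16, 4]), (18, [1, 4, 6, 16, 8]), (18, [1, 4, 7,
    16, 8]), (14, [1, 8, 16, 2, 4]), (14, [1, 8, 16, 3, 4]), (18, [1, 4, 16, 6, 8]), (18, [1, 4,
    16, 7, 8]), (18, [2, 8, 4, 5, 16]), (18, [2, 8, 4, 7, 16]), (20, [15, 3, 5, 7, 16]), (20, [15,
    3, 5, 8, 16])],
    [(8, [1, 2, 4, 8, 16]), (8, [1, 4, 2, 8, 16]), (8, [1, 4, 6, 8, 16]), (8, [4, 1, 8, 2, 16]),
    (8, [4, 1, 8, 6, 16]), (8, [4, 8, 1, 2, 16]), (8, [4, 8, 1, 6, 16]), (8, [4, 8, 9, 2, 16]),
    (8, [4, 8, 9, 6, 16]), (12, [1, 2, 4, 8, 16]), (12, [2, 1, 8, 4, 16]), (15, [1, 2, 8, 16, 5]),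
    (12, [2, 8, 1, 4, 16]), (15, [1, 8, 2, 16, 5]), (12, [2, 8, 9, 4, 16]), (15, [1, 8, 10, 16,
    5]), (12, [8, 2, 4, 1, 16]), (12, [8, 2, 4, 9, 16]), (15, [8, 1, 16, 2, 5]), (15, [8, 1, 16,
    10, 5]), (15, [8, 16, 1, 2, 5]), (15, [8, 16, 1, 10, 5]), (15, [8, 16, 17, 2, 5]), (15, [8,
    16, 17, 10, 5])],
    [(8, [1, 2, 4, 8, 16]), (8, [1, 5, 3, 8, 16]), (8, [1, 5, 6, 8, 16]), (9, [2, 1, 8, 4, 16]),
    (9, [2, 1, 8, 6, 16]), (9, [2, 10, 3, 6, 16]), (9, [2, 10, 3, 4, 16]), (9, [2, 10, 9, 6, 16]),
    (9, [2, 10, 9, 4, 16]), (13, [1, 2, 4, 8, 16]), (14, [2, 1, 8, 4, 16]), (15, [1, 3, 5, 16,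
    8]), (15, [1, 4, 2, 16, 8]), (14, [2, 10, 3, 4, 16]), (15, [1, 4, 6, 16, 8]), (14, [2, 10, 9,
    4, 16]), (16, [4, 2, 8, 1, 16]), (16, [4, 2, 8, 5, 16]), (17, [5, 1, 16, 3, 8]), (17, [5, 1,
    16, 6, 8]), (17, [5, 21, 4, 6, 8]), (17, [5, 21, 4, 3, 8]), (17, [5, 21, 17, 6, 8]), (17, [5,
    21, 17, 3, 8])],
    [(12, [1, 2, 4, 8, 16]), (14, [1, 2, 4, 8, 16]), (14, [1, 4, 2, 8, 16]), (14, [1, 4, 6, 8,
    16]), (16, [2, 1, 16, 4, 8]), (16, [2, 1, 16, 6, 8]), (16, [2, 16, 1, 4, 8]), (16, [2, 16, 1,
    6, 8]), (16, [2, 16, 17, 4, 8]), (16, [2, 16, 17, 6, 8]), (16, [14, 1, 16, 6, 4]), (16, [14,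
    1, 16, 6, 10]), (16, [14, 16, 1, 6, 4]), (16, [14, 16, 1, 6, 10]), (16, [14, 16, 17, 6, 4]),
    (16, [14, 16, 17, 6, 10]), (12, [24, 2, 4, 8, 9]), (12, [24, 2, 4, 8, 17]), (14, [24, 2, 4, 8,
    9]), (14, [24, 2, 4, 8, 17]), (14, [24, 4, 2, 8, 9]), (14, [24, 4, 2, 8, 17]), (14, [24, 4, 6,
    8, 9]), (14, [24, 4, 6, 8, 17])],
    [(13, [1, 2, 4, 8, 16]), (14, [1, 2, 4, 8, 16]), (14, [1, 5, 3, 8, 16]), (14, [1, 5, 6, 8,
    16]), (17, [1, 2, 8, 4, 16]), (17, [1, 2, 8, 5, 16]), (17, [1, 9, 3, 5, 16]), (17, [1, 9, 3,
    4, 16]), (17, [1, 9, 10, 5, 16]), (17, [1, 9, 10, 4, 16]), (17, [1, 2, 8, 16, 4]), (17, [1, 2,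
    8, 16, 5]), (17, [1, 9, 3, 16, 5]), (17, [1, 9, 3, 16, 4]), (17, [1, 9, 10, 16, 5]), (17, [1,
    9, 10, 16, 4]), (19, [2, 1, 16, 4, 8]), (19, [2, 1, 16, 4, 10]), (20, [2, 1, 16, 5, 8]), (20,
    [2, 1, 16, 5, 10]), (20, [2, 18, 3, 5, 10]), (20, [2, 18, 3, 5, 8]), (20, [2, 18, 17, 5, 10]),
    (20, [2, 18, 17, 5, 8])],
    [(15, [1, 2, 4, 8, 16]), (15, [1, 3, 9, 5, 16]), (16, [1, 2, 4, 8, 16]), (16, [1, 2, 7, 8,
    16]), (16, [1, 15, 7, 5, 16]), (16, [1, 15, 7, 10, 16]), (15, [1, 12, 4, 6, 16]), (15, [1, 12,
    9, 10, 16]), (15, [1, 12, 4, 10, 16]), (15, [1, 12, 9, 6, 16]), (17, [3, 1, 11, 16, 5]), (17,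
    [3, 1, 11, 16, 6]), (19, [4, 1, 2, 16, 8]), (19, [4, 1, 2, 16, 12]), (19, [4, 1, 7, 16, 12]),
    (19, [4, 1, 7, 16, 8]), (19, [4, 23, 7, 6, 12]), (19, [4, 23, 7, 6, 8]), (19, [4, 23, 7, 17,
    12]), (19, [4, 23, 7, 17, 8]), (17, [3, 27, 11, 10, 5]), (17, [3, 27, 11, 10, 6]), (17, [3,
    27, 11, 17, 5]), (17, [3, 27, 11, 17, 6])],
    [(16, [1, 2, 4, 8, 16]), (16, [2, 1, 4, 16, 8]), (17, [1, 2, 4, 8, 16]), (18, [1, 2, 4, 8,
    16]), (18, [1, 12, 4, 6, 16]), (18, [1, 12, 4, 10, 16]), (16, [2, 20, 4, 5, 8]), (17, [1, 12,
    4, 6, 16]), (16, [2, 20, 4, 17, 8]), (17, [1, 12, 4, 10, 16]), (18, [12, 1, 4, 16, 6]), (18,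
    [12, 1, 4, 16, 10]), (16, [20, 2, 4, 8, 5]), (16, [20, 2, 4, 8, 17]), (17, [12, 1, 4, 16, 6]),
    (17, [12, 1, 4, 16, 10]), (17, [12, 20, 4, 5, 6]), (17, [12, 20, 4, 5, 10]), (17, [12, 20, 4,
    17, 6]), (17, [12, 20, 4, 17, 10]), (18, [12, 20, 4, 5, 6]), (18, [12, 20, 4, 5, 10]), (18,
    [12, 20, 4, 17, 6]), (18, [12, 20, 4, 17, 10])]]"

definition maps\<^sub>8 :: "(int \<times> int list) list list" where
  "maps\<^sub>8 =
    [[(0, [1, 2, 4, 8, 16]), (0, [2, 1, 4, 8, 16]), (0, [2, 3, 4, 8, 16]), (0, [2, 4, 1, 8, 16]),
    (0, [2, 4, 3, 8, 16]), (0, [2, 4, 5, 8, 16]), (0, [2, 4, 7, 8, 16]), (5, [1, 2, 4, 8, 16]),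
    (5, [1, 2, 4, 8, 17]), (5, [1, 2, 4, 8, 18]), (5, [1, 2, 4, 8, 19]), (5, [1, 2, 4, 8, 20]),
    (5, [1, 2, 4, 8, 21]), (5, [1, 2, 4, 8, 22]), (5, [1, 2, 4, 8, 23]), (5, [1, 2, 4, 8, 24]),
    (5, [1, 2, 4, 8, 25]), (5, [1, 2, 4, 8, 26]), (5, [1, 2, 4, 8, 27]), (5, [1, 2, 4, 8, 28]),
    (5, [1, 2, 4, 8, 29]), (5, [1, 2, 4, 8, 30]), (5, [1, 2, 4, 8, 31])],
    [(0, [1, 2, 4, 8, 16]), (1, [1, 2, 4, 8, 16]), (1, [1, 2, 4, 9, 16]), (1, [1, 4, 2, 8, 16]),
    (1, [1, 4, 2, 9, 16]), (2, [1, 4, 6, 8, 16]), (2, [1, 4, 6, 9, 16]), (6, [1, 2, 4, 8, 16]),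
    (6, [1, 2, 4, 8, 17]), (6, [1, 2, 4, 8, 18]), (6, [1, 2, 4, 8, 19]), (6, [1, 2, 4, 8, 20]),
    (6, [1, 2, 4, 8, 21]), (6, [1, 2, 4, 8, 22]), (6, [1, 2, 4, 8, 23]), (6, [1, 2, 4, 8, 24]),
    (6, [1, 2, 4, 8, 25]), (6, [1, 2, 4, 8, 26]), (6, [1, 2, 4, 8, 27]), (6, [1, 2, 4, 8, 28]),
    (6, [1, 2, 4, 8, 29]), (6, [1, 2, 4, 8, 30]), (6, [1, 2, 4, 8, 31])],
    [(0, [1, 2, 4, 8, 16]), (2, [3, 1, 4, 9, 16]), (2, [3, 1, 4, 10, 16]), (2, [3, 4, 1, 9, 16]),
    (2, [3, 4, 1, 10, 16]), (2, [3, 4, 5, 9, 16]), (2, [3, 4, 5, 10, 16]), (7, [1, 2, 4, 8, 16]),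
    (7, [1, 2, 4, 8, 17]), (7, [1, 2, 4, 8, 18]), (7, [1, 2, 4, 8, 19]), (7, [1, 2, 4, 8, 20]),
    (7, [1, 2, 4, 8, 21]), (7, [1, 2, 4, 8, 22]), (7, [1, 2, 4, 8, 23]), (7, [1, 2, 4, 8, 24]),
    (7, [1, 2, 4, 8, 25]), (7, [1, 2, 4, 8, 26]), (7, [1, 2, 4, 8, 27]), (7, [1, 2, 4, 8, 28]),
    (7, [1, 2, 4, 8, 29]), (7, [1, 2, 4, 8, 30]), (7, [1, 2, 4, 8, 31])],
    [(1, [1, 2, 4, 8, 16]), (2, [1, 2, 4, 8, 16]), (2, [1, 2, 8, 4, 16]), (1, [4, 8, 1, 2, 16]),
    (2, [4, 8, 1, 2, 16]), (2, [8, 4, 1, 2, 16]), (4, [2, 3, 7, 10, 16]), (8, [1, 2, 4, 8, 16]),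
    (8, [1, 2, 4, 8, 17]), (8, [1, 2, 4, 8, 18]), (8, [1, 2, 4, 8, 19]), (8, [1, 2, 4, 8, 20]),
    (8, [1, 2, 4, 8, 21]), (8, [1, 2, 4, 8, 22]), (8, [1, 2, 4, 8, 23]), (8, [1, 2, 4, 8, 24]),
    (8, [1, 2, 4, 8, 25]), (8, [1, 2, 4, 8, 26]), (8, [1, 2, 4, 8, 27]), (8, [1, 2, 4, 8, 28]),
    (8, [1, 2, 4, 8, 29]), (8, [1, 2, 4, 8, 30]), (8, [1, 2, 4, 8, 31])],
    [(2, [1, 2, 4, 8, 16]), (2, [1, 3, 4, 9, 16]), (3, [1, 2, 4, 8, 16]), (2, [1, 12, 4, 6, 16]),
    (2, [1, 13, 4, 7, 16]), (2, [1, 12, 8, 6, 16]), (2, [1, 13, 9, 7, 16]), (9, [1, 2, 4, 8, 16]),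
    (9, [1, 2, 4, 8, 17]), (9, [1, 2, 4, 8, 18]), (9, [1, 2, 4, 8, 19]), (9, [1, 2, 4, 8, 20]),
    (9, [1, 2, 4, 8, 21]), (9, [1, 2, 4, 8, 22]), (9, [1, 2, 4, 8, 23]), (9, [1, 2, 4, 8, 24]),
    (9, [1, 2, 4, 8, 25]), (9, [1, 2, 4, 8, 26]), (9, [1, 2, 4, 8, 27]), (9, [1, 2, 4, 8, 28]),
    (9, [1, 2, 4, 8, 29]), (9, [1, 2, 4, 8, 30]), (9, [1, 2, 4, 8, 31])],
    [(3, [1, 2, 4, 8, 16]), (3, [2, 1, 4, 8, 16]), (3, [2, 3, 4, 8, 16]), (3, [2, 12, 4, 5, 16]),
    (3, [2, 12, 4, 7, 16]), (3, [2, 12, 4, 9, 16]), (3, [2, 12, 4, 11, 16]), (10, [1, 2, 4, 8,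
    16]), (10, [1, 2, 4, 8, 17]), (10, [1, 2, 4, 8, 18]), (10, [1, 2, 4, 8, 19]), (10, [1, 2, 4,
    8, 20]), (10, [1, 2, 4, 8, 21]), (10, [1, 2, 4, 8, 22]), (10, [1, 2, 4, 8, 23]), (10, [1, 2,
    4, 8, 24]), (10, [1, 2, 4, 8, 25]), (10, [1, 2, 4, 8, 26]), (10, [1, 2, 4, 8, 27]), (10, [1,
    2, 4, 8, 28]), (10, [1, 2, 4, 8, 29]), (10, [1, 2, 4, 8, 30]), (10, [1, 2, 4, 8, 31])],
    [(5, [1, 2, 4, 8, 16]), (6, [1, 2, 4, 8, 16]), (6, [2, 1, 4, 8, 16]), (6, [2, 3, 6, 8, 16]),
    (6, [2, 4, 1, 8, 16]), (6, [2, 6, 3, 8, 16]), (6, [6, 2, 3, 8, 16]), (7, [2, 4, 7, 8, 16]),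
    (6, [1, 2, 4, 16, 8]), (6, [2, 1, 4, 16, 8]), (6, [2, 3, 6, 16, 8]), (6, [2, 4, 1, 16, 8]),
    (6, [2, 6, 3, 16, 8]), (6, [6, 2, 3, 16, 8]), (7, [2, 4, 7, 16, 8]), (21, [2, 4, 8, 1, 16]),
    (23, [2, 4, 8, 3, 16]), (23, [4, 2, 8, 3, 16]), (23, [4, 6, 12, 3, 16]), (23, [4, 8, 2, 3,
    16]), (23, [4, 12, 6, 3, 16]), (23, [12, 4, 6, 3, 16]), (27, [4, 8, 14, 3, 16])],
    [(6, [1, 2, 4, 8, 16]), (6, [1, 2, 5, 8, 16]), (6, [1, 2, 8, 4, 16]), (6, [1, 2, 8, 5, 16]),
    (6, [1, 8, 2, 4, 16]), (6, [1, 8, 2, 5, 16]), (9, [1, 4, 6, 8, 16]), (9, [1, 4, 6, 9, 16]),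
    (11, [1, 2, 4, 8, 16]), (12, [1, 2, 8, 16, 4]), (12, [1, 3, 8, 16, 4]), (12, [1, 8, 2, 16,
    4]), (12, [1, 8, 3, 16, 4]), (17, [1, 4, 6, 16, 8]), (17, [1, 4, 7, 16, 8]), (12, [1, 8, 16,
    2, 4]), (12, [1, 8, 16, 3, 4]), (17, [1, 4, 16, 6, 8]), (17, [1, 4, 16, 7, 8]), (17, [1, 16,
    4, 6, 8]), (17, [1, 16, 4, 7, 8]), (28, [6, 3, 8, 10, 16]), (28, [6, 3, 8, 12, 16])],
    [(6, [1, 2, 4, 8, 16]), (6, [1, 2, 6, 8, 16]), (6, [2, 1, 8, 4, 16]), (6, [2, 1, 8, 6, 16]),
    (8, [1, 4, 2, 8, 16]), (8, [1, 4, 2, 9, 16]), (8, [1, 4, 6, 8, 16]), (8, [1, 4, 6, 9, 16]),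
    (12, [1, 2, 4, 8, 16]), (12, [2, 1, 8, 4, 16]), (14, [1, 2, 8, 16, 5]), (15, [1, 4, 2, 16,
    8]), (16, [1, 5, 3, 16, 8]), (15, [1, 4, 6, 16, 8]), (16, [1, 5, 6, 16, 8]), (15, [4, 1, 16,
    2, 8]), (15, [4, 1, 16, 6, 8]), (16, [5, 1, 16, 3, 8]), (16, [5, 1, 16, 6, 8]), (24, [6, 10,
    2, 3, 16]), (24, [6, 10, 2, 5, 16]), (24, [6, 10, 8, 3, 16]), (24, [6, 10, 8, 5, 16])],
    [(6, [1, 2, 4, 8, 16]), (7, [1, 2, 4, 8, 16]), (8, [3, 1, 5, 9, 16]), (8, [3, 1, 5, 10, 16]),
    (8, [3, 5, 1, 9, 16]), (8, [3, 5, 1, 10, 16]), (9, [2, 4, 5, 8, 16]), (9, [2, 4, 5, 10, 16]),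
    (13, [1, 2, 4, 8, 16]), (16, [2, 1, 4, 8, 16]), (16, [2, 3, 6, 8, 16]), (16, [2, 4, 1, 8,
    16]), (16, [2, 6, 3, 8, 16]), (17, [2, 4, 5, 8, 16]), (18, [1, 4, 7, 16, 8]), (22, [2, 4, 8,
    1, 16]), (22, [2, 4, 8, 3, 16]), (19, [12, 4, 6, 5, 16]), (19, [12, 4, 6, 9, 16]), (19, [12,
    6, 4, 5, 16]), (19, [12, 6, 4, 9, 16]), (26, [15, 5, 7, 3, 16]), (26, [15, 5, 7, 12, 16])],
    [(9, [1, 2, 4, 8, 16]), (9, [2, 1, 4, 8, 16]), (9, [2, 3, 4, 10, 16]), (10, [1, 2, 4, 8, 16]),
    (9, [2, 12, 4, 5, 16]), (9, [2, 14, 4, 7, 16]), (9, [14, 2, 4, 7, 16]), (9, [14, 12, 10, 9,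
    16]), (20, [1, 2, 4, 8, 16]), (20, [2, 1, 4, 8, 16]), (20, [2, 3, 4, 10, 16]), (25, [2, 4, 1,
    8, 16]), (25, [2, 6, 3, 10, 16]), (25, [6, 2, 3, 10, 16]), (25, [6, 4, 3, 12, 16]), (25, [6,
    9, 3, 1, 16]), (25, [6, 15, 3, 7, 16]), (25, [15, 6, 3, 7, 16]), (29, [6, 11, 3, 12, 16]),
    (20, [2, 12, 4, 5, 16]), (20, [2, 14, 4, 7, 16]), (20, [14, 2, 4, 7, 16]), (20, [14, 12, 10,
    9, 16])],
    [(11, [1, 2, 4, 8, 16]), (13, [1, 2, 4, 8, 16]), (13, [1, 2, 5, 8, 16]), (13, [1, 2, 8, 4,
    16]), (13, [1, 2, 8, 5, 16]), (13, [1, 8, 2, 4, 16]), (13, [1, 8, 2, 5, 16]), (20, [1, 4, 6,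
    8, 16]), (20, [1, 4, 6, 9, 16]), (13, [1, 2, 8, 16, 4]), (13, [1, 2, 8, 16, 5]), (13, [1, 8,
    2, 16, 4]), (13, [1, 8, 2, 16, 5]), (20, [1, 4, 6, 16, 8]), (20, [1, 4, 6, 16, 9]), (13, [1,
    8, 16, 2, 4]), (13, [1, 8, 16, 2, 5]), (20, [1, 4, 16, 6, 8]), (20, [1, 4, 16, 6, 9]), (20,
    [1, 16, 4, 6, 8]), (20, [1, 16, 4, 6, 9]), (33, [1, 6, 8, 12, 16]), (33, [1, 6, 8, 12, 17])],
    [(12, [1, 2, 4, 8, 16]), (12, [1, 4, 2, 8, 16]), (12, [1, 4, 6, 8, 16]), (15, [1, 2, 8, 4,
    16]), (15, [1, 2, 8, 5, 16]), (15, [1, 8, 2, 4, 16]), (15, [1, 8, 2, 5, 16]), (15, [1, 8, 10,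
    4, 16]), (15, [1, 8, 10, 5, 16]), (15, [1, 2, 8, 16, 4]), (15, [1, 2, 8, 16, 5]), (15, [1, 8,
    2, 16, 4]), (15, [1, 8, 2, 16, 5]), (15, [1, 8, 10, 16, 4]), (15, [1, 8, 10, 16, 5]), (21, [2,
    1, 16, 4, 8]), (21, [2, 1, 16, 4, 10]), (22, [12, 1, 16, 4, 6]), (22, [12, 1, 16, 4, 10]),
    (22, [12, 16, 1, 4, 6]), (22, [12, 16, 1, 4, 10]), (22, [12, 16, 17, 4, 6]), (22, [12, 16, 17,
    4, 10])],
    [(12, [1, 2, 4, 8, 16]), (12, [1, 5, 3, 8, 16]), (12, [1, 5, 6, 8, 16]), (16, [1, 2, 8, 4,
    16]), (16, [1, 2, 8, 5, 16]), (16, [1, 9, 3, 5, 16]), (16, [1, 9, 3, 4, 16]), (16, [1, 9, 10,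
    5, 16]), (16, [1, 9, 10, 4, 16]), (16, [1, 2, 8, 16, 4]), (16, [1, 2, 8, 16, 5]), (16, [1, 9,
    3, 16, 5]), (16, [1, 9, 3, 16, 4]), (16, [1, 9, 10, 16, 5]), (16, [1, 9, 10, 16, 4]), (23, [2,
    1, 16, 4, 8]), (23, [2, 1, 16, 4, 10]), (26, [2, 1, 16, 5, 8]), (26, [2, 1, 16, 5, 10]), (26,
    [2, 18, 3, 5, 10]), (26, [2, 18, 3, 5, 8]), (26, [2, 18, 17, 5, 10]), (26, [2, 18, 17, 5, 8])],
    [(12, [1, 2, 4, 8, 16]), (13, [1, 2, 4, 8, 16]), (13, [1, 2, 6, 8, 16]), (16, [2, 1, 16, 4,
    8]), (16, [2, 1, 16, 6, 8]), (19, [1, 4, 2, 8, 16]), (19, [1, 4, 2, 9, 16]), (19, [1, 4, 6, 8,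
    16]), (19, [1, 4, 6, 9, 16]), (16, [2, 1, 16, 8, 4]), (16, [2, 1, 16, 8, 6]), (19, [1, 4, 2,
    16, 8]), (19, [1, 4, 2, 16, 9]), (19, [1, 4, 6, 16, 8]), (19, [1, 4, 6, 16, 9]), (22, [2, 1,
    16, 4, 8]), (22, [2, 1, 16, 4, 10]), (25, [2, 1, 16, 5, 8]), (25, [2, 1, 16, 5, 10]), (32,
    [14, 2, 16, 6, 7]), (32, [14, 2, 16, 6, 9]), (32, [14, 2, 18, 6, 7]), (32, [14, 2, 18, 6, 9])],
    [(14, [1, 2, 4, 8, 16]), (15, [1, 2, 4, 8, 16]), (15, [1, 2, 7, 8, 16]), (16, [1, 3, 9, 5,
    16]), (16, [1, 3, 9, 6, 16]), (22, [1, 4, 2, 8, 16]), (22, [1, 4, 7, 12, 16]), (22, [1, 4, 2,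
    12, 16]), (22, [1, 4, 7, 8, 16]), (16, [3, 1, 11, 16, 5]), (16, [3, 1, 11, 16, 6]), (22, [4,
    1, 2, 16, 8]), (22, [4, 1, 2, 16, 12]), (22, [4, 1, 7, 16, 12]), (22, [4, 1, 7, 16, 8]), (24,
    [2, 3, 18, 6, 10]), (24, [2, 3, 18, 6, 8]), (24, [2, 3, 18, 5, 10]), (24, [2, 3, 18, 5, 8]),
    (31, [3, 12, 5, 4, 17]), (31, [3, 12, 5, 4, 18]), (31, [3, 12, 5, 8, 17]), (31, [3, 12, 5, 8,
    18])],
    [(15, [1, 2, 4, 8, 16]), (16, [1, 2, 4, 8, 16]), (17, [1, 2, 4, 8, 16]), (17, [1, 12, 4, 6,
    16]), (17, [1, 12, 4, 10, 16]), (15, [1, 12, 4, 6, 16]), (16, [1, 12, 4, 6, 16]), (15, [1, 12,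
    4, 10, 16]), (16, [1, 12, 4, 10, 16]), (19, [2, 1, 4, 16, 8]), (19, [2, 1, 4, 16, 10]), (23,
    [4, 1, 2, 16, 8]), (23, [4, 1, 2, 16, 12]), (24, [6, 1, 3, 16, 10]), (24, [6, 1, 3, 16, 12]),
    (24, [6, 19, 3, 2, 10]), (24, [6, 19, 3, 2, 12]), (24, [6, 19, 3, 17, 10]), (24, [6, 19, 3,
    17, 12]), (19, [2, 20, 4, 5, 8]), (19, [2, 20, 4, 5, 10]), (19, [2, 20, 4, 17, 8]), (19, [2,
    20, 4, 17, 10])],
    [(16, [1, 2, 4, 8, 16]), (16, [2, 1, 4, 16, 8]), (18, [1, 2, 4, 8, 16]), (19, [1, 3, 5, 9,
    16]), (19, [1, 3, 5, 10, 16]), (24, [1, 4, 2, 8, 16]), (26, [1, 4, 3, 8, 16]), (24, [1, 4, 2,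
    12, 16]), (26, [1, 4, 3, 12, 16]), (19, [3, 1, 5, 16, 9]), (19, [3, 1, 5, 16, 10]), (24, [4,
    1, 2, 16, 8]), (24, [4, 1, 2, 16, 12]), (26, [4, 1, 3, 16, 8]), (26, [4, 1, 3, 16, 12]), (31,
    [1, 2, 16, 4, 8]), (31, [1, 2, 16, 4, 9]), (31, [1, 2, 16, 6, 8]), (31, [1, 2, 16, 6, 9]),
    (32, [4, 22, 6, 7, 8]), (32, [4, 22, 6, 7, 12]), (32, [4, 22, 6, 17, 8]), (32, [4, 22, 6, 17,
    12])],
    [(17, [1, 2, 4, 8, 16]), (17, [2, 1, 4, 16, 8]), (18, [1, 2, 4, 8, 16]), (20, [1, 2, 4, 8,
    16]), (20, [1, 2, 4, 10, 16]), (19, [1, 12, 4, 6, 16]), (19, [1, 12, 5, 6, 16]), (19, [1, 12,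
    4, 10, 16]), (19, [1, 12, 5, 10, 16]), (20, [2, 1, 4, 16, 8]), (20, [2, 1, 4, 16, 10]), (19,
    [12, 1, 4, 16, 6]), (19, [12, 1, 4, 16, 10]), (19, [12, 1, 5, 16, 6]), (19, [12, 1, 5, 16,
    10]), (32, [1, 14, 6, 2, 16]), (32, [1, 14, 6, 2, 17]), (32, [1, 14, 6, 12, 16]), (32, [1, 14,
    6, 12, 17]), (30, [1, 12, 4, 6, 16]), (30, [1, 12, 4, 6, 17]), (30, [1, 12, 4, 10, 16]), (30,
    [1, 12, 4, 10, 17])],
    [(22, [1, 2, 4, 8, 16]), (23, [1, 2, 4, 8, 16]), (24, [1, 4, 2, 8, 16]), (24, [1, 4, 6, 12,
    16]), (24, [1, 4, 8, 2, 16]), (24, [1, 4, 12, 6, 16]), (26, [1, 13, 5, 7, 16]), (27, [1, 2, 4,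
    8, 16]), (28, [1, 2, 8, 14, 16]), (22, [18, 2, 4, 8, 3]), (22, [18, 2, 4, 8, 17]), (24, [20,
    4, 6, 12, 5]), (24, [20, 4, 6, 12, 17]), (24, [20, 4, 2, 8, 5]), (24, [20, 4, 2, 8, 17]), (24,
    [25, 9, 12, 10, 8]), (24, [25, 9, 12, 10, 17]), (24, [25, 9, 5, 3, 8]), (24, [25, 9, 5, 3,
    17]), (28, [27, 11, 3, 5, 10]), (28, [27, 11, 3, 5, 17]), (26, [29, 13, 5, 7, 12]), (26, [29,
    13, 5, 7, 17])],
    [(25, [1, 2, 4, 8, 16]), (26, [1, 2, 4, 8, 16]), (26, [1, 4, 2, 8, 16]), (26, [1, 4, 6, 12,
    16]), (26, [1, 4, 9, 3, 16]), (26, [1, 4, 13, 7, 16]), (26, [1, 13, 4, 7, 16]), (29, [1, 2, 4,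
    8, 16]), (28, [1, 2, 9, 12, 16]), (32, [3, 1, 5, 9, 17]), (32, [3, 1, 5, 9, 18]), (32, [3, 5,
    1, 9, 17]), (32, [3, 5, 1, 9, 18]), (32, [3, 5, 4, 12, 17]), (32, [3, 5, 4, 12, 18]), (32, [3,
    5, 10, 2, 18]), (32, [3, 5, 10, 2, 17]), (32, [3, 5, 15, 7, 18]), (32, [3, 5, 15, 7, 17]),
    (32, [3, 15, 5, 7, 18]), (32, [3, 15, 5, 7, 17]), (33, [2, 4, 10, 13, 18]), (33, [2, 4, 10,
    13, 16])]]"

definition maps\<^sub>9 :: "(int \<times> int list) list list" where
  "maps\<^sub>9 =
    [[(4, [1, 6, 24, 26, 8]), (4, [1, 6, 24, 26, 8]), (4, [1, 24, 6, 26, 8]), (4, [1, 24, 6, 26,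
    8]), (4, [1, 24, 30, 26, 8]), (4, [1, 24, 30, 26, 8]), (1, [1, 2, 28, 26, 12]), (1, [1, 2, 28,
    26, 13]), (1, [1, 2, 28, 26, 14]), (1, [1, 2, 28, 26, 15]), (1, [1, 2, 28, 26, 16]), (1, [1,
    2, 28, 26, 17]), (1, [1, 2, 28, 26, 18]), (1, [1, 2, 28, 26, 19]), (1, [1, 2, 28, 26, 22]),
    (1, [1, 2, 28, 26, 23]), (1, [1, 2, 28, 26, 20]), (1, [1, 2, 28, 26, 21]), (1, [1, 2, 28, 26,
    10]), (1, [1, 2, 28, 26, 11]), (1, [1, 2, 28, 26, 8]), (1, [1, 2, 28, 26, 9])],
    [(4, [1, 6, 24, 26, 8]), (4, [1, 6, 24, 26, 8]), (2, [1, 26, 29, 31, 8]), (0, [25, 3, 28, 30,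
    8]), (0, [3, 25, 28, 30, 8]), (0, [3, 26, 29, 31, 8]), (0, [3, 25, 28, 30, 14]), (0, [3, 25,
    28, 30, 13]), (0, [3, 25, 28, 30, 23]), (0, [3, 25, 28, 30, 20]), (0, [3, 25, 28, 30, 18]),
    (0, [3, 25, 28, 30, 17]), (0, [3, 25, 28, 30, 11]), (0, [3, 25, 28, 30, 8]), (0, [3, 25, 28,
    30, 16]), (0, [3, 25, 28, 30, 19]), (0, [3, 25, 28, 30, 9]), (0, [3, 25, 28, 30, 10]), (0, [3,
    25, 28, 30, 12]), (0, [3, 25, 28, 30, 15]), (0, [3, 25, 28, 30, 21]), (0, [3, 25, 28, 30,
    22])],
    [(4, [1, 6, 24, 26, 8]), (4, [1, 6, 24, 26, 8]), (0, [3, 5, 25, 30, 8]), (0, [3, 5, 26, 30,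
    8]), (0, [3, 5, 28, 30, 8]), (0, [3, 5, 31, 30, 8]), (0, [3, 5, 25, 30, 14]), (0, [3, 5, 25,
    30, 13]), (0, [3, 5, 25, 30, 11]), (0, [3, 5, 25, 30, 8]), (0, [3, 5, 25, 30, 23]), (0, [3, 5,
    25, 30, 20]), (0, [3, 5, 25, 30, 18]), (0, [3, 5, 25, 30, 17]), (0, [3, 5, 25, 30, 16]), (0,
    [3, 5, 25, 30, 19]), (0, [3, 5, 25, 30, 21]), (0, [3, 5, 25, 30, 22]), (0, [3, 5, 25, 30, 9]),
    (0, [3, 5, 25, 30, 10]), (0, [3, 5, 25, 30, 12]), (0, [3, 5, 25, 30, 15])],
    [(4, [1, 6, 24, 26, 8]), (4, [1, 7, 24, 26, 8]), (4, [1, 2, 24, 30, 8]), (4, [1, 2, 24, 30,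
    8]), (4, [1, 2, 24, 28, 8]), (4, [1, 2, 24, 28, 8]), (6, [7, 1, 24, 26, 19]), (6, [7, 1, 24,
    26, 20]), (6, [7, 1, 24, 26, 18]), (6, [7, 1, 24, 26, 21]), (6, [7, 1, 24, 26, 11]), (6, [7,
    1, 24, 26, 12]), (6, [7, 1, 24, 26, 10]), (6, [7, 1, 24, 26, 13]), (6, [7, 1, 24, 26, 9]), (6,
    [7, 1, 24, 26, 14]), (6, [7, 1, 24, 26, 8]), (6, [7, 1, 24, 26, 15]), (6, [7, 1, 24, 26, 17]),
    (6, [7, 1, 24, 26, 22]), (6, [7, 1, 24, 26, 16]), (6, [7, 1, 24, 26, 23])],
    [(0, [25, 3, 5, 30, 8]), (0, [6, 3, 26, 29, 8]), (0, [6, 3, 27, 28, 8]), (0, [6, 27, 3, 28,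
    8]), (0, [24, 3, 5, 31, 8]), (0, [24, 27, 29, 7, 8]), (0, [6, 3, 26, 29, 14]), (0, [6, 3, 26,
    29, 8]), (0, [6, 3, 26, 29, 13]), (0, [6, 3, 26, 29, 11]), (0, [6, 3, 26, 29, 20]), (0, [6, 3,
    26, 29, 18]), (0, [6, 3, 26, 29, 23]), (0, [6, 3, 26, 29, 17]), (0, [6, 3, 26, 29, 19]), (0,
    [6, 3, 26, 29, 21]), (0, [6, 3, 26, 29, 16]), (0, [6, 3, 26, 29, 22]), (0, [6, 3, 26, 29, 9]),
    (0, [6, 3, 26, 29, 15]), (0, [6, 3, 26, 29, 10]), (0, [6, 3, 26, 29, 12])],
    [(1, [1, 2, 28, 26, 12]), (1, [1, 2, 28, 21, 12]), (1, [1, 2, 28, 12, 21]), (1, [1, 28, 2, 21,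
    12]), (1, [1, 28, 2, 12, 21]), (1, [1, 28, 30, 21, 12]), (1, [1, 28, 30, 12, 21]), (1, [1, 2,
    28, 12, 26]), (1, [1, 2, 28, 12, 21]), (1, [1, 2, 28, 21, 12]), (1, [1, 28, 2, 12, 21]), (1,
    [1, 28, 2, 21, 12]), (1, [1, 28, 30, 12, 21]), (1, [1, 28, 30, 21, 12]), (1, [1, 2, 28, 12,
    23]), (1, [1, 2, 28, 12, 23]), (1, [1, 2, 28, 12, 21]), (1, [1, 2, 28, 12, 21]), (1, [1, 28,
    2, 12, 21]), (1, [1, 28, 2, 12, 21]), (1, [1, 28, 30, 12, 21]), (1, [1, 28, 30, 12, 21])],
    [(1, [1, 2, 28, 26, 12]), (0, [3, 25, 28, 30, 14]), (0, [3, 25, 28, 29, 14]), (0, [3, 28, 25,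
    30, 14]), (0, [3, 28, 25, 29, 14]), (0, [3, 25, 28, 30, 14]), (0, [3, 25, 28, 29, 14]), (0,
    [25, 3, 28, 7, 14]), (0, [3, 25, 28, 29, 14]), (0, [3, 26, 29, 28, 14]), (0, [3, 28, 25, 29,
    14]), (0, [3, 29, 26, 28, 14]), (1, [1, 28, 30, 26, 21]), (0, [25, 3, 28, 14, 27]), (1, [1, 2,
    28, 26, 15]), (1, [1, 2, 28, 26, 12]), (1, [1, 2, 28, 26, 15]), (1, [1, 2, 28, 26, 12]), (1,
    [1, 28, 2, 26, 15]), (1, [1, 28, 2, 26, 12]), (1, [1, 28, 30, 26, 15]), (1, [1, 28, 30, 26,
    12])],
    [(1, [1, 2, 28, 26, 12]), (0, [6, 3, 25, 29, 14]), (0, [6, 3, 25, 27, 14]), (0, [6, 3, 26, 29,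
    14]), (0, [6, 3, 26, 27, 14]), (0, [6, 3, 25, 29, 14]), (0, [6, 3, 25, 27, 14]), (3, [1, 14,
    22, 26, 28]), (0, [2, 25, 5, 29, 14]), (0, [2, 27, 5, 29, 14]), (0, [6, 3, 25, 27, 14]), (0,
    [6, 3, 31, 27, 14]), (0, [6, 3, 26, 27, 14]), (0, [6, 3, 28, 27, 14]), (1, [3, 1, 28, 12,
    23]), (1, [3, 1, 28, 12, 21]), (1, [3, 1, 28, 12, 23]), (1, [3, 1, 28, 12, 21]), (1, [1, 28,
    2, 26, 15]), (1, [1, 28, 2, 26, 12]), (1, [1, 28, 30, 26, 15]), (1, [1, 28, 30, 26, 12])],
    [(0, [3, 25, 28, 30, 14]), (0, [3, 5, 25, 30, 14]), (0, [3, 5, 30, 25, 14]), (0, [3, 5, 25,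
    30, 14]), (0, [3, 5, 26, 30, 14]), (0, [3, 5, 28, 30, 14]), (0, [3, 5, 30, 31, 14]), (0, [25,
    3, 28, 30, 14]), (0, [3, 25, 28, 30, 14]), (0, [3, 26, 29, 31, 14]), (0, [3, 5, 25, 30, 14]),
    (0, [3, 5, 26, 30, 14]), (0, [3, 5, 28, 30, 14]), (0, [3, 5, 31, 30, 14]), (0, [3, 5, 30, 25,
    14]), (0, [3, 5, 30, 26, 14]), (0, [3, 5, 30, 28, 14]), (0, [3, 5, 30, 31, 14]), (0, [27, 29,
    7, 30, 14]), (0, [27, 3, 28, 30, 14]), (0, [3, 27, 28, 30, 14]), (1, [12, 21, 15, 23, 28])],
    [(0, [3, 5, 25, 30, 14]), (0, [3, 6, 25, 29, 14]), (6, [7, 1, 24, 26, 19]), (0, [3, 5, 25, 30,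
    14]), (0, [3, 4, 25, 31, 14]), (0, [3, 5, 28, 30, 14]), (0, [3, 4, 29, 31, 14]), (5, [1, 10,
    22, 31, 26]), (5, [1, 2, 28, 23, 25]), (5, [1, 2, 28, 23, 25]), (0, [3, 5, 25, 30, 14]), (0,
    [3, 6, 26, 29, 14]), (0, [3, 5, 28, 30, 14]), (0, [3, 6, 28, 29, 14]), (0, [3, 2, 28, 25,
    14]), (0, [3, 1, 28, 26, 14]), (5, [1, 10, 22, 31, 15]), (5, [1, 10, 22, 31, 15]), (5, [1, 10,
    28, 31, 25]), (5, [1, 10, 28, 31, 25]), (5, [1, 10, 22, 31, 25]), (5, [1, 10, 22, 31, 25])],
    [(6, [7, 1, 24, 26, 19]), (6, [1, 7, 24, 26, 19]), (6, [1, 6, 24, 26, 19]), (6, [1, 2, 24, 31,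
    19]), (6, [1, 2, 24, 30, 19]), (6, [1, 2, 24, 29, 19]), (6, [1, 2, 24, 28, 19]), (3, [1, 2,
    24, 28, 14]), (3, [2, 1, 24, 28, 14]), (3, [2, 3, 24, 28, 14]), (3, [1, 2, 24, 28, 14]), (3,
    [1, 2, 24, 28, 14]), (3, [2, 1, 24, 28, 14]), (3, [2, 3, 24, 28, 14]), (3, [2, 4, 24, 25,
    14]), (3, [2, 4, 24, 27, 14]), (3, [2, 4, 24, 29, 14]), (3, [2, 4, 24, 31, 14]), (3, [2, 4,
    24, 25, 14]), (3, [2, 4, 24, 27, 14]), (3, [2, 4, 24, 29, 14]), (3, [2, 4, 24, 31, 14])],
    [(0, [25, 3, 28, 7, 14]), (0, [25, 3, 5, 7, 14]), (0, [25, 3, 5, 30, 14]), (0, [25, 3, 5, 7,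
    14]), (0, [25, 3, 5, 30, 14]), (0, [25, 3, 5, 7, 14]), (5, [1, 22, 28, 31, 26]), (5, [1, 22,
    28, 30, 26]), (0, [25, 3, 5, 14, 30]), (0, [25, 3, 5, 14, 7]), (0, [25, 3, 5, 14, 30]), (0,
    [25, 3, 5, 14, 7]), (5, [1, 22, 28, 26, 31]), (5, [1, 22, 28, 26, 30]), (0, [25, 3, 14, 5,
    30]), (0, [25, 3, 14, 5, 7]), (5, [1, 22, 26, 28, 31]), (5, [1, 22, 26, 28, 30]), (5, [1, 22,
    26, 28, 31]), (5, [1, 22, 26, 28, 30]), (5, [1, 22, 26, 28, 31]), (5, [1, 22, 26, 28, 30])],
    [(0, [25, 3, 28, 7, 14]), (0, [25, 3, 29, 5, 14]), (0, [3, 25, 14, 28, 29]), (0, [3, 25, 14,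
    29, 28]), (0, [25, 3, 28, 7, 14]), (0, [25, 3, 28, 30, 14]), (0, [25, 3, 29, 5, 14]), (0, [25,
    3, 29, 28, 14]), (0, [3, 25, 14, 28, 30]), (0, [3, 25, 14, 28, 29]), (0, [25, 3, 28, 14, 7]),
    (0, [25, 3, 28, 14, 30]), (0, [25, 3, 29, 14, 5]), (0, [25, 3, 29, 14, 28]), (1, [1, 26, 15,
    2, 28]), (1, [1, 26, 15, 2, 28]), (0, [3, 25, 14, 28, 30]), (0, [3, 25, 14, 28, 29]), (1, [1,
    26, 15, 28, 31]), (1, [1, 26, 15, 28, 30]), (1, [1, 26, 15, 28, 30]), (1, [1, 26, 15, 28,
    31])],
    [(0, [25, 3, 28, 7, 14]), (3, [1, 14, 22, 26, 28]), (0, [25, 3, 28, 30, 14]), (0, [25, 3, 28,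
    7, 14]), (0, [25, 3, 28, 7, 14]), (0, [25, 3, 28, 30, 14]), (5, [1, 28, 30, 23, 26]), (5, [1,
    28, 30, 22, 26]), (0, [25, 3, 28, 14, 30]), (0, [25, 3, 28, 14, 7]), (0, [25, 3, 28, 14, 7]),
    (0, [25, 3, 28, 14, 30]), (5, [1, 28, 30, 22, 27]), (5, [1, 28, 30, 22, 26]), (5, [3, 1, 28,
    21, 26]), (5, [3, 1, 28, 21, 25]), (3, [1, 24, 14, 26, 28]), (3, [1, 24, 14, 26, 28]), (3, [1,
    14, 24, 26, 28]), (3, [1, 14, 24, 26, 28]), (3, [1, 14, 22, 26, 28]), (3, [1, 14, 22, 26,
    28])],
    [(0, [3, 25, 28, 14, 29]), (0, [3, 25, 6, 14, 29]), (0, [3, 26, 13, 29, 28]), (0, [3, 26, 13,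
    5, 29]), (0, [25, 3, 4, 31, 14]), (0, [25, 3, 28, 30, 14]), (0, [25, 3, 4, 28, 14]), (0, [25,
    3, 28, 29, 14]), (0, [3, 25, 6, 14, 30]), (0, [3, 25, 6, 14, 29]), (0, [3, 25, 6, 14, 29]),
    (0, [3, 25, 6, 14, 30]), (0, [3, 25, 30, 14, 28]), (0, [3, 25, 30, 14, 31]), (0, [3, 26, 13,
    5, 30]), (0, [3, 26, 13, 5, 29]), (0, [3, 26, 13, 29, 28]), (0, [3, 26, 13, 29, 31]), (1, [1,
    26, 13, 15, 28]), (1, [1, 26, 13, 15, 28]), (1, [1, 26, 13, 21, 28]), (1, [1, 26, 13, 21,
    28])],
    [(0, [3, 25, 28, 14, 29]), (1, [1, 2, 28, 21, 26]), (0, [25, 3, 28, 30, 14]), (0, [25, 3, 28,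
    29, 14]), (1, [12, 1, 3, 28, 23]), (0, [25, 3, 28, 30, 14]), (1, [12, 1, 3, 28, 23]), (0, [25,
    3, 28, 29, 14]), (0, [3, 25, 28, 14, 30]), (0, [3, 25, 28, 14, 29]), (1, [1, 12, 3, 23, 28]),
    (1, [1, 12, 3, 23, 28]), (0, [3, 25, 28, 14, 30]), (0, [3, 25, 28, 14, 29]), (1, [1, 2, 28,
    21, 26]), (1, [1, 2, 28, 21, 27]), (1, [1, 2, 28, 21, 27]), (1, [1, 2, 28, 21, 26]), (1, [12,
    28, 3, 1, 23]), (1, [12, 28, 3, 1, 27]), (1, [12, 28, 3, 29, 23]), (1, [12, 28, 3, 29, 27])],
    [(0, [3, 25, 28, 14, 29]), (0, [25, 2, 5, 29, 14]), (0, [25, 26, 5, 7, 14]), (0, [25, 26, 5,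
    29, 14]), (0, [25, 2, 5, 31, 14]), (0, [25, 26, 5, 7, 14]), (0, [25, 2, 5, 29, 14]), (0, [25,
    26, 5, 29, 14]), (0, [3, 25, 28, 14, 30]), (0, [3, 25, 28, 14, 29]), (1, [1, 13, 2, 23, 28]),
    (1, [1, 13, 2, 23, 28]), (0, [3, 25, 28, 14, 30]), (0, [3, 25, 28, 14, 29]), (1, [1, 3, 28,
    12, 27]), (1, [1, 3, 28, 12, 26]), (1, [1, 3, 28, 12, 26]), (1, [1, 3, 28, 12, 27]), (5, [1,
    14, 23, 21, 28]), (5, [1, 14, 23, 21, 28]), (5, [1, 14, 23, 27, 28]), (5, [1, 14, 23, 27,
    28])],
    [(1, [1, 2, 28, 21, 26]), (0, [25, 2, 5, 29, 14]), (5, [1, 10, 22, 31, 26]), (5, [1, 10, 22,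
    21, 26]), (0, [25, 6, 3, 29, 14]), (0, [25, 6, 3, 29, 14]), (0, [25, 6, 3, 27, 14]), (0, [25,
    6, 3, 27, 14]), (5, [1, 2, 28, 21, 27]), (5, [1, 2, 28, 21, 26]), (1, [1, 24, 2, 15, 28]), (1,
    [1, 24, 2, 15, 28]), (1, [1, 24, 26, 15, 28]), (1, [1, 24, 26, 15, 28]), (1, [1, 2, 28, 21,
    26]), (1, [1, 2, 28, 21, 27]), (1, [1, 2, 28, 21, 27]), (1, [1, 2, 28, 21, 26]), (5, [1, 12,
    22, 21, 28]), (5, [1, 12, 22, 21, 28]), (5, [1, 12, 22, 25, 28]), (5, [1, 12, 22, 25, 28])],
    [(0, [25, 2, 5, 29, 14]), (0, [2, 25, 5, 14, 29]), (5, [2, 3, 28, 21, 25]), (5, [2, 3, 28, 22,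
    25]), (0, [25, 2, 5, 31, 14]), (0, [25, 2, 5, 31, 14]), (0, [25, 2, 5, 29, 14]), (0, [25, 2,
    5, 29, 14]), (5, [2, 3, 28, 21, 25]), (5, [2, 3, 28, 21, 27]), (0, [2, 25, 5, 14, 31]), (0,
    [2, 25, 5, 14, 29]), (0, [2, 25, 5, 14, 31]), (0, [2, 25, 5, 14, 29]), (1, [2, 3, 28, 12,
    23]), (1, [2, 3, 28, 12, 21]), (1, [2, 3, 28, 12, 21]), (1, [2, 3, 28, 12, 23]), (5, [3, 12,
    21, 23, 28]), (5, [3, 12, 21, 23, 28]), (5, [3, 12, 21, 27, 28]), (5, [3, 12, 21, 27, 28])],
    [(0, [25, 3, 28, 30, 14]), (0, [25, 3, 28, 30, 14]), (5, [2, 1, 28, 23, 25]), (5, [3, 1, 22,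
    28, 25]), (1, [13, 28, 1, 2, 23]), (0, [25, 3, 28, 30, 14]), (1, [13, 28, 1, 2, 23]), (1, [2,
    12, 3, 23, 28]), (5, [3, 1, 22, 26, 28]), (5, [3, 1, 22, 26, 28]), (1, [2, 12, 3, 23, 28]),
    (1, [2, 12, 3, 23, 28]), (5, [2, 1, 23, 28, 25]), (5, [2, 1, 23, 28, 27]), (1, [2, 12, 23, 3,
    28]), (1, [2, 12, 23, 3, 28]), (5, [2, 1, 28, 23, 25]), (5, [2, 1, 28, 23, 27]), (3, [2, 14,
    24, 25, 28]), (3, [2, 14, 24, 25, 28]), (5, [2, 15, 21, 25, 28]), (5, [2, 15, 21, 25, 28])],
    [(5, [1, 10, 22, 31, 26]), (5, [2, 1, 28, 23, 25]), (5, [2, 3, 28, 21, 25]), (3, [1, 2, 24,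
    28, 14]), (5, [1, 11, 28, 30, 26]), (5, [1, 10, 28, 31, 26]), (5, [3, 9, 21, 30, 25]), (5, [3,
    9, 21, 30, 25]), (5, [1, 2, 28, 23, 27]), (5, [1, 2, 28, 23, 26]), (3, [1, 2, 24, 28, 14]),
    (3, [1, 2, 24, 28, 14]), (3, [1, 2, 26, 28, 14]), (3, [1, 2, 26, 28, 14]), (3, [1, 6, 26, 24,
    14]), (3, [1, 6, 26, 24, 14]), (3, [1, 6, 26, 30, 14]), (3, [1, 6, 26, 30, 14]), (5, [1, 10,
    28, 31, 26]), (5, [1, 10, 28, 31, 27]), (5, [3, 9, 21, 30, 25]), (5, [3, 9, 21, 30, 26])],
    [(1, [12, 3, 1, 28, 23]), (1, [12, 1, 3, 28, 23]), (1, [12, 1, 2, 28, 23]), (1, [12, 1, 28, 3,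
    23]), (1, [12, 1, 28, 2, 23]), (1, [12, 1, 28, 31, 23]), (1, [12, 1, 2, 28, 23]), (1, [12, 1,
    28, 30, 23]), (1, [12, 1, 2, 28, 27]), (1, [12, 1, 2, 28, 23]), (1, [12, 1, 2, 28, 23]), (1,
    [12, 1, 2, 28, 27]), (1, [12, 1, 3, 28, 23]), (1, [12, 1, 3, 28, 27]), (1, [12, 1, 28, 2,
    23]), (1, [12, 1, 28, 2, 27]), (1, [12, 1, 28, 3, 23]), (1, [12, 1, 28, 3, 27]), (1, [12, 1,
    28, 30, 23]), (1, [12, 1, 28, 30, 27]), (1, [12, 1, 28, 31, 23]), (1, [12, 1, 28, 31, 27])],
    [(1, [12, 3, 1, 28, 23]), (0, [25, 2, 5, 31, 14]), (0, [25, 2, 5, 31, 14]), (0, [25, 2, 29, 7,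
    14]), (0, [25, 2, 29, 7, 14]), (0, [25, 2, 5, 31, 14]), (1, [12, 3, 1, 28, 23]), (5, [21, 3,
    28, 29, 15]), (5, [1, 3, 21, 26, 28]), (5, [1, 3, 21, 26, 28]), (1, [1, 13, 2, 23, 28]), (1,
    [1, 13, 2, 23, 28]), (1, [1, 13, 15, 26, 28]), (1, [1, 13, 15, 26, 28]), (1, [1, 13, 23, 2,
    28]), (1, [1, 13, 23, 2, 28]), (1, [1, 13, 26, 15, 28]), (1, [1, 13, 26, 15, 28]), (1, [12, 3,
    28, 29, 27]), (1, [12, 3, 28, 29, 23]), (1, [12, 3, 28, 29, 23]), (1, [12, 3, 28, 29, 27])],
    [(1, [12, 3, 1, 28, 23]), (1, [13, 1, 2, 28, 23]), (1, [13, 1, 3, 28, 23]), (1, [13, 1, 28, 2,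
    23]), (1, [13, 1, 28, 3, 23]), (1, [13, 1, 28, 30, 23]), (1, [13, 1, 2, 28, 23]), (1, [13, 1,
    28, 31, 23]), (1, [13, 1, 2, 28, 26]), (1, [13, 1, 2, 28, 23]), (1, [13, 1, 2, 28, 23]), (1,
    [13, 1, 2, 28, 26]), (1, [13, 1, 3, 28, 23]), (1, [13, 1, 3, 28, 26]), (1, [13, 1, 28, 2,
    23]), (1, [13, 1, 28, 2, 26]), (1, [13, 1, 28, 3, 23]), (1, [13, 1, 28, 3, 26]), (1, [13, 1,
    28, 30, 23]), (1, [13, 1, 28, 30, 26]), (1, [13, 1, 28, 31, 23]), (1, [13, 1, 28, 31, 26])],
    [(0, [25, 3, 4, 31, 14]), (1, [13, 1, 2, 28, 23]), (0, [25, 3, 4, 31, 14]), (1, [13, 12, 17,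
    15, 23]), (0, [25, 3, 4, 31, 14]), (1, [3, 1, 22, 26, 28]), (1, [13, 1, 2, 28, 23]), (1, [13,
    12, 17, 15, 23]), (1, [3, 1, 22, 26, 28]), (1, [3, 1, 22, 26, 28]), (1, [13, 1, 2, 28, 23]),
    (1, [13, 1, 2, 28, 26]), (1, [16, 12, 13, 23, 31]), (1, [16, 12, 13, 23, 15]), (1, [13, 12,
    17, 15, 26]), (1, [13, 12, 17, 15, 23]), (1, [16, 28, 7, 29, 31]), (1, [16, 28, 7, 29, 15]),
    (1, [3, 12, 22, 23, 28]), (1, [3, 12, 22, 23, 28]), (5, [9, 21, 20, 15, 23]), (5, [9, 21, 20,
    15, 30])],
    [(0, [25, 3, 5, 30, 14]), (0, [25, 26, 28, 7, 14]), (0, [25, 26, 4, 31, 14]), (0, [25, 26, 28,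
    7, 14]), (0, [25, 26, 4, 31, 14]), (0, [25, 2, 28, 31, 14]), (3, [24, 1, 2, 28, 14]), (5, [21,
    3, 9, 30, 15]), (3, [24, 1, 2, 28, 14]), (3, [24, 1, 2, 28, 14]), (3, [24, 2, 1, 28, 14]), (3,
    [24, 2, 1, 28, 14]), (3, [24, 2, 3, 28, 14]), (3, [24, 2, 3, 28, 14]), (3, [24, 2, 4, 25,
    14]), (3, [24, 2, 4, 25, 14]), (3, [24, 2, 4, 27, 14]), (3, [24, 2, 4, 27, 14]), (3, [24, 2,
    4, 29, 14]), (3, [24, 2, 4, 29, 14]), (3, [24, 2, 4, 31, 14]), (3, [24, 2, 4, 31, 14])],
    [(0, [25, 3, 5, 30, 14]), (0, [25, 3, 5, 30, 14]), (0, [25, 3, 4, 31, 14]), (0, [25, 3, 5, 30,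
    14]), (0, [25, 3, 4, 31, 14]), (1, [13, 1, 17, 30, 23]), (5, [20, 1, 2, 28, 15]), (1, [13, 1,
    17, 30, 23]), (1, [13, 1, 17, 30, 26]), (1, [13, 1, 17, 30, 23]), (5, [20, 1, 2, 28, 27]), (5,
    [20, 1, 2, 28, 15]), (5, [20, 1, 3, 28, 27]), (5, [20, 1, 3, 28, 15]), (5, [20, 1, 8, 22,
    15]), (5, [20, 1, 8, 22, 27]), (5, [20, 1, 8, 23, 15]), (5, [20, 1, 8, 23, 27]), (1, [13, 1,
    17, 30, 26]), (1, [13, 1, 17, 30, 23]), (3, [2, 24, 12, 23, 28]), (3, [2, 24, 12, 23, 28])],
    [(1, [12, 3, 1, 28, 23]), (1, [13, 1, 2, 28, 23]), (1, [14, 2, 1, 28, 21]), (1, [14, 2, 3, 28,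
    21]), (1, [13, 1, 28, 2, 23]), (1, [13, 1, 28, 3, 23]), (1, [13, 1, 28, 30, 23]), (1, [13, 1,
    28, 31, 23]), (1, [14, 2, 1, 28, 21]), (1, [14, 2, 1, 28, 27]), (1, [15, 3, 1, 28, 26]), (1,
    [15, 3, 1, 28, 21]), (1, [15, 3, 1, 28, 21]), (1, [15, 3, 1, 28, 26]), (1, [13, 1, 28, 2,
    23]), (1, [13, 1, 28, 2, 26]), (1, [13, 1, 28, 3, 23]), (1, [13, 1, 28, 3, 26]), (1, [13, 1,
    28, 30, 23]), (1, [13, 1, 28, 30, 26]), (1, [13, 1, 28, 31, 23]), (1, [13, 1, 28, 31, 26])],
    [(5, [21, 3, 2, 28, 15]), (1, [13, 1, 2, 28, 23]), (1, [14, 2, 1, 28, 21]), (5, [20, 1, 3, 28,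
    15]), (1, [24, 4, 5, 26, 15]), (1, [24, 4, 5, 30, 15]), (1, [24, 4, 5, 30, 15]), (1, [24, 4,
    5, 26, 15]), (1, [13, 1, 2, 28, 26]), (1, [13, 1, 2, 28, 23]), (1, [13, 1, 2, 28, 23]), (1,
    [13, 1, 2, 28, 26]), (5, [16, 5, 7, 25, 31]), (5, [16, 5, 7, 25, 15]), (1, [24, 4, 5, 26,
    15]), (1, [24, 4, 5, 26, 23]), (1, [24, 4, 5, 30, 15]), (1, [24, 4, 5, 30, 23]), (1, [24, 4,
    5, 30, 23]), (1, [24, 4, 5, 30, 15]), (1, [24, 4, 5, 26, 23]), (1, [24, 4, 5, 26, 15])],
    [(3, [24, 1, 2, 28, 14]), (5, [20, 1, 2, 28, 15]), (5, [20, 1, 2, 28, 15]), (5, [20, 1, 3, 28,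
    15]), (5, [20, 1, 8, 22, 15]), (5, [20, 1, 8, 23, 15]), (5, [20, 1, 8, 30, 15]), (5, [20, 1,
    8, 31, 15]), (3, [25, 1, 3, 28, 14]), (3, [25, 1, 3, 28, 14]), (3, [25, 3, 1, 28, 14]), (3,
    [25, 3, 1, 28, 14]), (3, [25, 3, 2, 28, 14]), (3, [25, 3, 2, 28, 14]), (3, [24, 2, 4, 25,
    14]), (3, [24, 2, 4, 25, 14]), (3, [24, 2, 4, 27, 14]), (3, [24, 2, 4, 27, 14]), (3, [24, 2,
    4, 29, 14]), (3, [24, 2, 4, 29, 14]), (3, [24, 2, 4, 31, 14]), (3, [24, 2, 4, 31, 14])],
    [(5, [1, 3, 22, 26, 28]), (5, [3, 1, 22, 26, 28]), (5, [3, 2, 21, 25, 28]), (5, [1, 2, 28, 23,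
    27]), (5, [3, 2, 21, 28, 25]), (5, [12, 9, 21, 23, 22]), (5, [3, 2, 21, 25, 28]), (5, [2, 3,
    21, 25, 28]), (5, [2, 1, 23, 27, 28]), (5, [3, 2, 21, 25, 28]), (5, [12, 9, 21, 22, 23]), (5,
    [3, 2, 21, 28, 25]), (5, [2, 3, 21, 28, 25]), (5, [2, 1, 23, 28, 27]), (5, [12, 9, 21, 22,
    23]), (5, [12, 11, 23, 21, 22]), (5, [11, 12, 23, 21, 22]), (5, [11, 7, 28, 29, 30]), (5, [9,
    5, 28, 30, 31]), (5, [9, 12, 21, 22, 23]), (5, [12, 9, 21, 22, 23]), (6, [6, 5, 19, 24, 31])],
    [(1, [1, 3, 12, 27, 28]), (1, [3, 1, 26, 15, 28]), (1, [2, 14, 1, 28, 21]), (5, [2, 3, 22, 25,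
    28]), (1, [13, 1, 28, 2, 26]), (5, [3, 2, 21, 26, 28]), (1, [2, 14, 1, 28, 21]), (1, [13, 1,
    28, 2, 26]), (1, [2, 3, 12, 23, 28]), (1, [2, 3, 12, 23, 28]), (1, [5, 9, 28, 31, 30]), (5,
    [3, 22, 1, 28, 25]), (1, [2, 14, 1, 28, 21]), (1, [13, 17, 12, 23, 15]), (1, [5, 9, 28, 31,
    30]), (1, [5, 9, 21, 26, 30]), (5, [22, 3, 28, 1, 25]), (1, [5, 25, 12, 27, 26]), (1, [5, 9,
    28, 31, 30]), (5, [4, 11, 28, 29, 30]), (5, [6, 9, 28, 29, 31]), (1, [5, 9, 21, 26, 30])],
    [(1, [1, 12, 16, 31, 27]), (3, [1, 24, 2, 28, 14]), (5, [2, 1, 22, 25, 28]), (5, [2, 1, 20,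
    27, 28]), (5, [2, 1, 20, 27, 28]), (5, [2, 1, 22, 25, 28]), (3, [1, 24, 2, 28, 14]), (1, [1,
    12, 16, 31, 27]), (1, [1, 12, 16, 31, 27]), (3, [1, 24, 2, 28, 14]), (5, [1, 21, 3, 28, 26]),
    (5, [1, 21, 2, 28, 26]), (5, [7, 21, 14, 25, 26]), (5, [7, 21, 9, 30, 26]), (5, [5, 21, 12,
    27, 26]), (5, [5, 21, 9, 30, 26]), (5, [7, 21, 14, 25, 26]), (5, [7, 21, 9, 30, 26]), (3, [6,
    14, 20, 27, 24]), (1, [1, 12, 16, 31, 27]), (3, [6, 14, 20, 27, 24]), (3, [6, 14, 20, 27,
    24])],
    [(5, [1, 16, 6, 26, 31]), (3, [1, 24, 2, 28, 14]), (3, [1, 25, 3, 28, 14]), (3, [1, 2, 24, 14,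
    28]), (3, [1, 3, 25, 14, 28]), (3, [1, 2, 12, 26, 28]), (3, [1, 3, 13, 26, 28]), (3, [1, 2,
    12, 22, 28]), (3, [1, 2, 12, 22, 28]), (3, [1, 2, 12, 22, 28]), (3, [1, 8, 6, 26, 30]), (3,
    [1, 8, 6, 26, 30]), (3, [1, 8, 6, 26, 22]), (3, [1, 8, 6, 26, 22]), (3, [1, 8, 18, 14, 22]),
    (3, [1, 8, 18, 14, 22]), (3, [1, 8, 18, 14, 30]), (3, [1, 8, 18, 14, 30]), (3, [1, 8, 18, 28,
    22]), (3, [1, 8, 18, 28, 22]), (3, [1, 8, 18, 28, 30]), (3, [1, 8, 18, 28, 30])]]"

section \<open>Evaluation of the certificates\<close>

lemma extension_step_0: "extension_step reps\<^sub>0 reps\<^sub>1 maps\<^sub>0"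
  by code_simp

lemma extension_step_1: "extension_step reps\<^sub>1 reps\<^sub>2 maps\<^sub>1"
  by code_simp

lemma extension_step_2: "extension_step reps\<^sub>2 reps\<^sub>3 maps\<^sub>2"
  by code_simp

lemma extension_step_3: "extension_step reps\<^sub>3 reps\<^sub>4 maps\<^sub>3"
  by code_simp

lemma extension_step_4: "extension_step reps\<^sub>4 reps\<^sub>5 maps\<^sub>4"
  by code_simp

lemma extension_step_5: "extension_step reps\<^sub>5 reps\<^sub>6 maps\<^sub>5"
  by code_simp

lemma extension_step_6: "extension_step reps\<^sub>6 reps\<^sub>7 maps\<^sub>6"
  by code_simp

lemma extension_step_7: "extension_step reps\<^sub>7 reps\<^sub>8 maps\<^sub>7"
  by code_simp

lemma extension_step_8: "extension_step reps\<^sub>8 reps\<^sub>9 maps\<^sub>8"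
  by code_simp

lemma extension_step_9: "extension_step reps\<^sub>9 reps\<^sub>1\<^sub>0 maps\<^sub>9"
  by code_simp

section \<open>Packings avoiding the representatives\<close>

definition blocks\<^sub>0 :: "int list list list" where
  "blocks\<^sub>0 =
    [[[1, 2, 3], [4, 8, 12], [5, 10, 15], [6, 16, 22], [7, 18, 21], [9, 17, 24], [11, 20, 31], [13,
    19, 30], [14, 23, 25], [26, 27, 28, 29]]]"

lemma disjoint_blocks_0:
  "list_all2 disjoint_blocks reps\<^sub>0 blocks\<^sub>0" "list_all (\<lambda>bs. length bs = 10) blocks\<^sub>0"
  by code_simp+

text \<open>Without a line, the other 28 vectors split completely into eight lines and a quadruple.
  Without three independent vectors 1, 2, 4 there are nine lines, and the vector left over is 7, the
  sum of the three.\<close>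

definition blocks\<^sub>3 :: "int list list list" where
  "blocks\<^sub>3 =
    [[[4, 8, 12], [5, 10, 15], [6, 16, 22], [7, 18, 21], [9, 17, 24], [11, 20, 31], [13, 19, 30],
    [14, 23, 25], [26, 27, 28, 29]],
    [[3, 5, 6], [8, 16, 24], [9, 18, 27], [10, 20, 30], [11, 22, 29], [12, 19, 31], [13, 17, 28],
    [14, 23, 25], [15, 21, 26]]]"

lemma disjoint_blocks_3:
  "list_all2 disjoint_blocks reps\<^sub>3 blocks\<^sub>3" "list_all (\<lambda>bs. length bs = 9) blocks\<^sub>3"
  by code_simp+

definition blocks\<^sub>8 :: "int list list list" where
  "blocks\<^sub>8 =
    [[[9, 16, 25], [10, 17, 27], [11, 20, 31], [12, 18, 30], [13, 23, 26], [14, 22, 24], [15, 19,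
    28]],
    [[7, 16, 23], [10, 17, 27], [11, 20, 31], [12, 18, 30], [13, 21, 24], [14, 19, 29], [15, 22,
    25]],
    [[1, 10, 11], [12, 16, 28], [13, 18, 31], [14, 19, 29], [15, 17, 30], [20, 21, 22, 23], [24,
    25, 26, 27]],
    [[3, 16, 19], [7, 17, 22], [11, 18, 25], [12, 20, 24], [13, 23, 26], [14, 21, 27], [28, 29,
    30, 31]],
    [[2, 16, 18], [3, 24, 27], [11, 20, 31], [12, 17, 29], [13, 19, 30], [14, 23, 25], [15, 21,
    26]],
    [[1, 2, 3], [12, 16, 28], [13, 18, 31], [14, 19, 29], [15, 17, 30], [20, 21, 22, 23], [24, 25,
    26, 27]],
    [[7, 9, 14], [10, 17, 27], [11, 18, 25], [12, 20, 24], [13, 19, 30], [15, 21, 26], [22, 23,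
    28, 29]],
    [[6, 17, 23], [7, 24, 31], [10, 19, 25], [11, 21, 30], [12, 22, 26], [14, 18, 28], [15, 20,
    27]],
    [[5, 10, 15], [7, 17, 22], [11, 18, 25], [12, 20, 24], [13, 23, 26], [14, 21, 27], [28, 29,
    30, 31]],
    [[1, 10, 11], [7, 17, 22], [12, 18, 30], [13, 20, 25], [14, 19, 29], [15, 21, 26], [24, 27,
    28, 31]],
    [[1, 2, 3], [11, 17, 26], [12, 18, 30], [13, 20, 25], [14, 19, 29], [15, 23, 24], [21, 22, 28,
    31]],
    [[1, 6, 7], [10, 18, 24], [11, 20, 31], [12, 21, 25], [13, 19, 30], [14, 15, 22, 23], [26, 27,
    28, 29]],
    [[3, 12, 15], [5, 18, 23], [7, 24, 31], [10, 19, 25], [11, 21, 30], [13, 22, 27], [14, 20,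
    26]],
    [[2, 5, 7], [10, 18, 24], [11, 20, 31], [12, 21, 25], [13, 19, 30], [14, 15, 22, 23], [26, 27,
    28, 29]],
    [[1, 10, 11], [5, 18, 23], [7, 24, 31], [12, 21, 25], [13, 22, 27], [14, 20, 26], [15, 19,
    28]],
    [[3, 4, 7], [9, 18, 27], [11, 20, 31], [12, 21, 25], [13, 23, 26], [14, 22, 24], [15, 19, 28]],
    [[2, 9, 11], [3, 20, 23], [7, 24, 31], [12, 18, 30], [13, 22, 27], [14, 19, 29], [15, 21, 26]],
    [[1, 12, 13], [2, 20, 22], [7, 24, 31], [9, 18, 27], [11, 21, 30], [14, 23, 25], [15, 19, 28]],
    [[1, 2, 3], [9, 18, 27], [11, 20, 31], [12, 21, 25], [13, 23, 26], [14, 22, 24], [15, 19, 28]],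
    [[1, 14, 15], [2, 20, 22], [5, 24, 29], [7, 25, 30], [9, 19, 26], [11, 23, 28], [13, 18, 31]],
    [[1, 14, 15], [2, 20, 22], [4, 24, 28], [6, 25, 31], [9, 18, 27], [11, 21, 30], [13, 23, 26]]]"

lemma disjoint_blocks_8:
  "list_all2 disjoint_blocks reps\<^sub>8 blocks\<^sub>8" "list_all (\<lambda>bs. length bs = 7) blocks\<^sub>8"
  by code_simp+

text \<open>Six blocks use at least 18 of the 31 nonzero vectors, so the set to be avoided can be
  padded to as many as 13 points. The sets of 13 points in \<open>reps\<^sub>1\<^sub>0\<close> are
  those whose complements are partitioned into six lines here.\<close>

definition blocks\<^sub>1\<^sub>0 :: "int list list list" where
  "blocks\<^sub>1\<^sub>0 =
    [[[1, 8, 9], [2, 13, 15], [4, 16, 20], [6, 10, 12], [11, 19, 24], [17, 18, 21, 22]],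
    [[4, 9, 13], [5, 11, 14], [6, 16, 22], [7, 19, 20], [8, 17, 25], [10, 18, 24]],
    [[3, 8, 11], [4, 9, 13], [6, 10, 12], [14, 22, 24], [15, 16, 17, 23, 25], [18, 19, 20, 21]],
    [[1, 2, 3], [4, 8, 12], [5, 16, 21], [6, 11, 13], [7, 19, 20], [9, 10, 17, 18]],
    [[2, 8, 10], [3, 12, 15], [4, 9, 13], [5, 11, 14], [16, 17, 18, 19], [20, 21, 22, 23]],
    [[3, 16, 19], [4, 8, 12], [5, 11, 14], [6, 18, 20], [7, 10, 13], [9, 17, 24]],
    [[1, 8, 9], [2, 12, 14], [3, 17, 18], [4, 16, 20], [5, 10, 15], [6, 11, 13]]]"

lemma disjoint_blocks_10:
  "list_all2 disjoint_blocks reps\<^sub>1\<^sub>0 blocks\<^sub>1\<^sub>0" "list_all (\<lambda>bs. length bs = 6) blocks\<^sub>1\<^sub>0"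
  by code_simp+

lemma covers_reps:
  fixes f :: "int \<Rightarrow> 'a::{ab_group_add,finite}"
  assumes "frame f"
  shows "covers TYPE('a) 0 reps\<^sub>0" "covers TYPE('a) 3 reps\<^sub>3" "covers TYPE('a) 8 reps\<^sub>8"
    "covers TYPE('a) 10 reps\<^sub>1\<^sub>0"
proof -
  show 0: "covers TYPE('a) 0 reps\<^sub>0"
    using covers_0[OF assms] by (simp add: reps\<^sub>0_def)
  note c1 = covers_Suc[OF 0 extension_step_0]
  note c2 = covers_Suc[OF c1 extension_step_1]
  note c3 = covers_Suc[OF c2 extension_step_2]
  note c4 = covers_Suc[OF c3 extension_step_3]
  note c5 = covers_Suc[OF c4 extension_step_4]
  note c6 = covers_Suc[OF c5 extension_step_5]
  note c7 = covers_Suc[OF c6 extension_step_6]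
  note c8 = covers_Suc[OF c7 extension_step_7]
  note c9 = covers_Suc[OF c8 extension_step_8]
  note c10 = covers_Suc[OF c9 extension_step_9]
  show "covers TYPE('a) 3 reps\<^sub>3" "covers TYPE('a) 8 reps\<^sub>8" "covers TYPE('a) 10 reps\<^sub>1\<^sub>0"
    using c3 c8 c10 by (simp_all add: eval_nat_numeral)
qed

text \<open>The thresholds are 31 minus the sizes 10, 8, 3 and 0 of the enumerated
  complements.\<close>

lemma packs_large:
  fixes f :: "int \<Rightarrow> 'a::{ab_group_add,finite}" and A :: "'a set"
  assumes f: "frame f" and "0 \<notin> A"
  shows "card A \<ge> 21 \<Longrightarrow> packs 6 A" "card A \<ge> 23 \<Longrightarrow> packs 7 A"
    "card A \<ge> 28 \<Longrightarrow> packs 9 A" "card A \<ge> 31 \<Longrightarrow> packs 10 A"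
  using covers_packs[OF covers_reps(4)[OF f] disjoint_blocks_10 assms(2) _ _ frame_card[OF f]]
    covers_packs[OF covers_reps(3)[OF f] disjoint_blocks_8 assms(2) _ _ frame_card[OF f]]
    covers_packs[OF covers_reps(2)[OF f] disjoint_blocks_3 assms(2) _ _ frame_card[OF f]]
    covers_packs[OF covers_reps(1)[OF f] disjoint_blocks_0 assms(2) _ _ frame_card[OF f]]
  by simp_all

section \<open>Lower bounds\<close>

text \<open>Whatever \<open>k\<close> blocks of weight at least \<open>c\<close> leave over has weight at most 1, so it is empty or
  a single term, and it has the same sum as the whole sequence.\<close>

lemma not_has_k_disjoint_zs_weight:
  fixes S :: "'a::ab_group_add multiset" and w :: "'a \<Rightarrow> nat"
  assumes heavy: "\<And>X. X \<subseteq># S \<Longrightarrow> X \<noteq> {#} \<Longrightarrow> sum_mset X = 0 \<Longrightarrow> c \<le> (\<Sum>x\<in>#X. w x)"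
    and pos: "\<And>x. x \<in># S \<Longrightarrow> 1 \<le> w x"
    and total: "(\<Sum>x\<in>#S. w x) \<le> k * c + 1"
    and sum: "sum_mset S \<noteq> 0" "sum_mset S \<notin># S"
  shows "\<not> has_k_disjoint_zs k S"
proof
  assume "has_k_disjoint_zs k S"
  then obtain T where T: "\<And>i. i < k \<Longrightarrow> T i \<noteq> {#} \<and> sum_mset (T i) = 0" "(\<Sum>i<k. T i) \<subseteq># S"
    unfolding has_k_disjoint_zs_def by blast
  define U where "U = S - (\<Sum>i<k. T i)"
  have S: "S = (\<Sum>i<k. T i) + U" using T(2) by (simp add: U_def)
  have weight_sum: "(\<Sum>x\<in>#(\<Sum>i<n. T i). w x) = (\<Sum>i<n. \<Sum>x\<in>#T i. w x)" for n
    by (induction n) auto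
  have "sum_mset (\<Sum>i<n. T i) = (\<Sum>i<n. sum_mset (T i))" for n
    by (induction n) auto
  then have "sum_mset (\<Sum>i<k. T i) = 0" using T(1) by simp
  then have sumU: "sum_mset S = sum_mset U" using S by (metis add_0 sum_mset.union)
  have "c \<le> (\<Sum>x\<in>#T i. w x)" if "i < k" for i
  proof (rule heavy)
    have "T i \<subseteq># (\<Sum>i<k. T i)" using that by (simp add: sum.remove)
    then show "T i \<subseteq># S" using T(2) by (rule subset_mset.order_trans)
  qed (use T(1) that in auto)
  then have "k * c \<le> (\<Sum>x\<in>#(\<Sum>i<k. T i). w x)"
    unfolding weight_sum using sum_mono[of "{..<k}" "\<lambda>_. c"] by simp
  then have "(\<Sum>x\<in>#U. w x) \<le> 1" using total by (subst (asm) S) simp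
  moreover have "size U \<le> (\<Sum>x\<in>#U. w x)"
    unfolding size_eq_sum_mset
    by (rule sum_mset_mono) (use pos S in auto)
  ultimately consider "size U = 0" | "size U = 1" by linarith
  then show False
  proof cases
    case 1
    then show ?thesis using sumU sum(1) by simp
  next
    case 2
    then obtain u where "U = {#u#}" by (metis size_1_singleton_mset)
    then show ?thesis using sumU sum(2) S by auto
  qed
qed

lemma submset_mset_set:
  fixes A :: "'a::finite set"
  assumes "X \<subseteq># mset_set A"
  shows "mset_set (set_mset X) = X" "set_mset X \<subseteq> A"
proof -
  show sub: "set_mset X \<subseteq> A" using set_mset_mono[OF assms] by simp
  have "count X x = 1" if "x \<in># X" for x
    using mset_subset_eq_count[OF assms, of x] that sub
    by (metis count_greater_eq_one_iff count_mset_set(1) finite le_antisym subsetD)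
  then show "mset_set (set_mset X) = X"
    by (intro multiset_eqI) (metis count_mset_set(1,3) finite_set_mset not_in_iff)
qed

lemma not_packs_weight:
  fixes A :: "'a::{ab_group_add,finite} set" and w :: "'a \<Rightarrow> nat"
  assumes heavy: "\<And>X. X \<subseteq> A \<Longrightarrow> X \<noteq> {} \<Longrightarrow> \<Sum>X = 0 \<Longrightarrow> c \<le> sum w X"
    and pos: "\<And>x. x \<in> A \<Longrightarrow> 1 \<le> w x"
    and total: "sum w A \<le> k * c + 1" and sum: "\<Sum>A \<noteq> 0" "\<Sum>A \<notin> A"
  shows "\<not> packs k A"
proof (rule not_has_k_disjoint_zs_weight)
  fix X assume X: "X \<subseteq># mset_set A" "X \<noteq> {#}" "sum_mset X = 0"
  have "\<Sum>(set_mset X) = 0"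
    using X(3) submset_mset_set(1)[OF X(1)] by (simp add: sum_unfold_sum_mset)
  then show "c \<le> (\<Sum>x\<in>#X. w x)"
    using heavy[of "set_mset X"] X(2) submset_mset_set[OF X(1)] by (simp add: sum_unfold_sum_mset)
qed (use pos total sum in \<open>simp_all add: sum_unfold_sum_mset\<close>)

lemma sum_frame_list:
  assumes "frame f" "distinct xs" "set xs \<subseteq> {1..<32}"
    "foldr (XOR) xs 0 \<notin> insert 0 (set xs)"
  shows "\<Sum>(f ` set xs) \<noteq> 0" "\<Sum>(f ` set xs) \<notin> f ` set xs" "0 \<notin> f ` set xs"
    "inj_on f (set xs)"
proof -
  have ran: "set xs \<subseteq> {0..<32}" using assms(3) by auto
  note sum = frame_sum[OF assms(1) ran assms(2)]
  note mem = inj_on_image_mem_iff[OF frame_inj[OF assms(1)]]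
  show "\<Sum>(f ` set xs) \<notin> f ` set xs"
    using sum mem[of "foldr (XOR) xs 0" "set xs"] ran assms(4) by auto
  show "\<Sum>(f ` set xs) \<noteq> 0"
    using sum mem[of "foldr (XOR) xs 0" "{0}"] frame_0[OF assms(1)] assms(4) by auto
  show "0 \<notin> f ` set xs"
    using mem[of 0 "set xs"] frame_0[OF assms(1)] ran assms(3) by auto
  show "inj_on f (set xs)"
    using inj_on_subset[OF frame_inj[OF assms(1)] ran] .
qed

lemma frame_elementary:
  fixes f :: "int \<Rightarrow> 'a::{ab_group_add,finite}"
  assumes "frame f"
  shows "elementary_two_group_32 TYPE('a)"
  by unfold_locales (use frame_double_zero[OF assms] frame_card[OF assms] in auto)

text \<open>Constant weight 1 works because every block has at least three elements.\<close>

lemma not_packs_lines: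
  fixes f :: "int \<Rightarrow> 'a::{ab_group_add,finite}"
  assumes f: "frame f" and xs: "distinct xs" "set xs \<subseteq> {1..<32}"
    "foldr (XOR) xs 0 \<notin> insert 0 (set xs)" and len: "length xs \<le> 3 * k + 1"
  shows "\<not> packs k (f ` set xs)"
proof -
  interpret elementary_two_group_32 "TYPE('a)" using frame_elementary[OF f] .
  note sum = sum_frame_list[OF f xs]
  show ?thesis
  proof (rule not_packs_weight[where w = "\<lambda>_. 1" and c = 3])
    fix X assume "X \<subseteq> f ` set xs" "X \<noteq> {}" "\<Sum>X = 0"
    then show "3 \<le> (\<Sum>x\<in>X. 1::nat)" using zero_sum_card_ge_3[of X] sum(3) by auto
  next
    show "(\<Sum>x\<in>f ` set xs. 1::nat) \<le> k * 3 + 1"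
      using len xs(1) sum(4) by (simp add: card_image distinct_card)
  qed (use sum in auto)
qed

text \<open>\<open>\<eta>\<close> is a homomorphism to the group of order two written as a
  predicate, with exclusive or as addition; summing its values over \<open>X\<close> counts modulo
  2.\<close>

lemma (in elementary_two_group) even_card_character:
  fixes \<eta> :: "'a \<Rightarrow> bool"
  assumes add: "\<And>x y. \<eta> (x + y) \<longleftrightarrow> \<eta> x \<noteq> \<eta> y"
  shows "\<eta> (\<Sum>X) \<longleftrightarrow> odd (card {x\<in>X. \<eta> x})"
proof (induction X rule: finite_induct[OF finite])
  case 1
  have "\<not> \<eta> 0" using add[of 0 0] by simp
  then show ?case by simp
next
  case (2 x F)
  have "{y \<in> insert x F. \<eta> y} = (if \<eta> x then insert x {y\<in>F. \<eta> y} else {y\<in>F. \<eta> y})" by auto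
  then show ?case using 2 add by auto
qed

text \<open>Points off the affine hyperplane \<open>{16, \<dots>, 31}\<close> count twice. A zero-sum set meets that hyperplane
  in an even number of points, so its weight is at least 4.\<close>

lemma not_packs_hyperplane:
  fixes f :: "int \<Rightarrow> 'a::{ab_group_add,finite}"
  assumes f: "frame f" and xs: "distinct xs" "set xs \<subseteq> {1..<32}"
    "foldr (XOR) xs 0 \<notin> insert 0 (set xs)"
    and weight: "(\<Sum>x\<leftarrow>xs. if 16 \<le> x then 1 else 2) \<le> 4 * k + 1"
  shows "\<not> packs k (f ` set xs)"
proof -
  interpret elementary_two_group_32 "TYPE('a)" using frame_elementary[OF f] .
  note sum = sum_frame_list[OF f xs]
  define \<eta> where "\<eta> y \<longleftrightarrow> y \<in> f ` {16..<32}" for y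
  \<comment> \<open>A code below 32 lies in the affine hyperplane exactly when its top bit is set,
    and top bits add under exclusive or.\<close>
  have chi: "\<eta> (f x) \<longleftrightarrow> bit x 4" "16 \<le> x \<longleftrightarrow> bit x 4" if "x \<in> {0..<32}" for x
  proof -
    have "x div 16 = (if 16 \<le> x then 1 else 0)" using that by auto
    then show "16 \<le> x \<longleftrightarrow> bit x 4" by (simp add: bit_iff_odd)
    moreover have "\<eta> (f x) \<longleftrightarrow> x \<in> {16..<32}"
      unfolding \<eta>_def using inj_on_image_mem_iff[OF frame_inj[OF f], of x "{16..<32}"] that by auto
    ultimately show "\<eta> (f x) \<longleftrightarrow> bit x 4" using that by auto
  qed
  have add: "\<eta> (x + y) \<longleftrightarrow> \<eta> x \<noteq> \<eta> y" for x y
  proof -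
    obtain a b where ab: "a \<in> {0..<32}" "b \<in> {0..<32}" "x = f a" "y = f b"
      using frame_surj[OF f] by metis
    then show ?thesis
      using frame_xor[OF f ab(1,2)] chi(1)[OF ab(1)] chi(1)[OF ab(2)] chi(1)[OF xor_range[OF ab(1,2)]]
      by (metis bit_xor_iff)
  qed
  let ?w = "\<lambda>y. if \<eta> y then 1 else (2::nat)"
  show ?thesis
  proof (rule not_packs_weight[where w = ?w and c = 4])
    fix X assume X: "X \<subseteq> f ` set xs" "X \<noteq> {}" "\<Sum>X = 0"
    have "\<not> \<eta> (\<Sum>X)" using X(3) add[of 0 0] by simp
    then have ev: "even (card {x\<in>X. \<eta> x})" using even_card_character[OF add, of X] by simp
    have "card X = card {x\<in>X. \<eta> x} + card {x\<in>X. \<not> \<eta> x}"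
      by (subst card_Un_disjoint[symmetric]) (auto intro: arg_cong[of _ _ card])
    moreover have "sum ?w X = card {x\<in>X. \<eta> x} + 2 * card {x\<in>X. \<not> \<eta> x}"
      by (simp add: sum.If_cases Int_def)
    moreover have "3 \<le> card X" using zero_sum_card_ge_3[of X] X sum(3) by auto
    \<comment> \<open>With \<open>h\<close> points on the hyperplane and \<open>m\<close> off it,
      the weight is \<open>h + 2 * m\<close> where \<open>h\<close> is even and
      \<open>h + m \<ge> 3\<close>. It is at least 6 for \<open>h = 0\<close>, and at least 4 for
      \<open>h = 2\<close> because then \<open>m \<ge> 1\<close>, and for
      \<open>h \<ge> 4\<close>.\<close>
    ultimately show "4 \<le> sum ?w X" using ev by presburger
  next
    have "sum ?w (f ` set xs) = (\<Sum>x\<in>set xs. ?w (f x))"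
      using sum(4) by (simp add: sum.reindex)
    also have "\<dots> = (\<Sum>x\<in>set xs. if 16 \<le> x then 1 else 2)"
      using chi xs(2) by (intro sum.cong) (auto simp: subset_iff)
    also have "\<dots> = (\<Sum>x\<leftarrow>xs. if 16 \<le> x then 1 else 2)"
      using xs(1) by (simp add: sum_list_distinct_conv_sum_set)
    finally show "sum ?w (f ` set xs) \<le> k * 4 + 1" using weight by simp
  qed (use sum in auto)
qed

text \<open>All elements but 0 and one more, together with \<open>j\<close> pairs of equal terms \<open>g\<close>. Giving \<open>g\<close> weight
  3 and the other elements weight 2, every zero-sum subsequence has weight at least 6.\<close>

lemma not_has_k_disjoint_zs_pairs:
  fixes f :: "int \<Rightarrow> 'a::{ab_group_add,finite}"
  assumes f: "frame f"
  shows "\<not> has_k_disjoint_zs (10 + j) (mset_set (f ` {1..<31}) + replicate_mset (2 * j) (f 1))"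
proof -
  interpret elementary_two_group_32 "TYPE('a)" using frame_elementary[OF f] .
  let ?A = "f ` {1..<31}" and ?g = "f 1"
  let ?S = "mset_set ?A + replicate_mset (2 * j) ?g"
  let ?w = "\<lambda>y. if y = ?g then 3 else (2::nat)"
  have "{1..<31::int} = set [1..30]" by auto
  also have "[1..30] = [1, 2, 3, 4, 5, 6, 7, 8, 9, 10, 11, 12, 13, 14, 15, 16, 17, 18, 19, 20, 21,
      22, 23, 24, 25, 26, 27, 28, 29, 30::int]" (is "_ = ?xs")
    by (simp add: upto.simps)
  finally have A: "{1..<31::int} = set ?xs" .
  \<comment> \<open>All vectors together sum to 0, so the sum of the 30 chosen ones is the omitted
    vector 31.\<close>
  have xor: "foldr (XOR) ?xs 0 = (31::int)" by code_simp
  have "distinct ?xs" by simp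
  then have "\<Sum>?A = f 31"
    using frame_sum[OF f, of ?xs] unfolding xor A[symmetric] by auto
  note inj = inj_on_image_mem_iff[OF frame_inj[OF f]]
  have mem: "0 \<notin> ?A" "f 31 \<notin> ?A" "f 31 \<noteq> 0" "?g \<in> ?A"
    using inj[of 0 "{1..<31}"] inj[of 31 "{1..<31}"] inj[of 31 "{0}"] frame_0[OF f] by auto
  have set_S: "set_mset ?S = ?A" using mem(4) by auto
  have "sum_mset (replicate_mset (2 * j) ?g) = 0"
    by (induction j) (simp_all add: double_zero)
  moreover have "sum_mset (mset_set ?A) = \<Sum>?A" using sum_unfold_sum_mset[of "\<lambda>x. x" ?A] by simp
  ultimately have sum_S: "sum_mset ?S = f 31" using \<open>\<Sum>?A = f 31\<close> by simp
  show ?thesis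
  proof (rule not_has_k_disjoint_zs_weight[where w = ?w and c = 6])
    fix X assume X: "X \<subseteq># ?S" "X \<noteq> {#}" "sum_mset X = 0"
    have ge: "2 * size X \<le> (\<Sum>x\<in>#X. ?w x)"
      by (induction X) auto
    have X0: "x \<noteq> 0" if "x \<in># X" for x
      using that set_mset_mono[OF X(1)] set_S mem(1) by auto
    \<comment> \<open>A single term would be 0. Two terms with sum 0 are equal, and only
      \<open>?g\<close> is repeated: this is why \<open>?g\<close> weighs 3. Three or more terms
      weigh at least 6 in any case.\<close>
    consider "size X = 1" | "size X = 2" | "size X \<ge> 3" using X(2) by (cases "size X" rule: nat.exhaust) force+
    then show "6 \<le> (\<Sum>x\<in>#X. ?w x)"
    proof cases
      case 1
      then obtain x where "X = {#x#}" by (metis size_1_singleton_mset)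
      then show ?thesis using X(3) X0[of x] by simp
    next
      case 2
      obtain x where x: "x \<in># X" using X(2) by blast
      with 2 have "size (X - {#x#}) = 1" by (simp add: size_Diff_singleton)
      then obtain y where "X - {#x#} = {#y#}" by (metis size_1_singleton_mset)
      with x have "X = {#x, y#}" by (metis insert_DiffM)
      with X(3) have Xx: "X = {#x, x#}" by (simp add: add_eq_0)
      then have "2 \<le> count ?S x" using mset_subset_eq_count[OF X(1), of x] by simp
      then have "x = ?g" by (auto split: if_splits simp: count_mset_set')
      then show ?thesis using Xx by simp
    qed (use ge in linarith)
  next
    \<comment> \<open>The total is \<open>3 + 2 * 29 + 6 * j\<close>, which equals
      \<open>(10 + j) * 6 + 1\<close>, the largest weight allowed.\<close>
    have "(\<Sum>x\<in>#mset_set ?A. ?w x) = sum ?w ?A" by (simp add: sum_unfold_sum_mset)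
    also have "\<dots> = 3 + sum ?w (?A - {?g})" using mem(4) by (subst sum.remove[of _ ?g]) auto
    also have "sum ?w (?A - {?g}) = (\<Sum>x\<in>?A - {?g}. 2)" by (rule sum.cong) auto
    also have "\<dots> = 2 * 29"
      using mem(4) inj_on_subset[OF frame_inj[OF f], of "{1..<31}"] by (simp add: card_image)
    finally show "(\<Sum>x\<in>#?S. ?w x) \<le> (10 + j) * 6 + 1" by simp
  next
    show "sum_mset ?S \<notin># ?S" using set_S sum_S mem by simp
  qed (use sum_S mem in auto)
qed

section \<open>The generalized Davenport constants\<close>

text \<open>Each split-off block uses at most two terms, and a zero uses only one; hence the
  inequality for the size. What survives has no repetition, so it is a set.\<close>

lemma (in elementary_two_group) reduce_to_set:
  fixes S :: "'a multiset"
  shows "\<exists>(A :: 'a set) j. 0 \<notin> A \<and> size S \<le> 2 * j + card A \<and>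
    (\<forall>k. packs k A \<longrightarrow> has_k_disjoint_zs (j + k) S)"
proof (induction S rule: measure_induct_rule[of size])
  case (less S)
  have split_off: ?case if X: "X \<noteq> {#}" "size X \<le> 2" "sum_mset X = 0" "S = X + T" for X T
  proof -
    have "size T < size S" using X by (simp add: nonempty_has_size)
    then obtain A :: "'a set" and j where A: "0 \<notin> A" "size T \<le> 2 * j + card A"
        "\<And>k. packs k A \<Longrightarrow> has_k_disjoint_zs (j + k) T"
      using less.IH by blast
    have "has_k_disjoint_zs (Suc j + k) S" if "packs k A" for k
      using has_k_disjoint_zs_Suc[OF X(1,3) A(3)[OF that]] X(4) by simp
    moreover have "size S \<le> 2 * Suc j + card A" using X A(2) by simp
    ultimately show ?thesis using A(1) by blast
  qed
  show ?case
  proof (cases "0 \<in># S")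
    case True
    then obtain T where "S = {#0#} + T" by (metis add_mset_add_single mset_add union_commute)
    then show ?thesis using split_off[of "{#0#}" T] by simp
  next
    case False
    show ?thesis
    proof (cases "\<exists>x. count S x \<ge> 2")
      case True
      then obtain x where "count S x \<ge> 2" by blast
      then have "{#x, x#} \<subseteq># S" by (intro mset_subset_eqI) auto
      then obtain T where "S = {#x, x#} + T" by (auto simp: mset_subset_eq_exists_conv)
      then show ?thesis using split_off[of "{#x, x#}" T] double_zero by simp
    next
      case no: False
      have "count S x = count (mset_set (set_mset S)) x" for x
      proof (cases "x \<in># S")
        case True
        then have "count S x \<ge> 1" "\<not> count S x \<ge> 2" using no by auto
        then have "count S x = 1" by linarith
        then show ?thesis using True by simp
      qed (simp add: not_in_iff)
      then have S: "mset_set (set_mset S) = S" by (metis multiset_eqI)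
      then have "size S = card (set_mset S)" by (metis size_mset_set)
      then show ?thesis using False S
        by (intro exI[of _ "set_mset S"] exI[of _ 0]) simp
    qed
  qed
qed

text \<open>The ten thresholds turn out to be the values of \<open>Dk\<close> for \<open>k\<close>
  from 1 to 10.\<close>

definition guaranteed :: "nat \<Rightarrow> nat" where
  "guaranteed n = (if n < 6 then 0 else if n < 10 then 1 else if n < 13 then 2 else
     if n < 16 then 3 else if n < 19 then 4 else if n < 21 then 5 else if n < 23 then 6 else
     if n < 26 then 7 else if n < 28 then 8 else if n < 31 then 9 else 10)"

text \<open>Only the upper end of each range is kept: a small \<open>n\<close> is compensated by
  more split-off blocks, so the critical case is the largest \<open>n\<close> with a given
  guarantee. Linear arithmetic then settles each case.\<close>

lemma guaranteed_cases:
  assumes "n \<le> 31"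
  obtains "n \<le> 5" "guaranteed n = 0" | "n \<le> 9" "guaranteed n = 1" | "n \<le> 12"
    "guaranteed n = 2" | "n \<le> 15" "guaranteed n = 3" | "n \<le> 18" "guaranteed n = 4" | "n
    \<le> 20" "guaranteed n = 5" | "n \<le> 22" "guaranteed n = 6" | "n \<le> 25" "guaranteed n =
    7" | "n \<le> 27" "guaranteed n = 8" | "n \<le> 30" "guaranteed n = 9" | "n \<le> 31"
    "guaranteed n = 10"
proof -
  consider "n < 6" | "6 \<le> n" "n < 10" | "10 \<le> n" "n < 13" | "13 \<le> n" "n < 16" | "16
    \<le> n" "n < 19" | "19 \<le> n" "n < 21" | "21 \<le> n" "n < 23" | "23 \<le> n" "n < 26" |
    "26 \<le> n" "n < 28" | "28 \<le> n" "n < 31" | "31 \<le> n" "n < 32"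
    using assms by linarith
  then show thesis
    by cases (rule that; simp add: guaranteed_def)+
qed

text \<open>The two thresholds not established directly, 19 and 26, exceed 16, so removing a line
  applies.\<close>

lemma packs_guaranteed:
  fixes f :: "int \<Rightarrow> 'a::{ab_group_add,finite}" and A :: "'a set"
  assumes f: "frame f" and A: "0 \<notin> A"
  shows "packs (guaranteed (card A)) A"
proof -
  interpret elementary_two_group_32 "TYPE('a)" using frame_elementary[OF f] .
  have "packs (Suc 4) A" if "card A \<ge> 19"
    using packs_Suc_large[of 16 4 A] packs_4 that A by simp
  moreover have "packs (Suc 7) A" if "card A \<ge> 26"
    using packs_Suc_large[of 23 7 A] packs_large(2)[OF f] that A by simp
  ultimately show ?thesis
    using packs_1[of A] packs_2[of A] packs_3[of A] packs_4[of A] packs_large[OF f A] A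
    by (simp add: guaranteed_def has_k_disjoint_zs_0)
qed

text \<open>After the reduction \<open>S\<close> enters only through the number \<open>j\<close> of
  split-off blocks and the size \<open>n\<close> of the remaining set, so that upper bounds for
  \<open>Dk\<close> become pure arithmetic.\<close>

lemma has_k_disjoint_zs_guaranteed:
  fixes f :: "int \<Rightarrow> 'a::{ab_group_add,finite}" and S :: "'a multiset"
  assumes f: "frame f"
    and enough: "\<And>n j. n \<le> 31 \<Longrightarrow> size S \<le> 2 * j + n \<Longrightarrow> k \<le> j + guaranteed n"
  shows "has_k_disjoint_zs k S"
proof -
  interpret elementary_two_group_32 "TYPE('a)" using frame_elementary[OF f] .
  obtain A :: "'a set" and j where A: "0 \<notin> A" "size S \<le> 2 * j + card A"
      "\<And>k. packs k A \<Longrightarrow> has_k_disjoint_zs (j + k) S"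
    using reduce_to_set[of S] by blast
  have "card (insert 0 A) \<le> 32" using card_mono[of UNIV "insert 0 A"] card_UNIV by simp
  then have "card A \<le> 31" using A(1) by simp
  then have "k \<le> j + guaranteed (card A)" using enough A(2) by blast
  then show ?thesis using A(3)[OF packs_guaranteed[OF f A(1)]] has_k_disjoint_zs_le by blast
qed

section \<open>Exact values\<close>

lemma Dk_eqI:
  fixes G :: "'a::{ab_group_add,finite} itself"
  assumes "\<And>S :: 'a multiset. l \<le> size S \<Longrightarrow> has_k_disjoint_zs k S"
    and "\<not> has_k_disjoint_zs k (S :: 'a multiset)" "Suc (size S) = l"
  shows "Dk G k = l"
  unfolding Dk_def
proof (rule Least_equality)
  fix m assume "\<forall>S :: 'a multiset. m \<le> size S \<longrightarrow> has_k_disjoint_zs k S"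
  then show "l \<le> m" using assms(2,3) by (metis not_less_eq_eq)
qed (use assms(1) in blast)

lemma Dk_frame_list:
  fixes f :: "int \<Rightarrow> 'a::{ab_group_add,finite}"
  assumes f: "frame f" and "\<not> packs k (f ` set xs)" and xs: "distinct xs" "set xs \<subseteq> {1..<32}"
    and "Suc (length xs) = l"
    and "\<And>n j. n \<le> 31 \<Longrightarrow> l \<le> 2 * j + n \<Longrightarrow> k \<le> j + guaranteed n"
  shows "Dk TYPE('a) k = l"
proof (rule Dk_eqI)
  have "inj_on f (set xs)" by (rule inj_on_subset[OF frame_inj[OF f]]) (use xs in auto)
  then show "Suc (size (mset_set (f ` set xs))) = l"
    using assms(5) xs(1) by (simp add: card_image distinct_card)
  fix S :: "'a multiset" assume "l \<le> size S"
  then show "has_k_disjoint_zs k S"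
    using assms(6) by (intro has_k_disjoint_zs_guaranteed[OF f]) auto
qed (use assms in simp)

text \<open>The extremal sets lie in the affine hyperplane for \<open>k \<le> 4\<close>, since its
  points are the light ones; for \<open>k\<close> from 5 to 7 they consist of all 16 of its points
  and a few others. In each case the sum of the list is a nonzero vector outside the list.\<close>

lemma Dk_values:
  fixes f :: "int \<Rightarrow> 'a::{ab_group_add,finite}"
  assumes f: "frame f"
  shows "Dk TYPE('a) 1 = 6" "Dk TYPE('a) 2 = 10" "Dk TYPE('a) 3 = 13" "Dk TYPE('a) 4 = 16"
    "Dk TYPE('a) 5 = 19" "Dk TYPE('a) 6 = 21" "Dk TYPE('a) 7 = 23" "Dk TYPE('a) 8 = 26"
    "Dk TYPE('a) 9 = 28"
proof -
  show "Dk TYPE('a) 1 = 6"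
    by (rule Dk_frame_list[OF f not_packs_hyperplane[OF f], of "[16, 17, 18, 20, 24]"])
      (simp_all, erule guaranteed_cases, linarith+)
  show "Dk TYPE('a) 2 = 10"
    by (rule Dk_frame_list[OF f not_packs_hyperplane[OF f],
        of "[21, 22, 23, 25, 26, 27, 29, 30, 31]"])
      (simp_all, erule guaranteed_cases, linarith+)
  show "Dk TYPE('a) 3 = 13"
    by (rule Dk_frame_list[OF f not_packs_hyperplane[OF f],
        of "[19, 21, 22, 23, 24, 25, 26, 27, 28, 29, 30, 31]"])
      (simp_all, erule guaranteed_cases, linarith+)
  show "Dk TYPE('a) 4 = 16"
    by (rule Dk_frame_list[OF f not_packs_hyperplane[OF f],
        of "[17, 18, 19, 20, 21, 22, 23, 24, 25, 26, 27, 28, 29, 30, 31]"])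
      (simp_all, erule guaranteed_cases, linarith+)
  show "Dk TYPE('a) 5 = 19"
    by (rule Dk_frame_list[OF f not_packs_hyperplane[OF f],
        of "[1, 2, 16, 17, 18, 19, 20, 21, 22, 23, 24, 25, 26, 27, 28, 29, 30, 31]"])
      (simp_all, erule guaranteed_cases, linarith+)
  show "Dk TYPE('a) 6 = 21"
    by (rule Dk_frame_list[OF f not_packs_hyperplane[OF f],
        of "[1, 2, 4, 8, 16, 17, 18, 19, 20, 21, 22, 23, 24, 25, 26, 27, 28, 29, 30, 31]"])
      (simp_all, erule guaranteed_cases, linarith+)
  show "Dk TYPE('a) 7 = 23"
    by (rule Dk_frame_list[OF f not_packs_hyperplane[OF f],
        of "[1, 2, 3, 4, 5, 8, 16, 17, 18, 19, 20, 21, 22, 23, 24, 25, 26, 27, 28, 29, 30, 31]"])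
      (simp_all, erule guaranteed_cases, linarith+)
  \<comment> \<open>From here on, counting three elements per block suffices: 25 is
    \<open>3 * 8 + 1\<close>. The omitted vectors 1, 2, 4, 8, 15, 16 sum to 16, so the chosen ones
    also sum to 16, an omitted vector.\<close>
  show "Dk TYPE('a) 8 = 26"
    by (rule Dk_frame_list[OF f not_packs_lines[OF f],
        of "[3, 5, 6, 7, 9, 10, 11, 12, 13, 14, 17, 18, 19, 20, 21, 22, 23, 24, 25, 26, 27, 28, 29,
          30, 31]"])
      (simp_all, erule guaranteed_cases, linarith+)
  \<comment> \<open>The omitted vectors 1, 2, 3, 4 sum to 4, again one of themselves.\<close>
  show "Dk TYPE('a) 9 = 28"
    by (rule Dk_frame_list[OF f not_packs_lines[OF f],
        of "[5, 6, 7, 8, 9, 10, 11, 12, 13, 14, 15, 16, 17, 18, 19, 20, 21, 22, 23, 24, 25, 26, 27,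
          28, 29, 30, 31]"])
      (simp_all, erule guaranteed_cases, linarith+)
qed

text \<open>The critical case of the upper bound is \<open>n = 30\<close> with nine guaranteed
  blocks: \<open>11 + k * 2 \<le> 2 * j + 30\<close> gives \<open>k - j \<le> 9\<close> only by
  parity. With one term fewer this case fails, and the example realizes it.\<close>

lemma Dk_ge_10:
  fixes f :: "int \<Rightarrow> 'a::{ab_group_add,finite}"
  assumes f: "frame f" and "k \<ge> 10"
  shows "Dk TYPE('a) k = 11 + k * 2"
proof -
  obtain j where k: "k = 10 + j" using assms(2) by (metis le_Suc_ex)
  show ?thesis
  proof (rule Dk_eqI)
    show "\<not> has_k_disjoint_zs k (mset_set (f ` {1..<31}) + replicate_mset (2 * j) (f 1))"
      unfolding k by (rule not_has_k_disjoint_zs_pairs[OF f])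
    have "inj_on f {1..<31}" by (rule inj_on_subset[OF frame_inj[OF f]]) auto
    then show "Suc (size (mset_set (f ` {1..<31}) + replicate_mset (2 * j) (f 1))) = 11 + k * 2"
      by (simp add: card_image k)
    fix S :: "'a multiset" assume "11 + k * 2 \<le> size S"
    then show "has_k_disjoint_zs k S"
      by (intro has_k_disjoint_zs_guaranteed[OF f]) (erule guaranteed_cases, linarith+)
  qed
qed

section \<open>The exponent and the stable range\<close>

lemma grp_exp_frame:
  fixes f :: "int \<Rightarrow> 'a::{ab_group_add,finite}"
  assumes f: "frame f"
  shows "grp_exp TYPE('a) = 2"
  unfolding grp_exp_def
proof (rule Least_equality)
  show "0 < (2::nat) \<and> (\<forall>g::'a. (\<Sum>_<2::nat. g) = 0)"
    using frame_double_zero[OF f] by (simp add: numeral_2_eq_2)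
  fix n :: nat assume n: "0 < n \<and> (\<forall>g::'a. (\<Sum>_<n. g) = 0)"
  have "f 1 \<noteq> f 0" using inj_onD[OF frame_inj[OF f], of 1 0] by auto
  then have "n \<noteq> 1" using n frame_0[OF f] by auto
  with n show "2 \<le> n" by auto
qed

lemma D0_kD_frame:
  fixes f :: "int \<Rightarrow> 'a::{ab_group_add,finite}"
  assumes f: "frame f"
  shows "D0 TYPE('a) = 11" "kD TYPE('a) = 10"
proof -
  show D0: "D0 TYPE('a) = 11"
    unfolding D0_def grp_exp_frame[OF f]
  proof (rule the_equality)
    show "\<exists>K. \<forall>k\<ge>K. Dk TYPE('a) k = 11 + k * 2" using Dk_ge_10[OF f] by blast
    fix d assume "\<exists>K. \<forall>k\<ge>K. Dk TYPE('a) k = d + k * 2"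
    then obtain K where "\<forall>k\<ge>K. Dk TYPE('a) k = d + k * 2" by blast
    \<comment> \<open>Both formulas hold at \<open>max K 10\<close>, where they are
      compared.\<close>
    then show "d = 11" using Dk_ge_10[OF f, of "max K 10"] by (metis add_right_cancel max.cobounded1 max.cobounded2)
  qed
  show "kD TYPE('a) = 10"
    unfolding kD_def D0 grp_exp_frame[OF f]
  proof (rule Least_equality)
    show "1 \<le> (10::nat) \<and> (\<forall>k\<ge>10. Dk TYPE('a) k = 11 + k * 2)" using Dk_ge_10[OF f] by simp
    fix m :: nat assume "1 \<le> m \<and> (\<forall>k\<ge>m. Dk TYPE('a) k = 11 + k * 2)"
    \<comment> \<open>At \<open>k = 9\<close> the linear formula predicts 29 while the value is
      28.\<close>
    then have "\<not> m \<le> 9" using Dk_values(9)[OF f] by fastforce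
    then show "10 \<le> m" by simp
  qed
qed

text \<open>The coordinates of a code are its binary digits, on which exclusive or is addition
  modulo 2. Injectivity comes from the digits, surjectivity from counting 32 elements on both
  sides.\<close>

lemma ex_frame_bit5: "\<exists>f :: int \<Rightarrow> bit ^ 5. frame f"
proof -
  \<comment> \<open>The elements of the index type \<open>5\<close> are not natural numbers, so
    \<open>h\<close> assigns a digit position to each.\<close>
  have "CARD(5) = card {..<5::nat}" by simp
  from finite_same_card_bij[OF finite finite_lessThan this]
  obtain h :: "5 \<Rightarrow> nat" where h: "bij_betw h UNIV {..<5}" by blast
  define f :: "int \<Rightarrow> bit ^ 5" where "f x = (\<chi> i. of_bool (bit x (h i)))" for x
  have inj: "inj_on f {0..<32}"
  proof (rule inj_onI)
    fix x y :: int assume xy: "x \<in> {0..<32}" "y \<in> {0..<32}" "f x = f y"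
    have "bit x n = bit y n" if "n < 5" for n
    proof -
      have "n \<in> h ` UNIV" using h that by (simp add: bij_betw_def)
      then obtain i where "n = h i" by blast
      moreover have "f x $ i = f y $ i" using xy(3) by simp
      ultimately show ?thesis by (simp add: f_def of_bool_eq_iff)
    qed
    then have "take_bit 5 x = take_bit 5 y" by (auto simp: bit_eq_iff bit_take_bit_iff)
    moreover have "take_bit 5 x = x" "take_bit 5 y = y"
      using xy(1,2) by (auto simp: take_bit_int_eq_self_iff)
    ultimately show "x = y" by simp
  qed
  have "(UNIV :: bit set) = {0, 1}" by (auto intro: bit.exhaust)
  then have "CARD(bit) = card {0::bit, 1}" by (rule arg_cong)
  also have "\<dots> = 2" by simp
  finally have "CARD(bit) = 2" .
  then have "card (f ` {0..<32}) = CARD(bit ^ 5)"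
    using card_image[OF inj] by simp
  then have "f ` {0..<32} = UNIV" by (intro card_subset_eq) auto
  moreover have "f (x XOR y) = f x + f y" for x y
    by (auto simp: f_def vec_eq_iff bit_xor_iff)
  ultimately show ?thesis using inj by (auto simp: frame_def bij_betw_def)
qed

theorem theorem7p10:
  shows "D0 C2_5 = 11 \<and> kD C2_5 = 10 \<and>
         Dk C2_5 1 = 6 \<and> Dk C2_5 2 = 10 \<and> Dk C2_5 3 = 13 \<and> Dk C2_5 4 = 16 \<and>
         Dk C2_5 5 = 19 \<and> Dk C2_5 6 = 21 \<and> Dk C2_5 7 = 23 \<and> Dk C2_5 8 = 26 \<and>
         Dk C2_5 9 = 28"
proof -
  obtain f :: "int \<Rightarrow> bit ^ 5" where f: "frame f" using ex_frame_bit5 by blast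
  show ?thesis using D0_kD_frame[OF f] Dk_values[OF f] by blast
qed

end
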